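(* The contravariant functors $\Phi:\mathbf{dVS}\to\mathbf{deV}$ and $\Lambda:\mathbf{deV}\to\mathbf{dVS}$ establish a dual equivalence between the category $\mathbf{deV}$ of de Vries algebras and de Vries morphisms and the category $\mathbf{dVS}$ of $dV$-spaces and $dV$-maps. Here $\Phi(X,\tau)=(\mathsf{RO}(X),\ll)$ for a $dV$-space $(X,\tau)$ and $\Phi(f)(U)=(f^{-1}[U])^{\bot\bot}$ for a $dV$-map $f:(X,\tau_1)\to(Y,\tau_2)$ and $U\in\mathsf{RO}(Y)$; and $\Lambda(V)=(S_V,\sigma)$ for a de Vries algebra $V$ and $\Lambda(h)(F)=\{a\in h^{-1}[F]\mid \exists b\in h^{-1}[F]: b\prec_1 a\}$ for a de Vries morphism $h:V_1\to V_2$ and $F\in S_{V_2}$.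
   Context: The paper's setting is choice-free: the result is intended without use of the Axiom of Choice or the Boolean Prime Ideal Theorem. Topological notation. For a topological space $(X,\tau)$ and $U\subseteq X$: $\overline U$ is the closure, $U^\bot=X\setminus\overline U$, and $\mathsf{RO}(X)$ is the complete Boolean algebra (ordered by inclusion, with meet $\cap$ and complement $U\mapsto U^\bot$) of regular open sets, i.e. sets with $U^{\bot\bot}=U$. The specialization preorder is $x\le y$ iff every open set containing $x$ contains $y$. Put $\mathord{\downarrow}U=\{x\mid\exists y\in U:x\le y\}$ and $\operatorname{Int}_{\le}U=\{x\mid \forall y\ge x:\ y\in U\}$. $\mathcal{RO}(X)$ is the set of $U\subseteq X$ with $\operatorname{Int}_{\le}(\mathord{\downarrow}U)=U$. For $U,V\subseteq X$, $U\ll V$ iff $\overline U\subseteq\mathord{\downarrow}V$. De Vries algebras. A de Vries algebra is a pair $V=(B,\prec)$ with $B$ a complete Boolean algebra and $\prec$ a binary relation on $B$ such that: (A1) $1\prec1$; (A2) $a\prec b$ implies $a\le b$; (A3) $a\le b\prec c\le d$ implies $a\prec d$; (A4) $a\prec b$ and $a\prec c$ imply $a\prec b\wedge c$; (A5) $a\prec b$ implies $\neg b\prec\neg a$; (A6) $a\prec c$ implies $a\prec b\prec c$ for some $b$; (A7) $a\ne0$ implies $b\prec a$ for some $b\neq0$. Filters are proper. A filter $F$ on $B$ is concordant if for every $a\in F$ there is $b\in F$ with $b\prec a$. $S_V$ is the set of all concordant filters on $V$, and $\sigma$ is the topology on $S_V$ generated by the sets $\widehat a=\{F\in S_V\mid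 a\in F\}$, $a\in B$. De Vries morphisms. A de Vries morphism $h:(B_1,\prec_1)\to(B_2,\prec_2)$ is a function $h:B_1\to B_2$ with (V1) $h(0)=0$; (V2) $h(a\wedge b)=h(a)\wedge h(b)$; (V3) $a\prec_1b$ implies $\neg h(\neg a)\prec_2h(b)$; (V4) $h(a)=\bigvee\{h(b)\mid b\prec_1a\}$. The composition in $\mathbf{deV}$ of $h:V_1\to V_2$ and $k:V_2\to V_3$ is $(k\star h)(a)=\bigvee\{k(h(b))\mid b\prec_1a\}$. $dV$-spaces. A space $(X,\tau)$ is order-normal if for any closed set $A$ and any regular closed set $B$ with $A\cap\operatorname{Int}_{\le}B=\emptyset$ there are disjoint open sets $U,W$ with $A\subseteq\mathord{\downarrow}U$ and $\operatorname{Int}_{\le}B\subseteq W$. A $dV$-space is a topological space $(X,\tau)$ such that: (i) it is $T_0$, compact and order-normal; (ii) $\mathsf{RO}(X)$ is a basis for $\tau$ and $\mathsf{RO}(X)\subseteq\mathcal{RO}(X)$; (iii) for every $x\in X$, $\mathsf{RO}(x)=\{U\in\mathsf{RO}(X)\mid x\in U\}$ is a concordant filter on $(\mathsf{RO}(X),\ll)$, and for every (proper) filter $F$ on $\mathsf{RO}(X)$ there is $x\in X$ with $\{U\in F\mid\exists W\in F: W\ll U\}=\mathsf{RO}(x)$. $dV$-maps. A $dV$-map $f:X\to Y$ between $dV$-spaces (with specialization orders $\le_1,\le_2$) is a continuous function that is weakly dense: whenever $f(x)\le_2y$ there is $x'\ge_1x$ with $y\le_2f(x')$. Composition in $\mathbf{dVS}$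 is ordinary composition of functions. *)

theory Defs
  imports "HOL-Analysis.Analysis" "HOL-Algebra.Complete_Lattice"
begin

section \<open>Categories and contravariant functors\<close>

text \<open>In \<open>Cmp C X Y Z g f\<close> the arrow \<open>f : X \<rightarrow> Y\<close> is applied first and \<open>g : Y \<rightarrow> Z\<close> second.\<close>

record ('o, 'm) cat =
  Obj :: "'o set"
  Hom :: "'o \<Rightarrow> 'o \<Rightarrow> 'm set"
  Idm :: "'o \<Rightarrow> 'm"
  Cmp :: "'o \<Rightarrow> 'o \<Rightarrow> 'o \<Rightarrow> 'm \<Rightarrow> 'm \<Rightarrow> 'm"

definition category :: "('o, 'm) cat \<Rightarrow> bool" where
  "category C \<longleftrightarrow>
     (\<forall>X\<in>Obj C. Idm C X \<in> Hom C X X) \<and>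
     (\<forall>X\<in>Obj C. \<forall>Y\<in>Obj C. \<forall>Z\<in>Obj C. \<forall>f\<in>Hom C X Y. \<forall>g\<in>Hom C Y Z.
        Cmp C X Y Z g f \<in> Hom C X Z) \<and>
     (\<forall>X\<in>Obj C. \<forall>Y\<in>Obj C. \<forall>f\<in>Hom C X Y.
        Cmp C X X Y f (Idm C X) = f \<and> Cmp C X Y Y (Idm C Y) f = f) \<and>
     (\<forall>W\<in>Obj C. \<forall>X\<in>Obj C. \<forall>Y\<in>Obj C. \<forall>Z\<in>Obj C.
        \<forall>f\<in>Hom C W X. \<forall>g\<in>Hom C X Y. \<forall>h\<in>Hom C Y Z.
          Cmp C W X Z (Cmp C X Y Z h g) f = Cmp C W Y Z h (Cmp C W X Y g f))"

definition contravariant_functor ::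
  "('o, 'm) cat \<Rightarrow> ('p, 'n) cat \<Rightarrow> ('o \<Rightarrow> 'p) \<Rightarrow> ('o \<Rightarrow> 'o \<Rightarrow> 'm \<Rightarrow> 'n) \<Rightarrow> bool" where
  "contravariant_functor C D F Fm \<longleftrightarrow>
     category C \<and> category D \<and>
     (\<forall>X\<in>Obj C. F X \<in> Obj D) \<and>
     (\<forall>X\<in>Obj C. \<forall>Y\<in>Obj C. \<forall>f\<in>Hom C X Y. Fm X Y f \<in> Hom D (F Y) (F X)) \<and>
     (\<forall>X\<in>Obj C. Fm X X (Idm C X) = Idm D (F X)) \<and>
     (\<forall>X\<in>Obj C. \<forall>Y\<in>Obj C. \<forall>Z\<in>Obj C. \<forall>f\<in>Hom C X Y. \<forall>g\<in>Hom C Y Z.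
        Fm X Z (Cmp C X Y Z g f) = Cmp D (F Z) (F Y) (F X) (Fm X Y f) (Fm Y Z g))"


section \<open>De Vries algebras\<close>

locale complete_Boolean_lattice = complete_lattice +
  assumes meet_join_distrib:
      "\<lbrakk>x \<in> carrier L; y \<in> carrier L; z \<in> carrier L\<rbrakk>
         \<Longrightarrow> x \<sqinter> (y \<squnion> z) = (x \<sqinter> y) \<squnion> (x \<sqinter> z)"
    and complement_exists:
      "x \<in> carrier L \<Longrightarrow> \<exists>y\<in>carrier L. x \<sqinter> y = \<bottom> \<and> x \<squnion> y = \<top>"

definition compl :: "('a, 'b) gorder_scheme \<Rightarrow> 'a \<Rightarrow> 'a" where
  "compl L x = (THE y. y \<in> carrier L \<and> x \<sqinter>\<^bsub>L\<^esub> y = \<bottom>\<^bsub>L\<^esub> \<and> x \<squnion>\<^bsub>L\<^esub> y = \<top>\<^bsub>L\<^esub>)"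

record 'a dv_struct = "'a gorder" +
  prec :: "'a \<Rightarrow> 'a \<Rightarrow> bool" (infixl \<open>\<prec>\<index>\<close> 50)

text \<open>The one-element Boolean algebra is allowed; it corresponds to the empty space.\<close>

locale deVries_algebra = complete_Boolean_lattice V for V :: "'a dv_struct" (structure) +
  assumes A1: "\<top> \<prec> \<top>"
    and A2: "\<lbrakk>a \<in> carrier V; b \<in> carrier V; a \<prec> b\<rbrakk> \<Longrightarrow> a \<sqsubseteq> b"
    and A3: "\<lbrakk>a \<in> carrier V; b \<in> carrier V; c \<in> carrier V; d \<in> carrier V;
              a \<sqsubseteq> b; b \<prec> c; c \<sqsubseteq> d\<rbrakk> \<Longrightarrow> a \<prec> d"
    and A4: "\<lbrakk>a \<in> carrier V; b \<in> carrier V; c \<in> carrier V; a \<prec> b; a \<prec> c\<rbrakk> \<Longrightarrow> a \<prec> b \<sqinter> c"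
    and A5: "\<lbrakk>a \<in> carrier V; b \<in> carrier V; a \<prec> b\<rbrakk> \<Longrightarrow> compl V b \<prec> compl V a"
    and A6: "\<lbrakk>a \<in> carrier V; c \<in> carrier V; a \<prec> c\<rbrakk> \<Longrightarrow> \<exists>b\<in>carrier V. a \<prec> b \<and> b \<prec> c"
    and A7: "\<lbrakk>a \<in> carrier V; a \<noteq> \<bottom>\<rbrakk> \<Longrightarrow> \<exists>b\<in>carrier V. b \<noteq> \<bottom> \<and> b \<prec> a"

definition proper_filter :: "('a, 'b) gorder_scheme \<Rightarrow> 'a set \<Rightarrow> bool" where
  "proper_filter L F \<longleftrightarrow>
     F \<subseteq> carrier L \<and> F \<noteq> {} \<and> \<bottom>\<^bsub>L\<^esub> \<notin> F \<and>
     (\<forall>a\<in>F. \<forall>b\<in>carrier L. a \<sqsubseteq>\<^bsub>L\<^esub> b \<longrightarrow> b \<in> F) \<and>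
     (\<forall>a\<in>F. \<forall>b\<in>F. a \<sqinter>\<^bsub>L\<^esub> b \<in> F)"

definition concordant_filter :: "'a dv_struct \<Rightarrow> 'a set \<Rightarrow> bool" where
  "concordant_filter V F \<longleftrightarrow> proper_filter V F \<and> (\<forall>a\<in>F. \<exists>b\<in>F. b \<prec>\<^bsub>V\<^esub> a)"

text \<open>Morphisms are extensional functions (equal to \<^const>\<open>undefined\<close> off the carrier), so that
  equality of functions is equality of morphisms. The two algebras may live on different types.\<close>

definition deV_hom :: "'a dv_struct \<Rightarrow> 'b dv_struct \<Rightarrow> ('a \<Rightarrow> 'b) set" where
  "deV_hom V W = {h \<in> carrier V \<rightarrow>\<^sub>E carrier W.
     h \<bottom>\<^bsub>V\<^esub> = \<bottom>\<^bsub>W\<^esub> \<and>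
     (\<forall>a\<in>carrier V. \<forall>b\<in>carrier V. h (a \<sqinter>\<^bsub>V\<^esub> b) = h a \<sqinter>\<^bsub>W\<^esub> h b) \<and>
     (\<forall>a\<in>carrier V. \<forall>b\<in>carrier V. a \<prec>\<^bsub>V\<^esub> b \<longrightarrow> compl W (h (compl V a)) \<prec>\<^bsub>W\<^esub> h b) \<and>
     (\<forall>a\<in>carrier V. h a = \<Squnion>\<^bsub>W\<^esub> {h b | b. b \<in> carrier V \<and> b \<prec>\<^bsub>V\<^esub> a})}"

definition deV_id :: "'a dv_struct \<Rightarrow> 'a \<Rightarrow> 'a" where
  "deV_id V = (\<lambda>a\<in>carrier V. a)"

text \<open>The composite \<open>k \<star> h\<close> of \<open>h : V1 \<rightarrow> V2\<close> and \<open>k : V2 \<rightarrow> V3\<close>; the middle algebra is not needed.\<close>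

definition deV_comp ::
  "'a dv_struct \<Rightarrow> 'c dv_struct \<Rightarrow> ('b \<Rightarrow> 'c) \<Rightarrow> ('a \<Rightarrow> 'b) \<Rightarrow> 'a \<Rightarrow> 'c" where
  "deV_comp V1 V3 k h =
     (\<lambda>a\<in>carrier V1. \<Squnion>\<^bsub>V3\<^esub> {k (h b) | b. b \<in> carrier V1 \<and> b \<prec>\<^bsub>V1\<^esub> a})"

definition deV_iso :: "'a dv_struct \<Rightarrow> 'b dv_struct \<Rightarrow> ('a \<Rightarrow> 'b) \<Rightarrow> bool" where
  "deV_iso V W h \<longleftrightarrow> h \<in> deV_hom V W \<and>
     (\<exists>k\<in>deV_hom W V. deV_comp V V k h = deV_id V \<and> deV_comp W W h k = deV_id W)"

definition deV :: "('a dv_struct, 'a \<Rightarrow> 'a) cat" where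
  "deV = \<lparr>Obj = {V. deVries_algebra V}, Hom = deV_hom, Idm = deV_id,
          Cmp = (\<lambda>V1 V2 V3 k h. deV_comp V1 V3 k h)\<rparr>"


section \<open>Topological notions\<close>

definition perp :: "'x topology \<Rightarrow> 'x set \<Rightarrow> 'x set" where
  "perp X U = topspace X - X closure_of U"

definition reg_open :: "'x topology \<Rightarrow> 'x set set" where
  "reg_open X = {U. U \<subseteq> topspace X \<and> perp X (perp X U) = U}"

definition regular_closedin :: "'x topology \<Rightarrow> 'x set \<Rightarrow> bool" where
  "regular_closedin X B \<longleftrightarrow> B \<subseteq> topspace X \<and> X closure_of (X interior_of B) = B"

definition spec_le :: "'x topology \<Rightarrow> 'x \<Rightarrow> 'x \<Rightarrow> bool" where
  "spec_le X x y \<longleftrightarrow> x \<in> topspace X \<and> y \<in> topspace X \<and>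
     (\<forall>U. openin X U \<and> x \<in> U \<longrightarrow> y \<in> U)"

definition down :: "'x topology \<Rightarrow> 'x set \<Rightarrow> 'x set" where
  "down X U = {x \<in> topspace X. \<exists>y\<in>U. spec_le X x y}"

definition Int_le :: "'x topology \<Rightarrow> 'x set \<Rightarrow> 'x set" where
  "Int_le X U = {x \<in> topspace X. \<forall>y. spec_le X x y \<longrightarrow> y \<in> U}"

definition order_reg_open :: "'x topology \<Rightarrow> 'x set set" where
  "order_reg_open X = {U. U \<subseteq> topspace X \<and> Int_le X (down X U) = U}"

definition well_inside :: "'x topology \<Rightarrow> 'x set \<Rightarrow> 'x set \<Rightarrow> bool" where
  "well_inside X U V \<longleftrightarrow> X closure_of U \<subseteq> down X V"

text \<open>The structure \<open>(RO(X), \<lless>)\<close>. Meet, join and complement are those of the inclusion order.\<close>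

definition RO_struct :: "'x topology \<Rightarrow> 'x set dv_struct" where
  "RO_struct X = \<lparr>carrier = reg_open X, eq = (=), le = (\<subseteq>), prec = well_inside X\<rparr>"

definition reg_open_at :: "'x topology \<Rightarrow> 'x \<Rightarrow> 'x set set" where
  "reg_open_at X x = {U \<in> reg_open X. x \<in> U}"


section \<open>dV-spaces\<close>

definition order_normal_space :: "'x topology \<Rightarrow> bool" where
  "order_normal_space X \<longleftrightarrow>
     (\<forall>A B. closedin X A \<and> regular_closedin X B \<and> A \<inter> Int_le X B = {} \<longrightarrow>
        (\<exists>U W. openin X U \<and> openin X W \<and> disjnt U W \<and> A \<subseteq> down X U \<and> Int_le X B \<subseteq> W))"

definition dV_space :: "'x topology \<Rightarrow> bool" where
  "dV_space X \<longleftrightarrow>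
     t0_space X \<and> compact_space X \<and> order_normal_space X \<and>
     openin X = arbitrary union_of (\<lambda>U. U \<in> reg_open X) \<and>
     reg_open X \<subseteq> order_reg_open X \<and>
     (\<forall>x\<in>topspace X. concordant_filter (RO_struct X) (reg_open_at X x)) \<and>
     (\<forall>F. proper_filter (RO_struct X) F \<longrightarrow>
        (\<exists>x\<in>topspace X. {U \<in> F. \<exists>W\<in>F. well_inside X W U} = reg_open_at X x))"

definition dVS_hom :: "'x topology \<Rightarrow> 'y topology \<Rightarrow> ('x \<Rightarrow> 'y) set" where
  "dVS_hom X Y = {f \<in> topspace X \<rightarrow>\<^sub>E topspace Y. continuous_map X Y f \<and>
     (\<forall>x\<in>topspace X. \<forall>y\<in>topspace Y. spec_le Y (f x) y \<longrightarrow>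
        (\<exists>x'\<in>topspace X. spec_le X x x' \<and> spec_le Y y (f x')))}"

definition dVS_id :: "'x topology \<Rightarrow> 'x \<Rightarrow> 'x" where
  "dVS_id X = (\<lambda>x\<in>topspace X. x)"

definition dVS_comp :: "'x topology \<Rightarrow> ('y \<Rightarrow> 'z) \<Rightarrow> ('x \<Rightarrow> 'y) \<Rightarrow> 'x \<Rightarrow> 'z" where
  "dVS_comp X g f = compose (topspace X) g f"

definition dVS_iso :: "'x topology \<Rightarrow> 'y topology \<Rightarrow> ('x \<Rightarrow> 'y) \<Rightarrow> bool" where
  "dVS_iso X Y f \<longleftrightarrow> f \<in> dVS_hom X Y \<and>
     (\<exists>g\<in>dVS_hom Y X. dVS_comp X g f = dVS_id X \<and> dVS_comp Y f g = dVS_id Y)"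

definition dVS :: "('x topology, 'x \<Rightarrow> 'x) cat" where
  "dVS = \<lparr>Obj = {X. dV_space X}, Hom = dVS_hom, Idm = dVS_id,
          Cmp = (\<lambda>X Y Z g f. dVS_comp X g f)\<rparr>"


section \<open>The functors\<close>

definition Phi :: "'x topology \<Rightarrow> 'x set dv_struct" where
  "Phi X = RO_struct X"

definition Phi_map :: "'x topology \<Rightarrow> 'y topology \<Rightarrow> ('x \<Rightarrow> 'y) \<Rightarrow> 'y set \<Rightarrow> 'x set" where
  "Phi_map X Y f = (\<lambda>U\<in>reg_open Y. perp X (perp X {x \<in> topspace X. f x \<in> U}))"

definition conc_filters :: "'a dv_struct \<Rightarrow> 'a set set" where
  "conc_filters V = {F. concordant_filter V F}"

text \<open>The underlying set of this topology is \<open>conc_filters V\<close>, because every filter contains \<open>\<top>\<close>.\<close>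

definition Lambda :: "'a dv_struct \<Rightarrow> 'a set topology" where
  "Lambda V = topology_generated_by {{F \<in> conc_filters V. a \<in> F} | a. a \<in> carrier V}"

definition Lambda_map ::
  "'a dv_struct \<Rightarrow> 'b dv_struct \<Rightarrow> ('a \<Rightarrow> 'b) \<Rightarrow> 'b set \<Rightarrow> 'a set" where
  "Lambda_map V1 V2 h =
     (\<lambda>F\<in>conc_filters V2. {a \<in> carrier V1. h a \<in> F \<and>
        (\<exists>b\<in>carrier V1. h b \<in> F \<and> b \<prec>\<^bsub>V1\<^esub> a)})"


section \<open>Natural isomorphisms with an identity functor\<close>

text \<open>\<^const>\<open>dVS\<close> on the type \<open>'x\<close> has as objects all dV-spaces whose points form a subset of \<open>'x\<close>, and
  \<open>\<Lambda>\<Phi>\<close> sends such a space to one with points in \<open>'x set set\<close>. The two definitions below therefore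
  speak of a covariant functor (object part \<open>G\<close>, arrow part \<open>Gm\<close>) into the same category over
  another type, the identity functor standing for the inclusion. Since \<open>'x\<close> and \<open>'a\<close> are arbitrary
  and objects on two types can be transported to their sum type, it is no restriction that source
  and target of an arrow in \<^const>\<open>dVS\<close> or \<^const>\<open>deV\<close> share a type.\<close>

definition dVS_natural_iso_from_id ::
  "('x topology \<Rightarrow> 'y topology) \<Rightarrow> ('x topology \<Rightarrow> 'x topology \<Rightarrow> ('x \<Rightarrow> 'x) \<Rightarrow> 'y \<Rightarrow> 'y)
     \<Rightarrow> ('x topology \<Rightarrow> 'x \<Rightarrow> 'y) \<Rightarrow> bool" where
  "dVS_natural_iso_from_id G Gm \<eta> \<longleftrightarrow>
     (\<forall>X\<in>Obj dVS. G X \<in> Obj dVS \<and> dVS_iso X (G X) (\<eta> X)) \<and>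
     (\<forall>X\<in>Obj dVS. \<forall>Y\<in>Obj dVS. \<forall>f\<in>Hom dVS X Y.
        dVS_comp X (Gm X Y f) (\<eta> X) = dVS_comp X (\<eta> Y) f)"

definition deV_natural_iso_from_id ::
  "('a dv_struct \<Rightarrow> 'b dv_struct) \<Rightarrow> ('a dv_struct \<Rightarrow> 'a dv_struct \<Rightarrow> ('a \<Rightarrow> 'a) \<Rightarrow> 'b \<Rightarrow> 'b)
     \<Rightarrow> ('a dv_struct \<Rightarrow> 'a \<Rightarrow> 'b) \<Rightarrow> bool" where
  "deV_natural_iso_from_id G Gm \<epsilon> \<longleftrightarrow>
     (\<forall>V\<in>Obj deV. G V \<in> Obj deV \<and> deV_iso V (G V) (\<epsilon> V)) \<and>
     (\<forall>V\<in>Obj deV. \<forall>W\<in>Obj deV. \<forall>h\<in>Hom deV V W.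
        deV_comp V (G W) (Gm V W h) (\<epsilon> V) = deV_comp V (G W) (\<epsilon> W) h)"

end

theory Submission
  imports Defs
begin

text \<open>For a de Vries algebra \<open>V\<close> the basic open sets \<open>hat V a\<close> satisfy
  \<open>(\<Union>\<^sub>i hat V a\<^sub>i)\<^sup>\<bottom> = hat V (\<not> \<Or>\<^sub>i a\<^sub>i)\<close>, because axiom A7 puts a concordant filter through every
  nonzero element. Hence \<open>hat V\<close> identifies \<open>V\<close> with the regular open sets of its space of concordant
  filters. That \<open>\<prec>\<close> becomes \<open>\<lless>\<close>, and that the space is order-normal, rests on one extension
  argument: if \<open>a \<prec> b\<close> and \<open>\<not>a \<notin> F\<close>, then \<open>F\<close> extends to a concordant filter containing \<open>b\<close>;
  while \<open>{x. \<not>b \<prec> x}\<close> is a concordant filter none of whose concordant extensions contains \<open>b\<close>.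

  Conversely, in a dV-space the round part \<open>{U \<in> F. \<exists>W\<in>F. W \<lless> U}\<close> of a filter \<open>F\<close> of regular open
  sets is by assumption some \<open>RO(x)\<close>, so it is a concordant filter; applied to principal filters,
  this yields A4 and A6. It also shows that the concordant filters are exactly the sets \<open>RO(x)\<close>, so
  that \<open>x \<mapsto> RO(x)\<close> is a homeomorphism onto the dual space of \<open>(RO(X), \<lless>)\<close>. No maximal or prime
  filters are used.\<close>

text \<open>Using all concordant filters instead of maximal ones dispenses with choice, but such a
  filter may contain neither \<open>a\<close> nor its complement. The closure of
  \<open>hat V a\<close> consists of the filters that omit \<open>compl V a\<close>; these need not
  contain a given \<open>b\<close> with \<open>a \<prec> b\<close> and can only be extended to
  contain it. Since specialization in the dual space is inclusion of filters, this is why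
  \<open>\<lless>\<close>, order-normality and order-regularity are stated with \<open>down\<close>
  and \<open>Int_le\<close>.

  Morphisms lose precision in a similar way: the double complement of a preimage may exceed the
  preimage, and the round part of the preimage of a filter may be smaller than the preimage. One
  step of \<open>\<prec>\<close> absorbs either error. This is the reason for the join over
  \<open>b \<prec> a\<close> in the composition of de Vries morphisms, and arguments about
  composites use A6 to make room for such a step.\<close>

no_notation lesspoll (infixl "\<prec>" 50)

section \<open>Complete Boolean lattices\<close>

context complete_Boolean_lattice
begin

text \<open>These rules of the weak-order library apply to every membership or equality goal and make
  the classical reasoner loop.\<close>

declare le_cong_l [rule del] le_cong_r [rule del] weak_refl [rule del] weak_refl [simp del]
  le_antisym [rule del] is_closed_eq [rule del] is_closed_eq_rev [rule del]
  least_closed [rule del] greatest_closed [rule del] GFP_fixed_point [rule del]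
  LFP_fixed_point [rule del] at_least_at_most_member [rule del]
  Upper_elemD [rule del] Upper_memD [rule del] Lower_memD [rule del]

lemma eq_bottomI: "\<lbrakk>x \<in> carrier L; x \<sqsubseteq> \<bottom>\<rbrakk> \<Longrightarrow> x = \<bottom>"
  by (simp add: bottom_lower le_antisym)

lemma meet_mono:
  assumes "x \<in> carrier L" "x' \<in> carrier L" "y \<in> carrier L" "y' \<in> carrier L" "x \<sqsubseteq> x'" "y \<sqsubseteq> y'"
  shows "x \<sqinter> y \<sqsubseteq> x' \<sqinter> y'"
  using assms by (meson le_trans meet_closed meet_le meet_left meet_right)

text \<open>Distributivity puts any element disjoint from \<open>x\<close> below any element whose
  join with \<open>x\<close> is top; uniqueness uses this in both directions.\<close>

lemma compl_unique:
  assumes "x \<in> carrier L" "y \<in> carrier L" "z \<in> carrier L"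
    and "x \<sqinter> y = \<bottom>" "x \<squnion> y = \<top>" "x \<sqinter> z = \<bottom>" "x \<squnion> z = \<top>"
  shows "y = z"
proof -
  have *: "u \<sqsubseteq> v"
    if "u \<in> carrier L" "v \<in> carrier L" "x \<sqinter> u = \<bottom>" "x \<squnion> v = \<top>" for u v
  proof -
    have "u = u \<sqinter> (x \<squnion> v)"
      using that top_meet[of u] by (simp add: eq_is_equal meet_comm)
    also have "\<dots> = (u \<sqinter> x) \<squnion> (u \<sqinter> v)"
      using that assms(1) by (intro meet_join_distrib)
    also have "\<dots> = u \<sqinter> v"
      using that bottom_join[of "u \<sqinter> v"] by (simp add: eq_is_equal meet_comm[of L u x])
    finally show ?thesis
      using that by (metis meet_right)
  qed
  show ?thesis
    using assms by (simp add: * le_antisym)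
qed

lemma complE:
  assumes "x \<in> carrier L"
  shows "compl L x \<in> carrier L \<and> x \<sqinter> compl L x = \<bottom> \<and> x \<squnion> compl L x = \<top>"
proof -
  have "\<exists>!y. y \<in> carrier L \<and> x \<sqinter> y = \<bottom> \<and> x \<squnion> y = \<top>"
    using complement_exists[OF assms] compl_unique[OF assms] by blast
  then show ?thesis
    unfolding compl_def by (rule theI')
qed

lemma compl_closed [simp]: "x \<in> carrier L \<Longrightarrow> compl L x \<in> carrier L"
  and meet_compl: "x \<in> carrier L \<Longrightarrow> x \<sqinter> compl L x = \<bottom>"
  and join_compl: "x \<in> carrier L \<Longrightarrow> x \<squnion> compl L x = \<top>"
  using complE by auto

lemma compl_eqI:
  assumes "x \<in> carrier L" "y \<in> carrier L" "x \<sqinter> y = \<bottom>" "x \<squnion> y = \<top>"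
  shows "compl L x = y"
  using compl_unique[of x "compl L x" y] assms complE by auto

lemma compl_compl [simp]: "x \<in> carrier L \<Longrightarrow> compl L (compl L x) = x"
  by (rule compl_eqI) (auto simp: meet_comm[of L _ x] join_comm[of L _ x] meet_compl join_compl)

text \<open>The complement of \<open>y\<close> is the largest element disjoint from
  \<open>y\<close>. Rewriting disjointness as an inequality is what makes infinite joins manageable
  later.\<close>

lemma meet_eq_bottom_iff:
  assumes x: "x \<in> carrier L" and y: "y \<in> carrier L"
  shows "x \<sqinter> y = \<bottom> \<longleftrightarrow> x \<sqsubseteq> compl L y"
proof
  assume *: "x \<sqinter> y = \<bottom>"
  have "x = x \<sqinter> (y \<squnion> compl L y)"
    using x y top_meet[of x] by (simp add: eq_is_equal meet_comm join_compl)
  also have "\<dots> = (x \<sqinter> y) \<squnion> (x \<sqinter> compl L y)"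
    using x y by (simp add: meet_join_distrib)
  also have "\<dots> = x \<sqinter> compl L y"
    using x y * bottom_join[of "x \<sqinter> compl L y"] by (simp add: eq_is_equal)
  finally show "x \<sqsubseteq> compl L y"
    using x y by (metis compl_closed meet_right)
next
  assume "x \<sqsubseteq> compl L y"
  then have "x \<sqinter> y \<sqsubseteq> compl L y \<sqinter> y"
    using x y by (simp add: meet_mono)
  then show "x \<sqinter> y = \<bottom>"
    using x y by (simp add: meet_comm[of L "compl L y"] meet_compl eq_bottomI)
qed

lemma le_compl_iff:
  "\<lbrakk>x \<in> carrier L; y \<in> carrier L\<rbrakk> \<Longrightarrow> x \<sqsubseteq> compl L y \<longleftrightarrow> y \<sqsubseteq> compl L x"
  by (metis meet_comm meet_eq_bottom_iff)

lemma compl_antimono: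
  "\<lbrakk>x \<in> carrier L; y \<in> carrier L; x \<sqsubseteq> y\<rbrakk> \<Longrightarrow> compl L y \<sqsubseteq> compl L x"
  by (metis compl_closed compl_compl le_compl_iff)

lemma le_iff_meet_compl:
  "\<lbrakk>x \<in> carrier L; y \<in> carrier L\<rbrakk> \<Longrightarrow> x \<sqsubseteq> y \<longleftrightarrow> x \<sqinter> compl L y = \<bottom>"
  by (simp add: meet_eq_bottom_iff)

lemma compl_bottom: "compl L \<bottom> = \<top>"
  by (metis bottom_closed bottom_join compl_closed eq_is_equal join_compl)

lemma compl_top: "compl L \<top> = \<bottom>"
  by (metis bottom_closed compl_bottom compl_compl)

text \<open>Disjointness from \<open>y\<close> means lying below \<open>compl L y\<close>, and a
  join lies below that bound as soon as all its members do.\<close>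

lemma sup_meet_eq_bottom_iff:
  assumes "A \<subseteq> carrier L" "y \<in> carrier L"
  shows "(\<Squnion>A) \<sqinter> y = \<bottom> \<longleftrightarrow> (\<forall>a\<in>A. a \<sqinter> y = \<bottom>)"
proof -
  have "(\<Squnion>A) \<sqsubseteq> compl L y \<longleftrightarrow> (\<forall>a\<in>A. a \<sqsubseteq> compl L y)"
    using assms by (meson compl_closed le_trans subsetD sup_closed sup_least sup_upper)
  then show ?thesis
    using assms by (simp add: meet_eq_bottom_iff subset_iff)
qed

lemma sup_eqI:
  assumes "A \<subseteq> carrier L" "x \<in> carrier L"
    and "\<And>a. a \<in> A \<Longrightarrow> a \<sqsubseteq> x"
    and "\<And>u. \<lbrakk>u \<in> carrier L; \<forall>a\<in>A. a \<sqsubseteq> u\<rbrakk> \<Longrightarrow> x \<sqsubseteq> u"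
  shows "\<Squnion>A = x"
  using assms by (simp add: le_antisym sup_least sup_upper)

text \<open>Moving \<open>compl L u\<close> into the meet reduces the claim to
  \<open>sup_meet_eq_bottom_iff\<close>, applied to each join in turn. This half of infinite
  distributivity lets composites of de Vries morphisms preserve meets.\<close>

lemma sup_meet_sup_le:
  assumes A: "A \<subseteq> carrier L" and B: "B \<subseteq> carrier L" and u: "u \<in> carrier L"
    and *: "\<And>a b. \<lbrakk>a \<in> A; b \<in> B\<rbrakk> \<Longrightarrow> a \<sqinter> b \<sqsubseteq> u"
  shows "(\<Squnion>A) \<sqinter> (\<Squnion>B) \<sqsubseteq> u"
proof -
  have cA: "a \<in> carrier L" if "a \<in> A" for a using A that by auto
  have cB: "b \<in> carrier L" if "b \<in> B" for b using B that by auto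
  have "a \<sqinter> ((\<Squnion>B) \<sqinter> compl L u) = \<bottom>" if a: "a \<in> A" for a
  proof -
    have "b \<sqinter> (a \<sqinter> compl L u) = \<bottom>" if "b \<in> B" for b
    proof -
      have "b \<sqinter> (a \<sqinter> compl L u) = (a \<sqinter> b) \<sqinter> compl L u"
        using cA[OF a] cB[OF that] u by (metis compl_closed meet_assoc meet_comm)
      then show ?thesis
        using le_iff_meet_compl *[OF a that] cA[OF a] cB[OF that] u by simp
    qed
    then have "(\<Squnion>B) \<sqinter> (a \<sqinter> compl L u) = \<bottom>"
      using B u cA[OF a] by (subst sup_meet_eq_bottom_iff) auto
    then show ?thesis
      using cA[OF a] B u by (metis compl_closed meet_assoc meet_comm sup_closed)
  qed
  then have "(\<Squnion>A) \<sqinter> ((\<Squnion>B) \<sqinter> compl L u) = \<bottom>"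
    using A B u by (subst sup_meet_eq_bottom_iff) auto
  then show ?thesis
    using A B u by (simp add: le_iff_meet_compl meet_assoc)
qed

end

section \<open>Concordant filters and the topology they carry\<close>

text \<open>The set that occurs in the last clause of \<open>dV_space\<close>; applied to the
  preimage of a filter it also gives \<open>Lambda_map\<close>.\<close>

definition round_part :: "'a dv_struct \<Rightarrow> 'a set \<Rightarrow> 'a set" where
  "round_part V F = {a \<in> F. \<exists>b\<in>F. b \<prec>\<^bsub>V\<^esub> a}"

definition hat :: "'a dv_struct \<Rightarrow> 'a \<Rightarrow> 'a set set" where
  "hat V a = {F \<in> conc_filters V. a \<in> F}"

lemma proper_filterD:
  assumes "proper_filter L F"
  shows "F \<subseteq> carrier L" "F \<noteq> {}" "\<bottom>\<^bsub>L\<^esub> \<notin> F"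
    and "\<And>a b. \<lbrakk>a \<in> F; b \<in> carrier L; a \<sqsubseteq>\<^bsub>L\<^esub> b\<rbrakk> \<Longrightarrow> b \<in> F"
    and "\<And>a b. \<lbrakk>a \<in> F; b \<in> F\<rbrakk> \<Longrightarrow> a \<sqinter>\<^bsub>L\<^esub> b \<in> F"
  using assms by (simp_all add: proper_filter_def)

lemma conc_filtersD:
  assumes "F \<in> conc_filters V"
  shows "proper_filter V F" and "\<And>a. a \<in> F \<Longrightarrow> \<exists>b\<in>F. b \<prec>\<^bsub>V\<^esub> a"
  using assms by (simp_all add: conc_filters_def concordant_filter_def)

lemma round_part_eq: "F \<in> conc_filters V \<Longrightarrow> round_part V F = F"
  using conc_filtersD(2)[of F V] unfolding round_part_def by (intro equalityI subsetI) simp_all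

lemma openin_perp: "openin X (perp X U)"
  unfolding perp_def by (intro openin_diff) simp_all

section \<open>Constructing concordant filters\<close>

context deVries_algebra
begin

lemma filter_carrier: "F \<in> conc_filters V \<Longrightarrow> a \<in> F \<Longrightarrow> a \<in> carrier V"
  using conc_filtersD(1)[of F V] proper_filterD(1)[of V F] by auto

lemma filter_up: "\<lbrakk>F \<in> conc_filters V; a \<in> F; b \<in> carrier V; a \<sqsubseteq> b\<rbrakk> \<Longrightarrow> b \<in> F"
  by (rule proper_filterD(4)[OF conc_filtersD(1)])

lemma filter_meet: "\<lbrakk>F \<in> conc_filters V; a \<in> F; b \<in> F\<rbrakk> \<Longrightarrow> a \<sqinter> b \<in> F"
  by (rule proper_filterD(5)[OF conc_filtersD(1)])

lemma filter_proper: "F \<in> conc_filters V \<Longrightarrow> \<bottom> \<notin> F"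
  by (rule proper_filterD(3)[OF conc_filtersD(1)])

lemma filter_disjoint:
  "\<lbrakk>F \<in> conc_filters V; a \<in> F; b \<in> F\<rbrakk> \<Longrightarrow> a \<sqinter> b \<noteq> \<bottom>"
  using filter_meet[of F a b] filter_proper[of F] by auto

lemma filter_top:
  assumes "F \<in> conc_filters V"
  shows "\<top> \<in> F"
proof -
  obtain a where "a \<in> F"
    using conc_filtersD(1)[OF assms] proper_filterD(2) by blast
  then show ?thesis
    using assms filter_carrier[of F a] filter_up[of F a \<top>] top_higher[of a] by simp
qed

lemma prec_top: "a \<in> carrier V \<Longrightarrow> a \<prec> \<top>"
  using A1 by (simp add: A3[of a \<top> \<top>] top_higher)

lemma prec_mono_left: "\<lbrakk>a \<in> carrier V; b \<in> carrier V; c \<in> carrier V; a \<sqsubseteq> b; b \<prec> c\<rbrakk> \<Longrightarrow> a \<prec> c"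
  by (rule A3[of a b c c]) auto

lemma prec_mono_right: "\<lbrakk>a \<in> carrier V; b \<in> carrier V; c \<in> carrier V; a \<prec> b; b \<sqsubseteq> c\<rbrakk> \<Longrightarrow> a \<prec> c"
  by (rule A3[of a a b c]) auto

lemma prec_meet:
  assumes "a \<in> carrier V" "b \<in> carrier V" "c \<in> carrier V" "d \<in> carrier V" "a \<prec> b" "c \<prec> d"
  shows "a \<sqinter> c \<prec> b \<sqinter> d"
proof (rule A4)
  show "a \<sqinter> c \<prec> b" "a \<sqinter> c \<prec> d"
    using assms prec_mono_left[of "a \<sqinter> c" a b] prec_mono_left[of "a \<sqinter> c" c d]
    by (simp_all add: meet_left meet_right)
qed (use assms in auto)

text \<open>Closure under meets comes from A4. The new set is round because an interpolant
  \<open>c \<prec> b \<prec> a\<close> from A6 lies above \<open>c \<in> F\<close>, so it belongs to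
  \<open>F\<close> and, with witness \<open>c\<close>, to the round part.\<close>

lemma round_part_concordant:
  assumes F: "proper_filter V F"
  shows "round_part V F \<in> conc_filters V"
proof -
  note F = proper_filterD[OF F]
  have car: "a \<in> carrier V" if "a \<in> F" for a
    using F(1) that by blast
  obtain a where "a \<in> F" using F(2) by blast
  then have "\<top> \<in> F" using F(4)[of a \<top>] car top_higher by simp
  then have "\<top> \<in> round_part V F"
    unfolding round_part_def using A1 by blast
  moreover have "b \<in> round_part V F" if "a \<in> round_part V F" "b \<in> carrier V" "a \<sqsubseteq> b" for a b
  proof -
    obtain c where "a \<in> F" "c \<in> F" "c \<prec> a"
      using \<open>a \<in> round_part V F\<close> unfolding round_part_def by blast
    then have "b \<in> F" "c \<prec> b"
      using that F(4)[of a b] car prec_mono_right[of c a b] by auto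
    then show ?thesis
      using \<open>c \<in> F\<close> unfolding round_part_def by blast
  qed
  moreover have "a \<sqinter> b \<in> round_part V F" if ab: "a \<in> round_part V F" "b \<in> round_part V F" for a b
  proof -
    obtain c d where cd: "a \<in> F" "c \<in> F" "c \<prec> a" "b \<in> F" "d \<in> F" "d \<prec> b"
      using ab unfolding round_part_def by blast
    then have "a \<sqinter> b \<in> F" "c \<sqinter> d \<in> F" "c \<sqinter> d \<prec> a \<sqinter> b"
      using F(5) car prec_meet[of c a d b] by auto
    then show ?thesis
      unfolding round_part_def by blast
  qed
  moreover have "\<exists>b\<in>round_part V F. b \<prec> a" if a: "a \<in> round_part V F" for a
  proof -
    obtain c where c: "c \<in> F" "c \<prec> a" "a \<in> F"
      using a unfolding round_part_def by blast
    then obtain b where b: "b \<in> carrier V" "c \<prec> b" "b \<prec> a"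
      using A6[of c a] car by blast
    then have "b \<in> F"
      using c car F(4)[of c b] A2[of c b] by simp
    then show ?thesis
      using b c unfolding round_part_def by blast
  qed
  moreover have "round_part V F \<subseteq> F"
    unfolding round_part_def by blast
  ultimately show ?thesis
    using F(1,3) unfolding conc_filters_def concordant_filter_def proper_filter_def
    by (intro CollectI conjI ballI impI) auto
qed

text \<open>\<open>H\<close> consists of the elements above a meet of one element from each side,
  and the disjointness hypothesis keeps it proper. Only \<open>F\<close> is sure to survive in the
  round part, because \<open>F\<close> is itself round; for elements of \<open>G\<close> the
  witnesses for \<open>\<prec>\<close> have to be found separately.\<close>

lemma generated_filter:
  assumes F: "F \<in> conc_filters V" and G: "G \<subseteq> carrier V" "G \<noteq> {}"
    and meet: "\<And>a b. \<lbrakk>a \<in> G; b \<in> G\<rbrakk> \<Longrightarrow> a \<sqinter> b \<in> G"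
    and disj: "\<And>a b. \<lbrakk>a \<in> F; b \<in> G\<rbrakk> \<Longrightarrow> a \<sqinter> b \<noteq> \<bottom>"
  obtains H where "proper_filter V H" "F \<subseteq> round_part V H" "G \<subseteq> H"
proof
  define H where "H = {x \<in> carrier V. \<exists>a\<in>F. \<exists>b\<in>G. a \<sqinter> b \<sqsubseteq> x}"
  have carF: "a \<in> carrier V" if "a \<in> F" for a
    using F filter_carrier that by blast
  have carG: "a \<in> carrier V" if "a \<in> G" for a
    using G that by blast
  show "G \<subseteq> H"
    using filter_top[OF F] carG meet_right[OF top_closed] unfolding H_def by blast
  have "F \<subseteq> H"
    using G(2) carF carG meet_left unfolding H_def by fast
  then show "F \<subseteq> round_part V H"
    using conc_filtersD(2)[OF F] unfolding round_part_def by blast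
  have "\<bottom> \<notin> H"
  proof
    assume "\<bottom> \<in> H"
    then obtain a b where "a \<in> F" "b \<in> G" "a \<sqinter> b \<sqsubseteq> \<bottom>"
      unfolding H_def by blast
    then show False
      using disj carF carG eq_bottomI[of "a \<sqinter> b"] by simp
  qed
  moreover have "H \<noteq> {}"
    using \<open>G \<subseteq> H\<close> G(2) by blast
  moreover have "y \<in> H" if xy: "x \<in> H" "y \<in> carrier V" "x \<sqsubseteq> y" for x y
  proof -
    obtain a b where ab: "a \<in> F" "b \<in> G" "a \<sqinter> b \<sqsubseteq> x" "x \<in> carrier V"
      using xy(1) unfolding H_def by blast
    then have "a \<sqinter> b \<sqsubseteq> y"
      using xy carF carG by (intro le_trans[of "a \<sqinter> b" x y]) auto
    then show ?thesis
      using ab xy(2) unfolding H_def by blast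
  qed
  moreover have "x \<sqinter> y \<in> H" if x: "x \<in> H" and y: "y \<in> H" for x y
  proof -
    obtain a b where ab: "a \<in> F" "b \<in> G" "a \<sqinter> b \<sqsubseteq> x" "x \<in> carrier V"
      using x unfolding H_def by blast
    obtain c d where cd: "c \<in> F" "d \<in> G" "c \<sqinter> d \<sqsubseteq> y" "y \<in> carrier V"
      using y unfolding H_def by blast
    have "(a \<sqinter> c) \<sqinter> (b \<sqinter> d) \<sqsubseteq> a \<sqinter> b" "(a \<sqinter> c) \<sqinter> (b \<sqinter> d) \<sqsubseteq> c \<sqinter> d"
      using ab cd carF carG by (simp_all add: meet_mono meet_left meet_right)
    then have "(a \<sqinter> c) \<sqinter> (b \<sqinter> d) \<sqsubseteq> x" "(a \<sqinter> c) \<sqinter> (b \<sqinter> d) \<sqsubseteq> y"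
      using ab cd carF carG le_trans[of "(a \<sqinter> c) \<sqinter> (b \<sqinter> d)" "a \<sqinter> b" x]
        le_trans[of "(a \<sqinter> c) \<sqinter> (b \<sqinter> d)" "c \<sqinter> d" y]
      by simp_all
    then have "(a \<sqinter> c) \<sqinter> (b \<sqinter> d) \<sqsubseteq> x \<sqinter> y"
      using ab cd carF carG by (simp add: meet_le)
    moreover have "a \<sqinter> c \<in> F" "b \<sqinter> d \<in> G"
      using ab cd meet filter_meet[OF F] by simp_all
    ultimately show ?thesis
      using ab cd unfolding H_def by auto
  qed
  moreover have "H \<subseteq> carrier V"
    unfolding H_def by blast
  ultimately show "proper_filter V H"
    unfolding proper_filter_def by (intro conjI ballI impI) auto
qed

text \<open>The filter is the round part of the principal filter of some nonzero
  \<open>b \<prec> a\<close> given by A7. It takes the place of the prime filter theorem.\<close>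

lemma hat_nonempty:
  assumes "a \<in> carrier V" "a \<noteq> \<bottom>"
  shows "hat V a \<noteq> {}"
proof -
  obtain b where b: "b \<in> carrier V" "b \<noteq> \<bottom>" "b \<prec> a"
    using A7[of a] assms by blast
  have "proper_filter V {x \<in> carrier V. b \<sqsubseteq> x}"
    unfolding proper_filter_def using b eq_bottomI
    by (auto intro: le_trans meet_le)
  then have "round_part V {x \<in> carrier V. b \<sqsubseteq> x} \<in> conc_filters V"
    by (rule round_part_concordant)
  moreover have "a \<in> round_part V {x \<in> carrier V. b \<sqsubseteq> x}"
    using b assms A2 unfolding round_part_def by blast
  ultimately show ?thesis
    unfolding hat_def by blast
qed

section \<open>The sets \<open>hat V a\<close> as a basis\<close>

lemma hat_subset: "hat V a \<subseteq> conc_filters V"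
  unfolding hat_def by blast

lemma hat_bottom: "hat V \<bottom> = {}"
  using filter_proper unfolding hat_def by blast

lemma hat_meet:
  assumes "a \<in> carrier V" "b \<in> carrier V"
  shows "hat V (a \<sqinter> b) = hat V a \<inter> hat V b"
proof -
  have "a \<sqinter> b \<in> F \<longleftrightarrow> a \<in> F \<and> b \<in> F" if "F \<in> conc_filters V" for F
    using assms that filter_meet[of F a b] filter_up[of F "a \<sqinter> b" a] filter_up[of F "a \<sqinter> b" b]
      meet_left[of a b] meet_right[of a b] by auto
  then show ?thesis
    unfolding hat_def by blast
qed

lemma hat_top: "hat V \<top> = conc_filters V"
  using filter_top unfolding hat_def by blast

text \<open>For the forward direction, a point of \<open>hat V (a \<sqinter> compl V b)\<close>
  would contain both \<open>b\<close> and its complement, so this hat is empty; only the bottom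
  element has an empty hat.\<close>

lemma hat_subset_iff:
  assumes "a \<in> carrier V" "b \<in> carrier V"
  shows "hat V a \<subseteq> hat V b \<longleftrightarrow> a \<sqsubseteq> b"
proof
  assume *: "hat V a \<subseteq> hat V b"
  have "hat V (a \<sqinter> compl V b) \<subseteq> hat V (b \<sqinter> compl V b)"
    using * assms by (auto simp: hat_meet)
  then have "hat V (a \<sqinter> compl V b) = {}"
    using assms by (simp add: meet_compl hat_bottom)
  then show "a \<sqsubseteq> b"
    using assms hat_nonempty[of "a \<sqinter> compl V b"] by (auto simp: le_iff_meet_compl)
next
  assume "a \<sqsubseteq> b"
  then show "hat V a \<subseteq> hat V b"
    using assms filter_up[of _ a b] unfolding hat_def by auto
qed

lemma hat_inject: "\<lbrakk>a \<in> carrier V; b \<in> carrier V\<rbrakk> \<Longrightarrow> hat V a = hat V b \<longleftrightarrow> a = b"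
  by (metis hat_subset_iff le_antisym order_refl)

lemma Lambda_eq: "Lambda V = topology_generated_by (hat V ` carrier V)"
proof -
  have "{{F \<in> conc_filters V. a \<in> F} | a. a \<in> carrier V} = hat V ` carrier V"
    unfolding hat_def by blast
  then show ?thesis
    unfolding Lambda_def by simp
qed

lemma topspace_Lambda [simp]: "topspace (Lambda V) = conc_filters V"
proof -
  have "conc_filters V = hat V \<top>" "hat V \<top> \<in> hat V ` carrier V"
    by (simp add: hat_top) blast
  moreover have "A \<subseteq> conc_filters V" if "A \<in> hat V ` carrier V" for A
    using that by (auto simp: hat_def)
  ultimately have "\<Union>(hat V ` carrier V) = conc_filters V"
    by blast
  then show ?thesis
    by (simp only: Lambda_eq topology_generated_by_topspace)
qed

lemma openin_hat: "a \<in> carrier V \<Longrightarrow> openin (Lambda V) (hat V a)"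
  unfolding Lambda_eq by (rule topology_generated_by_Basis) simp

lemma openin_Lambda_iff:
  "openin (Lambda V) U \<longleftrightarrow> (\<exists>A. A \<subseteq> carrier V \<and> U = (\<Union>a\<in>A. hat V a))"
proof
  assume "openin (Lambda V) U"
  then have "generate_topology_on (hat V ` carrier V) U"
    unfolding Lambda_eq openin_topology_generated_by_iff .
  then show "\<exists>A. A \<subseteq> carrier V \<and> U = (\<Union>a\<in>A. hat V a)"
  proof induction
    case Empty
    show ?case
      by (intro exI[of _ "{}"]) auto
  next
    case (Int U1 U2)
    then obtain A B where "A \<subseteq> carrier V" "U1 = (\<Union>a\<in>A. hat V a)"
        "B \<subseteq> carrier V" "U2 = (\<Union>b\<in>B. hat V b)"
      by blast
    then have "U1 \<inter> U2 = (\<Union>c\<in>{a \<sqinter> b | a b. a \<in> A \<and> b \<in> B}. hat V c)"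
      "{a \<sqinter> b | a b. a \<in> A \<and> b \<in> B} \<subseteq> carrier V"
      by (auto simp: hat_meet subset_iff) (auto simp: hat_meet subset_iff intro!: exI)
    then show ?case by blast
  next
    case (UN K)
    \<comment> \<open>All basic sets inside the union are collected, so that no representation has
      to be chosen for each member of \<open>K\<close>.\<close>
    let ?A = "{a \<in> carrier V. hat V a \<subseteq> \<Union>K}"
    have "F \<in> (\<Union>c\<in>?A. hat V c)" if F: "F \<in> k" "k \<in> K" for F k
    proof -
      obtain A where A: "A \<subseteq> carrier V" "k = (\<Union>a\<in>A. hat V a)"
        using UN F(2) by blast
      then obtain a where "a \<in> A" "F \<in> hat V a"
        using F(1) by blast
      then show ?thesis
        using A F(2) by blast
    qed
    then have "\<Union>K = (\<Union>c\<in>?A. hat V c)"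
      by blast
    then show ?case
      by (intro exI[of _ ?A]) simp
  next
    case (Basis s)
    then obtain a where "a \<in> carrier V" "s = hat V a"
      by blast
    then show ?case
      by (intro exI[of _ "{a}"]) auto
  qed
next
  assume "\<exists>A. A \<subseteq> carrier V \<and> U = (\<Union>a\<in>A. hat V a)"
  then show "openin (Lambda V) U"
    by (auto intro!: openin_Union openin_hat)
qed

lemma openin_LambdaD:
  assumes "openin (Lambda V) U" "F \<in> U"
  obtains a where "a \<in> F" "hat V a \<subseteq> U"
proof -
  obtain A where A: "A \<subseteq> carrier V" "U = (\<Union>a\<in>A. hat V a)"
    using assms(1) unfolding openin_Lambda_iff by blast
  then obtain a where "a \<in> A" "F \<in> hat V a"
    using assms(2) by blast
  then have "F \<in> hat V a" "hat V a \<subseteq> U"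
    using A by auto
  then show ?thesis
    using that by (auto simp: hat_def)
qed

lemma perp_Union_hat:
  assumes A: "A \<subseteq> carrier V"
  shows "perp (Lambda V) (\<Union>a\<in>A. hat V a) = hat V (compl V (\<Squnion>A))"
proof (intro equalityI subsetI)
  fix F assume "F \<in> perp (Lambda V) (\<Union>a\<in>A. hat V a)"
  then have F: "F \<in> conc_filters V"
    and "\<exists>U. F \<in> U \<and> openin (Lambda V) U \<and> (\<forall>a\<in>A. hat V a \<inter> U = {})"
    unfolding perp_def by (auto simp: in_closure_of)
  then obtain U where U: "F \<in> U" "openin (Lambda V) U" "\<And>a. a \<in> A \<Longrightarrow> hat V a \<inter> U = {}"
    by blast
  obtain b where b: "b \<in> F" "hat V b \<subseteq> U"
    using openin_LambdaD U by blast
  have bc: "b \<in> carrier V" using F b filter_carrier by blast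
  \<comment> \<open>Disjoint hats come from disjoint elements, by \<open>hat_nonempty\<close>
    applied to the meet.\<close>
  have "a \<sqinter> b = \<bottom>" if "a \<in> A" for a
  proof -
    have a: "a \<in> carrier V" using that A by blast
    have "hat V (a \<sqinter> b) = {}"
      using U(3)[OF that] b(2) a bc by (auto simp: hat_meet)
    then show ?thesis
      using hat_nonempty[of "a \<sqinter> b"] a bc by auto
  qed
  then have "(\<Squnion>A) \<sqinter> b = \<bottom>"
    using A bc by (simp add: sup_meet_eq_bottom_iff)
  then have "b \<sqsubseteq> compl V (\<Squnion>A)"
    using A bc by (metis meet_comm meet_eq_bottom_iff sup_closed)
  then show "F \<in> hat V (compl V (\<Squnion>A))"
    using F b(1) A filter_up[of F b] unfolding hat_def by simp
next
  fix F assume *: "F \<in> hat V (compl V (\<Squnion>A))"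
  have "hat V a \<inter> hat V (compl V (\<Squnion>A)) = {}" if "a \<in> A" for a
  proof -
    have "a \<sqinter> compl V (\<Squnion>A) = \<bottom>"
      using A that sup_upper[of A a] le_iff_meet_compl[of a "\<Squnion>A"] by auto
    then show ?thesis
      using A that hat_bottom hat_meet[of a "compl V (\<Squnion>A)"] by auto
  qed
  then have "F \<notin> Lambda V closure_of (\<Union>a\<in>A. hat V a)"
    using * openin_hat[of "compl V (\<Squnion>A)"] A unfolding in_closure_of by auto
  then show "F \<in> perp (Lambda V) (\<Union>a\<in>A. hat V a)"
    using * unfolding perp_def hat_def by simp
qed

lemma perp_hat: "a \<in> carrier V \<Longrightarrow> perp (Lambda V) (hat V a) = hat V (compl V a)"
  using perp_Union_hat[of "{a}"] by simp

lemma perp_perp_Union_hat: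
  "A \<subseteq> carrier V \<Longrightarrow> perp (Lambda V) (perp (Lambda V) (\<Union>a\<in>A. hat V a)) = hat V (\<Squnion>A)"
  by (simp add: perp_Union_hat perp_hat)

lemma closure_of_hat: "a \<in> carrier V \<Longrightarrow> Lambda V closure_of hat V a = conc_filters V - hat V (compl V a)"
  using perp_hat[of a] closure_of_subset_topspace[of "Lambda V" "hat V a"] unfolding perp_def by auto

lemma reg_open_Lambda: "reg_open (Lambda V) = hat V ` carrier V"
proof (intro equalityI subsetI)
  fix U assume U: "U \<in> reg_open (Lambda V)"
  then have eq: "perp (Lambda V) (perp (Lambda V) U) = U"
    unfolding reg_open_def by blast
  have "openin (Lambda V) (perp (Lambda V) (perp (Lambda V) U))"
    by (rule openin_perp)
  then have "openin (Lambda V) U"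
    unfolding eq .
  then obtain A where "A \<subseteq> carrier V" "U = (\<Union>a\<in>A. hat V a)"
    unfolding openin_Lambda_iff by blast
  then have "U = hat V (\<Squnion>A)" "\<Squnion>A \<in> carrier V"
    using eq perp_perp_Union_hat[of A] by simp_all
  then show "U \<in> hat V ` carrier V"
    by blast
next
  fix U assume "U \<in> hat V ` carrier V"
  then obtain a where "a \<in> carrier V" "U = hat V a"
    by blast
  then show "U \<in> reg_open (Lambda V)"
    using hat_subset[of a] by (simp add: reg_open_def perp_hat)
qed

section \<open>Specialization as inclusion, and the extension of filters\<close>

lemma spec_le_Lambda:
  "spec_le (Lambda V) F G \<longleftrightarrow> F \<in> conc_filters V \<and> G \<in> conc_filters V \<and> F \<subseteq> G"
proof
  assume *: "spec_le (Lambda V) F G"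
  then have FG: "F \<in> conc_filters V" "G \<in> conc_filters V"
    by (simp_all add: spec_le_def)
  have "a \<in> G" if "a \<in> F" for a
  proof -
    have "openin (Lambda V) (hat V a)" "F \<in> hat V a"
      using FG that filter_carrier openin_hat by (auto simp: hat_def)
    then have "G \<in> hat V a"
      using * unfolding spec_le_def by blast
    then show ?thesis by (simp add: hat_def)
  qed
  then show "F \<in> conc_filters V \<and> G \<in> conc_filters V \<and> F \<subseteq> G"
    using FG by blast
next
  assume *: "F \<in> conc_filters V \<and> G \<in> conc_filters V \<and> F \<subseteq> G"
  have "G \<in> U" if "openin (Lambda V) U" "F \<in> U" for U
  proof -
    obtain a where "a \<in> F" "hat V a \<subseteq> U"
      using openin_LambdaD \<open>openin (Lambda V) U\<close> \<open>F \<in> U\<close> by blast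
    then show ?thesis
      using * unfolding hat_def by blast
  qed
  then show "spec_le (Lambda V) F G"
    using * by (simp add: spec_le_def)
qed

lemma down_hat: "down (Lambda V) (hat V a) = {F \<in> conc_filters V. \<exists>G\<in>conc_filters V. F \<subseteq> G \<and> a \<in> G}"
  by (auto simp: down_def spec_le_Lambda hat_def)

text \<open>The filter is generated by \<open>F\<close> and an interpolant \<open>c\<close> between
  \<open>a\<close> and \<open>b\<close>, not by \<open>b\<close> itself: the round part then keeps
  \<open>b\<close>, with \<open>c\<close> as its witness. It is proper because
  \<open>f \<sqinter> c = \<bottom>\<close> would give
  \<open>f \<sqsubseteq> compl V c \<sqsubseteq> compl V a\<close> and so put
  \<open>compl V a\<close> into \<open>F\<close>.\<close>

lemma extend_filter:
  assumes F: "F \<in> conc_filters V" and a: "a \<in> carrier V" and b: "b \<in> carrier V"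
    and "a \<prec> b" "compl V a \<notin> F"
  shows "\<exists>G\<in>conc_filters V. F \<subseteq> G \<and> b \<in> G"
proof -
  obtain c where c: "c \<in> carrier V" "a \<prec> c" "c \<prec> b"
    using A6[OF a b] assms by blast
  have "f \<sqinter> d \<noteq> \<bottom>" if f: "f \<in> F" and "d \<in> {c}" for f d
  proof
    assume "f \<sqinter> d = \<bottom>"
    then have "f \<sqsubseteq> compl V c"
      using that c F filter_carrier by (simp add: meet_eq_bottom_iff)
    moreover have "compl V c \<sqsubseteq> compl V a"
      using c a A2[of a c] compl_antimono[of a c] by simp
    ultimately have "f \<sqsubseteq> compl V a"
      using F f c a filter_carrier[of F f] le_trans[of f "compl V c" "compl V a"] by simp
    then show False
      using assms f filter_up[of F f "compl V a"] by simp
  qed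
  moreover have "d \<sqinter> e \<in> {c}" if "d \<in> {c}" "e \<in> {c}" for d e
    using that c le_iff_join[of c c] by auto
  ultimately obtain H where H: "proper_filter V H" "F \<subseteq> round_part V H" "{c} \<subseteq> H"
    using generated_filter[OF F, of "{c}"] c by blast
  have "b \<in> H"
    using proper_filterD(4)[OF H(1), of c b] H(3) c b A2[of c b] by simp
  then have "b \<in> round_part V H"
    using H(3) c unfolding round_part_def by blast
  then show ?thesis
    using H round_part_concordant by blast
qed

text \<open>The least element, if any, of \<open>Int\<^sub>\<le> (S\<^sub>V - hat V a)\<close>.\<close>

definition upper_filter :: "'a \<Rightarrow> 'a set" where
  "upper_filter a = {x \<in> carrier V. compl V a \<prec> x}"

lemma upper_filter_meet:
  "\<lbrakk>a \<in> carrier V; x \<in> upper_filter a; y \<in> upper_filter a\<rbrakk> \<Longrightarrow> x \<sqinter> y \<in> upper_filter a"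
  by (auto simp: upper_filter_def intro: A4)

text \<open>For \<open>a = \<top>\<close> the set would be the whole carrier, because A5 turns A1
  into \<open>\<bottom> \<prec> \<bottom>\<close>; hence the case distinctions on
  \<open>\<top>\<close> below.\<close>

lemma upper_filter_concordant:
  assumes a: "a \<in> carrier V" "a \<noteq> \<top>"
  shows "upper_filter a \<in> conc_filters V"
proof -
  have "\<top> \<in> upper_filter a"
    using a prec_top by (simp add: upper_filter_def)
  moreover have "\<bottom> \<notin> upper_filter a"
  proof
    assume "\<bottom> \<in> upper_filter a"
    then have "compl V a = \<bottom>"
      using a A2[of "compl V a" \<bottom>] eq_bottomI by (simp add: upper_filter_def)
    then show False
      using a by (metis compl_bottom compl_compl)
  qed
  moreover have "y \<in> upper_filter a" if "x \<in> upper_filter a" "y \<in> carrier V" "x \<sqsubseteq> y" for x y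
    using that a prec_mono_right[of "compl V a" x y] unfolding upper_filter_def by simp
  moreover have "\<exists>y\<in>upper_filter a. y \<prec> x" if "x \<in> upper_filter a" for x
    using that a A6[of "compl V a" x] by (auto simp: upper_filter_def)
  ultimately show ?thesis
    using a upper_filter_meet
    unfolding conc_filters_def concordant_filter_def proper_filter_def
    by (auto simp: upper_filter_def)
qed

text \<open>Were \<open>a\<close> in \<open>G\<close>, roundness would give
  \<open>c \<prec> a\<close> in \<open>G\<close>, and A5 would place \<open>compl V c\<close> in
  \<open>upper_filter a\<close> and hence in \<open>G\<close>.\<close>

lemma upper_filter_not_mem:
  assumes a: "a \<in> carrier V" and G: "G \<in> conc_filters V" "upper_filter a \<subseteq> G"
  shows "a \<notin> G"
proof
  assume "a \<in> G"
  then obtain c where c: "c \<in> G" "c \<prec> a"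
    using conc_filtersD(2)[OF G(1)] by blast
  have cc: "c \<in> carrier V" using c G filter_carrier[of G c] by simp
  have "compl V c \<in> upper_filter a"
    using A5[OF cc a c(2)] cc by (simp add: upper_filter_def)
  then show False
    using c cc G filter_disjoint[of G c "compl V c"] meet_compl[of c] by auto
qed

text \<open>From right to left this is \<open>extend_filter\<close>. In the other direction a single
  test point suffices: \<open>upper_filter b\<close> lies outside \<open>down\<close> of
  \<open>hat V b\<close>, so it is not in the closure of \<open>hat V a\<close> and must contain
  \<open>compl V a\<close>, which means \<open>compl V b \<prec> compl V a\<close>.\<close>

lemma well_inside_hat_iff:
  assumes a: "a \<in> carrier V" and b: "b \<in> carrier V"
  shows "well_inside (Lambda V) (hat V a) (hat V b) \<longleftrightarrow> a \<prec> b"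
proof
  assume "a \<prec> b"
  then show "well_inside (Lambda V) (hat V a) (hat V b)"
    using extend_filter[OF _ a b] unfolding well_inside_def closure_of_hat[OF a] down_hat
    by (auto simp: hat_def)
next
  assume *: "well_inside (Lambda V) (hat V a) (hat V b)"
  show "a \<prec> b"
  proof (cases "b = \<top>")
    case True
    then show ?thesis using a prec_top by simp
  next
    case False
    have conc: "upper_filter b \<in> conc_filters V"
      using upper_filter_concordant False b by blast
    moreover have "upper_filter b \<notin> down (Lambda V) (hat V b)"
      using upper_filter_not_mem[OF b] unfolding down_hat by blast
    ultimately have "upper_filter b \<in> hat V (compl V a)"
      using * unfolding well_inside_def closure_of_hat[OF a] by blast
    then have "compl V b \<prec> compl V a"
      by (simp add: hat_def upper_filter_def)
    then show ?thesis
      using A5[of "compl V b" "compl V a"] a b by simp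
  qed
qed

lemma Int_le_down_hat:
  assumes a: "a \<in> carrier V"
  shows "Int_le (Lambda V) (down (Lambda V) (hat V a)) = hat V a"
proof (intro equalityI subsetI)
  fix F assume "F \<in> hat V a"
  then show "F \<in> Int_le (Lambda V) (down (Lambda V) (hat V a))"
    unfolding Int_le_def spec_le_Lambda down_hat by (auto simp: hat_def)
next
  fix F assume *: "F \<in> Int_le (Lambda V) (down (Lambda V) (hat V a))"
  then have F: "F \<in> conc_filters V"
    by (simp add: Int_le_def)
  \<comment> \<open>If there were no such pair, \<open>F\<close> and \<open>upper_filter a\<close>
    would generate a proper filter. Both are round, so its round part contains both; it would extend
    \<open>F\<close> without having any extension that contains \<open>a\<close>.\<close>
  have "\<exists>f\<in>F. \<exists>x\<in>upper_filter a. f \<sqinter> x = \<bottom>"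
  proof (rule ccontr)
    assume disj: "\<not> (\<exists>f\<in>F. \<exists>x\<in>upper_filter a. f \<sqinter> x = \<bottom>)"
    have top: "\<top> \<in> upper_filter a"
      using a prec_top by (simp add: upper_filter_def)
    obtain H where H: "proper_filter V H" "F \<subseteq> round_part V H" "upper_filter a \<subseteq> H"
      using generated_filter[OF F, of "upper_filter a"] upper_filter_meet[OF a] disj top
      unfolding upper_filter_def by blast
    have R: "round_part V H \<in> conc_filters V"
      using H round_part_concordant by blast
    have "x \<in> round_part V H" if x: "x \<in> upper_filter a" for x
    proof -
      obtain y where "y \<in> upper_filter a" "y \<prec> x"
        using x a A6[of "compl V a" x] by (auto simp: upper_filter_def)
      then show ?thesis
        using x H(3) unfolding round_part_def by blast
    qed
    then have "round_part V H \<notin> down (Lambda V) (hat V a)"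
      using upper_filter_not_mem[OF a] unfolding down_hat by blast
    moreover have "round_part V H \<in> down (Lambda V) (hat V a)"
      using * F R H(2) unfolding Int_le_def spec_le_Lambda by blast
    ultimately show False by blast
  qed
  then obtain f x where fx: "f \<in> F" "x \<in> carrier V" "compl V a \<prec> x" "f \<sqinter> x = \<bottom>"
    unfolding upper_filter_def by blast
  have fc: "f \<in> carrier V" using fx F filter_carrier by blast
  have "f \<sqsubseteq> compl V x"
    using fx fc by (simp add: meet_eq_bottom_iff)
  moreover have "compl V x \<sqsubseteq> a"
    using fx a A2[of "compl V a" x] compl_antimono[of "compl V a" x] by simp
  ultimately have "f \<sqsubseteq> a"
    using fx fc a le_trans[of f "compl V x" a] by simp
  then show "F \<in> hat V a"
    using F fx(1) a filter_up[of F f a] by (simp add: hat_def)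
qed

section \<open>Separation and compactness of the dual space\<close>

lemma t0_space_Lambda: "t0_space (Lambda V)"
  unfolding t0_space_def
proof (intro ballI impI)
  fix F G assume FG: "F \<in> topspace (Lambda V)" "G \<in> topspace (Lambda V)" "F \<noteq> G"
  then obtain a where a: "a \<in> carrier V" "a \<in> F \<longleftrightarrow> a \<notin> G"
    using filter_carrier by auto
  have "openin (Lambda V) (hat V a) \<and> (F \<notin> hat V a \<longleftrightarrow> G \<in> hat V a)"
    using a FG openin_hat by (simp add: hat_def)
  then show "\<exists>U. openin (Lambda V) U \<and> (F \<notin> U \<longleftrightarrow> G \<in> U)"
    by blast
qed

text \<open>The trivial filter \<open>{\<top>}\<close> is a point whose only neighbourhood is the whole space.\<close>

lemma compact_space_Lambda: "compact_space (Lambda V)"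
proof (cases "\<top> = \<bottom>")
  case True
  then have "conc_filters V = {}"
    using hat_top hat_bottom by metis
  then show ?thesis
    by (simp add: compact_space_def)
next
  case False
  have "{\<top>} \<in> conc_filters V"
    using False A1 le_iff_join[of \<top> \<top>]
    unfolding conc_filters_def concordant_filter_def proper_filter_def
    by (auto simp: top_higher le_antisym)
  moreover have *: "topspace (Lambda V) \<subseteq> U" if U: "openin (Lambda V) U" "{\<top>} \<in> U" for U
  proof -
    obtain a where "a \<in> {\<top>}" "hat V a \<subseteq> U"
      by (rule openin_LambdaD[OF U])
    then show ?thesis
      by (simp add: hat_top)
  qed
  ultimately have "\<exists>\<F>. finite \<F> \<and> \<F> \<subseteq> \<U> \<and> topspace (Lambda V) \<subseteq> \<Union>\<F>"
    if \<U>: "\<forall>U\<in>\<U>. openin (Lambda V) U" "topspace (Lambda V) \<subseteq> \<Union>\<U>" for \<U>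
  proof -
    have "{\<top>} \<in> \<Union>\<U>"
      using \<U>(2) \<open>{\<top>} \<in> conc_filters V\<close> by (simp add: subset_iff)
    then obtain U where "U \<in> \<U>" "{\<top>} \<in> U"
      by blast
    moreover from this have "topspace (Lambda V) \<subseteq> U"
      using \<U>(1) * by blast
    ultimately show ?thesis
      by (intro exI[of _ "{U}"]) simp
  qed
  then show ?thesis
    unfolding compact_space_alt by blast
qed

end

section \<open>Regular open sets\<close>

lemma perp_subset: "perp X U \<subseteq> topspace X"
  unfolding perp_def by blast

text \<open>\<open>perp X U\<close> is the largest open set disjoint from \<open>U\<close>. Most of
  the algebra of double complements below follows from this adjunction.\<close>

lemma subset_perp_iff: "openin X W \<Longrightarrow> W \<subseteq> perp X U \<longleftrightarrow> W \<inter> U = {}"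
  using openin_subset[of X W] openin_Int_closure_of_eq_empty[of X W U] unfolding perp_def by blast

lemma perp_disjoint: "openin X U \<Longrightarrow> U \<inter> perp X U = {}"
  using subset_perp_iff[OF openin_perp, of X U U] by blast

lemma perp_antimono: "U \<subseteq> V \<Longrightarrow> perp X V \<subseteq> perp X U"
  unfolding perp_def using closure_of_mono[of U V X] by blast

lemma subset_perp_perp: "openin X U \<Longrightarrow> U \<subseteq> perp X (perp X U)"
  by (simp add: subset_perp_iff perp_disjoint)

lemma perp_perp_mono: "U \<subseteq> V \<Longrightarrow> perp X (perp X U) \<subseteq> perp X (perp X V)"
  by (intro perp_antimono)

lemma perp_perp_perp: "openin X U \<Longrightarrow> perp X (perp X (perp X U)) = perp X U"
  by (intro equalityI perp_antimono subset_perp_perp openin_perp)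

lemma perp_perp_Int:
  assumes U: "openin X U" and V: "openin X V"
  shows "perp X (perp X (U \<inter> V)) = perp X (perp X U) \<inter> perp X (perp X V)"
proof
  show "perp X (perp X (U \<inter> V)) \<subseteq> perp X (perp X U) \<inter> perp X (perp X V)"
    by (simp add: perp_perp_mono)
  \<comment> \<open>The part of the right-hand side that misses the left. It is emptied by the same
    argument for \<open>V\<close> and then for \<open>U\<close>: an open set disjoint from
    \<open>V\<close> lies in \<open>perp X V\<close>, which is disjoint from
    \<open>perp X (perp X V)\<close>.\<close>
  let ?N = "perp X (perp X U) \<inter> perp X (perp X V) \<inter> perp X (U \<inter> V)"
  have N: "openin X ?N"
    by (intro openin_Int openin_perp)
  have "?N \<inter> U \<inter> (U \<inter> V) = {}"
    using perp_disjoint[OF openin_Int[OF U V]] by blast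
  then have "?N \<inter> U \<inter> V = {}"
    by blast
  then have "?N \<inter> U \<subseteq> perp X V"
    using subset_perp_iff[OF openin_Int[OF N U], of V] by blast
  then have "?N \<inter> U = {}"
    using perp_disjoint[OF openin_perp, of X V] by blast
  then have "?N \<subseteq> perp X U"
    using subset_perp_iff[OF N, of U] by blast
  then have "?N = {}"
    using perp_disjoint[OF openin_perp, of X U] by blast
  then show "perp X (perp X U) \<inter> perp X (perp X V) \<subseteq> perp X (perp X (U \<inter> V))"
    by (subst subset_perp_iff) (simp_all add: openin_Int openin_perp)
qed

lemma reg_openD:
  assumes "U \<in> reg_open X"
  shows "perp X (perp X U) = U" "openin X U" "U \<subseteq> topspace X"
proof -
  show "perp X (perp X U) = U" "U \<subseteq> topspace X"
    using assms by (simp_all add: reg_open_def)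
  then show "openin X U"
    using openin_perp[of X "perp X U"] by simp
qed

lemma perp_reg_open: "openin X U \<Longrightarrow> perp X U \<in> reg_open X"
  by (simp add: reg_open_def perp_subset perp_perp_perp)

lemma perp_perp_reg_open: "perp X (perp X U) \<in> reg_open X"
  by (rule perp_reg_open[OF openin_perp])

lemma perp_perp_least: "\<lbrakk>U \<subseteq> R; R \<in> reg_open X\<rbrakk> \<Longrightarrow> perp X (perp X U) \<subseteq> R"
  using perp_perp_mono[of U R X] by (simp add: reg_openD)

lemma perp_empty: "perp X {} = topspace X"
  and perp_topspace: "perp X (topspace X) = {}"
  by (simp_all add: perp_def)

lemma empty_reg_open: "{} \<in> reg_open X"
  and topspace_reg_open: "topspace X \<in> reg_open X"
  by (simp_all add: reg_open_def perp_empty perp_topspace)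

lemma Int_reg_open: "\<lbrakk>U \<in> reg_open X; V \<in> reg_open X\<rbrakk> \<Longrightarrow> U \<inter> V \<in> reg_open X"
  by (metis perp_perp_Int perp_perp_reg_open reg_openD(1,2))

lemma RO_struct_simps [simp]:
  "carrier (RO_struct X) = reg_open X"
  "le (RO_struct X) U V \<longleftrightarrow> U \<subseteq> V"
  "prec (RO_struct X) U V \<longleftrightarrow> well_inside X U V"
  by (simp_all add: RO_struct_def)

lemma partial_order_RO_struct: "partial_order (RO_struct X)"
  by unfold_locales (auto simp: RO_struct_def)

lemma least_RO_struct:
  assumes "A \<subseteq> reg_open X"
  shows "least (RO_struct X) (perp X (perp X (\<Union>A))) (Upper (RO_struct X) A)"
proof (rule least_UpperI)
  have "openin X (\<Union>A)"
    using assms reg_openD(2) by blast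
  then show "U \<sqsubseteq>\<^bsub>RO_struct X\<^esub> perp X (perp X (\<Union>A))" if "U \<in> A" for U
    using that subset_perp_perp[of X "\<Union>A"] by auto
  show "perp X (perp X (\<Union>A)) \<sqsubseteq>\<^bsub>RO_struct X\<^esub> V" if "V \<in> Upper (RO_struct X) A" for V
  proof -
    have "\<Union>A \<subseteq> V" "V \<in> reg_open X"
      using that assms by (auto simp: Upper_def)
    then show ?thesis
      by (simp add: perp_perp_least)
  qed
qed (use assms perp_perp_reg_open in auto)

text \<open>Greatest lower bounds are taken as regularized unions of all regular open lower bounds,
  which also covers the empty family.\<close>

lemma greatest_RO_struct:
  assumes "A \<subseteq> reg_open X"
  shows "\<exists>U. greatest (RO_struct X) U (Lower (RO_struct X) A)"
proof
  let ?L = "{W \<in> reg_open X. \<forall>V\<in>A. W \<subseteq> V}"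
  show "greatest (RO_struct X) (perp X (perp X (\<Union>?L))) (Lower (RO_struct X) A)"
  proof (rule greatest_LowerI)
    show "perp X (perp X (\<Union>?L)) \<sqsubseteq>\<^bsub>RO_struct X\<^esub> V" if "V \<in> A" for V
    proof -
      have "\<Union>?L \<subseteq> V" "V \<in> reg_open X"
        using that assms by auto
      then show ?thesis
        by (simp add: perp_perp_least)
    qed
    show "W \<sqsubseteq>\<^bsub>RO_struct X\<^esub> perp X (perp X (\<Union>?L))" if "W \<in> Lower (RO_struct X) A" for W
    proof -
      have "W \<in> ?L"
        using that assms by (auto simp: Lower_def)
      moreover have "openin X (\<Union>?L)"
        by (rule openin_Union) (simp add: reg_openD)
      ultimately show ?thesis
        using subset_perp_perp[of X "\<Union>?L"] by auto
    qed
  qed (use assms perp_perp_reg_open in auto)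
qed

lemma complete_lattice_RO_struct: "complete_lattice (RO_struct X)"
proof -
  interpret partial_order "RO_struct X"
    by (rule partial_order_RO_struct)
  show ?thesis
    by (rule complete_latticeI) (use least_RO_struct greatest_RO_struct in auto)
qed

lemma sup_RO_struct:
  assumes "A \<subseteq> reg_open X"
  shows "\<Squnion>\<^bsub>RO_struct X\<^esub>A = perp X (perp X (\<Union>A))"
proof -
  interpret complete_lattice "RO_struct X"
    by (rule complete_lattice_RO_struct)
  show ?thesis
    using sup_lub[of A] least_RO_struct[OF assms] assms least_unique by auto
qed

lemma meet_RO_struct:
  assumes "U \<in> reg_open X" "V \<in> reg_open X"
  shows "U \<sqinter>\<^bsub>RO_struct X\<^esub> V = U \<inter> V"
proof -
  interpret complete_lattice "RO_struct X"
    by (rule complete_lattice_RO_struct)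
  show ?thesis
    using meet_left[of U V] meet_right[of U V] meet_le[of "U \<inter> V" U V] assms
    by (intro equalityI) (simp_all add: Int_reg_open)
qed

lemma bottom_RO_struct: "\<bottom>\<^bsub>RO_struct X\<^esub> = {}"
proof -
  interpret complete_lattice "RO_struct X"
    by (rule complete_lattice_RO_struct)
  show ?thesis
    using bottom_lower[of "{}"] by (simp add: empty_reg_open)
qed

lemma top_RO_struct: "\<top>\<^bsub>RO_struct X\<^esub> = topspace X"
proof -
  interpret complete_lattice "RO_struct X"
    by (rule complete_lattice_RO_struct)
  show ?thesis
    using top_higher[of "topspace X"] top_closed reg_openD(3)[of "\<top>\<^bsub>RO_struct X\<^esub>" X]
    by (intro equalityI) (simp_all add: topspace_reg_open)
qed

lemma join_RO_struct:
  "\<lbrakk>U \<in> reg_open X; V \<in> reg_open X\<rbrakk> \<Longrightarrow> U \<squnion>\<^bsub>RO_struct X\<^esub> V = perp X (perp X (U \<union> V))"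
  by (simp add: join_def sup_RO_struct)

lemma complete_Boolean_lattice_RO_struct: "complete_Boolean_lattice (RO_struct X)"
proof -
  interpret complete_lattice "RO_struct X"
    by (rule complete_lattice_RO_struct)
  show ?thesis
  proof
    fix U V W assume UVW: "U \<in> carrier (RO_struct X)" "V \<in> carrier (RO_struct X)" "W \<in> carrier (RO_struct X)"
    then have "U \<inter> perp X (perp X (V \<union> W)) = perp X (perp X (U \<inter> (V \<union> W)))"
      using perp_perp_Int[of X U "V \<union> W"] by (simp add: reg_openD openin_Un)
    then show "U \<sqinter>\<^bsub>RO_struct X\<^esub> (V \<squnion>\<^bsub>RO_struct X\<^esub> W) = U \<sqinter>\<^bsub>RO_struct X\<^esub> V \<squnion>\<^bsub>RO_struct X\<^esub> (U \<sqinter>\<^bsub>RO_struct X\<^esub> W)"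
      using UVW by (simp add: join_RO_struct meet_RO_struct perp_perp_reg_open Int_reg_open Int_Un_distrib)
  next
    fix U assume "U \<in> carrier (RO_struct X)"
    then have U: "U \<in> reg_open X" "openin X U" and U': "perp X U \<in> reg_open X"
      by (simp_all add: reg_openD perp_reg_open)
    \<comment> \<open>\<open>U\<close> and \<open>perp X U\<close> together are dense: by the first
      equation the open set \<open>perp X (U \<union> perp X U)\<close> lies in
      \<open>perp X U\<close>, and by the second it is disjoint from it.\<close>
    have "U \<inter> perp X (U \<union> perp X U) = {}" "perp X U \<inter> perp X (U \<union> perp X U) = {}"
      using perp_disjoint[of X "U \<union> perp X U"] U(2) openin_perp[of X U] by (auto simp: openin_Un)
    then have "perp X (U \<union> perp X U) = {}"
      using subset_perp_iff[OF openin_perp, of X "U \<union> perp X U" U] by blast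
    then have "U \<squnion>\<^bsub>RO_struct X\<^esub> perp X U = \<top>\<^bsub>RO_struct X\<^esub>"
      using U U' by (simp add: join_RO_struct perp_empty top_RO_struct)
    moreover have "U \<sqinter>\<^bsub>RO_struct X\<^esub> perp X U = \<bottom>\<^bsub>RO_struct X\<^esub>"
      using U U' by (simp add: meet_RO_struct perp_disjoint bottom_RO_struct)
    ultimately show "\<exists>V\<in>carrier (RO_struct X). U \<sqinter>\<^bsub>RO_struct X\<^esub> V = \<bottom>\<^bsub>RO_struct X\<^esub> \<and> U \<squnion>\<^bsub>RO_struct X\<^esub> V = \<top>\<^bsub>RO_struct X\<^esub>"
      using U' by auto
  qed
qed

lemma compl_RO_struct:
  assumes U: "U \<in> reg_open X"
  shows "compl (RO_struct X) U = perp X U"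
proof -
  interpret complete_Boolean_lattice "RO_struct X"
    by (rule complete_Boolean_lattice_RO_struct)
  let ?C = "compl (RO_struct X) U"
  have C: "?C \<in> reg_open X" and "U \<inter> ?C = {}"
    using U compl_closed[of U] meet_compl[of U] by (simp_all add: meet_RO_struct bottom_RO_struct)
  then have "?C \<subseteq> perp X U"
    using subset_perp_iff[of X ?C U] by (auto simp: reg_openD)
  moreover have "perp X U \<subseteq> ?C"
    using meet_eq_bottom_iff[of "perp X U" U] U perp_disjoint[of X U]
    by (simp add: meet_RO_struct bottom_RO_struct perp_reg_open reg_openD Int_commute)
  ultimately show ?thesis
    by blast
qed

section \<open>The de Vries algebra of a dV-space\<close>

lemma spec_leD: "\<lbrakk>spec_le X x y; openin X U; x \<in> U\<rbrakk> \<Longrightarrow> y \<in> U"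
  by (simp add: spec_le_def)

lemma spec_le_refl: "x \<in> topspace X \<Longrightarrow> spec_le X x x"
  by (simp add: spec_le_def)

lemma spec_le_trans: "\<lbrakk>spec_le X x y; spec_le X y z\<rbrakk> \<Longrightarrow> spec_le X x z"
  by (auto simp: spec_le_def)

lemma spec_le_continuous:
  assumes f: "continuous_map X Y f" and xy: "spec_le X x y"
  shows "spec_le Y (f x) (f y)"
proof -
  have xy': "x \<in> topspace X" "y \<in> topspace X"
    using xy by (simp_all add: spec_le_def)
  have "f y \<in> U" if "openin Y U" "f x \<in> U" for U
    using spec_leD[OF xy openin_continuous_map_preimage[OF f that(1)]] that(2) xy' by simp
  then show ?thesis
    using xy' continuous_map_image_subset_topspace[OF f] by (auto simp: spec_le_def)
qed

lemma down_mono: "U \<subseteq> V \<Longrightarrow> down X U \<subseteq> down X V"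
  unfolding down_def by blast

lemma subset_down: "U \<subseteq> topspace X \<Longrightarrow> U \<subseteq> down X U"
  unfolding down_def using spec_le_refl by fastforce

lemma well_inside_empty: "well_inside X {} U"
  by (simp add: well_inside_def)

lemma proper_filter_up:
  assumes "U \<in> reg_open X" "U \<noteq> {}"
  shows "proper_filter (RO_struct X) {V \<in> reg_open X. U \<subseteq> V}"
  using assms unfolding proper_filter_def
  by (auto simp: meet_RO_struct Int_reg_open bottom_RO_struct)

context
  fixes X :: "'x topology"
  assumes X: "dV_space X"
begin

lemma dV_basis: "openin X U \<Longrightarrow> x \<in> U \<Longrightarrow> \<exists>W\<in>reg_open X. x \<in> W \<and> W \<subseteq> U"
  using X unfolding dV_space_def union_of_def arbitrary_def by auto

text \<open>Regular open sets are fixed by \<open>down\<close> followed by \<open>Int_le\<close>, so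
  membership in \<open>U\<close> may be tested on the points above \<open>x\<close>, and there only
  up to \<open>down X U\<close>. This is how a bound obtained from \<open>\<lless>\<close> is turned
  back into membership.\<close>

lemma dV_order_regular:
  assumes "U \<in> reg_open X" "x \<in> topspace X" "\<And>y. spec_le X x y \<Longrightarrow> y \<in> down X U"
  shows "x \<in> U"
proof -
  have "Int_le X (down X U) = U"
    using X assms(1) unfolding dV_space_def order_reg_open_def by blast
  then show ?thesis
    using assms(2,3) unfolding Int_le_def by blast
qed

lemma dV_well_inside_basis:
  assumes "U \<in> reg_open X" "x \<in> U"
  shows "\<exists>W\<in>reg_open X. x \<in> W \<and> well_inside X W U"
proof -
  have "x \<in> topspace X"
    using assms reg_openD(3) by blast
  then have "concordant_filter (RO_struct X) (reg_open_at X x)"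
    using X unfolding dV_space_def by blast
  then show ?thesis
    using assms unfolding concordant_filter_def reg_open_at_def by auto
qed

lemma dV_round_part:
  assumes "proper_filter (RO_struct X) F"
  shows "\<exists>x\<in>topspace X. round_part (RO_struct X) F = reg_open_at X x"
proof -
  have "\<exists>x\<in>topspace X. {U \<in> F. \<exists>W\<in>F. well_inside X W U} = reg_open_at X x"
    using X assms unfolding dV_space_def by blast
  then show ?thesis
    by (simp add: round_part_def)
qed

lemma reg_open_at_concordant:
  "x \<in> topspace X \<Longrightarrow> reg_open_at X x \<in> conc_filters (RO_struct X)"
  using X unfolding dV_space_def conc_filters_def by blast

text \<open>An open set is closed upwards, so every point above \<open>x \<in> U\<close> is again in
  \<open>U\<close> and hence in \<open>down X V\<close>; order-regularity of \<open>V\<close> then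
  yields \<open>x \<in> V\<close>.\<close>

lemma well_inside_subset:
  assumes "U \<in> reg_open X" "V \<in> reg_open X" "well_inside X U V"
  shows "U \<subseteq> V"
proof
  fix x assume x: "x \<in> U"
  show "x \<in> V"
  proof (rule dV_order_regular[OF assms(2)])
    show "x \<in> topspace X"
      using x assms(1) reg_openD(3) by blast
    fix y assume "spec_le X x y"
    then have "y \<in> U"
      using spec_leD[OF _ reg_openD(2)[OF assms(1)] x] by simp
    then show "y \<in> down X V"
      using assms closure_of_subset[of U X] reg_openD(3)[of U X] unfolding well_inside_def by blast
  qed
qed

text \<open>Any witness \<open>W\<close> contains \<open>U\<close>, and \<open>\<lless>\<close> is
  preserved by shrinking its left side, so \<open>U\<close> itself may serve as the witness.\<close>

lemma round_part_up:
  assumes U: "U \<in> reg_open X"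
  shows "round_part (RO_struct X) {V \<in> reg_open X. U \<subseteq> V}
    = {V \<in> reg_open X. U \<subseteq> V \<and> well_inside X U V}"
proof -
  have "well_inside X U V" if "U \<subseteq> W" "well_inside X W V" for V W
    using that closure_of_mono[of U W X] unfolding well_inside_def by blast
  then show ?thesis
    using U unfolding round_part_def by auto
qed

lemma round_part_up_concordant:
  assumes "U \<in> reg_open X" "U \<noteq> {}"
  shows "{V \<in> reg_open X. U \<subseteq> V \<and> well_inside X U V} \<in> conc_filters (RO_struct X)"
proof -
  obtain x where "x \<in> topspace X"
    "{V \<in> reg_open X. U \<subseteq> V \<and> well_inside X U V} = reg_open_at X x"
    using dV_round_part[OF proper_filter_up[OF assms]] unfolding round_part_up[OF assms(1)] by blast
  then show ?thesis
    using reg_open_at_concordant[of x] by simp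
qed

lemma deVries_algebra_RO_struct: "deVries_algebra (RO_struct X)"
proof -
  interpret complete_Boolean_lattice "RO_struct X"
    by (rule complete_Boolean_lattice_RO_struct)
  show ?thesis
  proof (unfold_locales, goal_cases)
    case 1
    show ?case
      using subset_down[of "topspace X" X] by (simp add: top_RO_struct well_inside_def)
  next
    case (2 U V)
    then show ?case
      by (simp add: well_inside_subset)
  next
    case (3 U V W T)
    then show ?case
      using closure_of_mono[of U V X] down_mono[of W T X] by (auto simp: well_inside_def)
  next
    \<comment> \<open>A4 is closure of the round part of the principal filter of \<open>U\<close>
      under meets. That filter is proper only for nonempty \<open>U\<close>; the empty set is well
      inside everything.\<close>
    case (4 U V W)
    show ?case
    proof (cases "U = {}")
      case True
      then show ?thesis by (simp add: well_inside_empty)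
    next
      case False
      have "V \<in> {V \<in> reg_open X. U \<subseteq> V \<and> well_inside X U V}"
        "W \<in> {V \<in> reg_open X. U \<subseteq> V \<and> well_inside X U V}"
        using 4 well_inside_subset[of U V] well_inside_subset[of U W] by simp_all
      then have "V \<sqinter>\<^bsub>RO_struct X\<^esub> W \<in> {V \<in> reg_open X. U \<subseteq> V \<and> well_inside X U V}"
        using round_part_up_concordant[of U] 4 False
        by (intro proper_filterD(5)[OF conc_filtersD(1)]) auto
      then show ?thesis
        by simp
    qed
  next
    case (5 U V)
    \<comment> \<open>A5: a point \<open>y\<close> of the closure of \<open>perp X V\<close> is not
      in \<open>V\<close>, so order-regularity supplies some \<open>z\<close> above \<open>y\<close>
      outside \<open>down X V\<close>. Then \<open>z\<close> avoids the closure of \<open>U\<close>,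
      which places it in \<open>perp X U\<close>.\<close>
    have "y \<in> down X (perp X U)" if y: "y \<in> X closure_of perp X V" for y
    proof -
      have V: "V \<in> reg_open X" and UV: "X closure_of U \<subseteq> down X V" and U: "U \<in> reg_open X"
        using 5 by (simp_all add: well_inside_def)
      have "perp X (perp X V) = V"
        by (rule reg_openD(1)[OF V])
      then have "y \<notin> V" and yX: "y \<in> topspace X"
        using y closure_of_subset_topspace[of X "perp X V"] unfolding perp_def[of X "perp X V"] by blast+
      then obtain z where z: "spec_le X y z" "z \<notin> down X V"
        using dV_order_regular[OF V] by blast
      then have "z \<in> perp X U"
        using UV by (auto simp: perp_def spec_le_def)
      then show ?thesis
        using z yX unfolding down_def by blast
    qed
    then show ?case
      using 5 by (auto simp: compl_RO_struct well_inside_def)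
  next
    \<comment> \<open>A6: the interpolant is the witness that the same round part is itself
      round.\<close>
    case (6 U W)
    show ?case
    proof (cases "U = {}")
      case True
      then show ?thesis using 6 empty_reg_open[of X] by (auto simp: well_inside_empty intro!: bexI[of _ "{}"])
    next
      case False
      have "W \<in> {V \<in> reg_open X. U \<subseteq> V \<and> well_inside X U V}"
        using 6 well_inside_subset[of U W] by simp
      then show ?thesis
        using conc_filtersD(2)[OF round_part_up_concordant[of U], of W] 6 False by auto
    qed
  next
    case (7 U)
    then obtain x where "x \<in> U"
      by (auto simp: bottom_RO_struct)
    then show ?case
      using dV_well_inside_basis[of U x] 7 by (auto simp: bottom_RO_struct)
  qed
qed

end

section \<open>The dV-space of a de Vries algebra\<close>

lemma regular_closedin_complement:
  assumes "regular_closedin X B"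
  shows "topspace X - B \<in> reg_open X"
proof -
  have B: "B \<subseteq> topspace X" "X closure_of (X interior_of B) = B"
    using assms by (simp_all add: regular_closedin_def)
  have "perp X (topspace X - B) = X interior_of B"
    using B(1) by (simp add: perp_def interior_of_closure_of)
  then have "perp X (perp X (topspace X - B)) = topspace X - B"
    using B(2) by (simp add: perp_def[of X "X interior_of B"])
  then show ?thesis
    by (simp add: reg_open_def)
qed

context deVries_algebra
begin

lemma reg_open_at_Lambda:
  assumes "F \<in> conc_filters V"
  shows "reg_open_at (Lambda V) F = hat V ` F"
proof -
  have "F \<in> hat V a \<longleftrightarrow> a \<in> F" for a
    using assms by (simp add: hat_def)
  then show ?thesis
    using filter_carrier[OF assms] unfolding reg_open_at_def reg_open_Lambda by blast
qed

lemma hat_image_concordant: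
  assumes F: "F \<in> conc_filters V"
  shows "concordant_filter (RO_struct (Lambda V)) (hat V ` F)"
proof -
  have car: "a \<in> carrier V" if "a \<in> F" for a
    using that F filter_carrier by blast
  have "hat V ` F \<subseteq> reg_open (Lambda V)"
    using car unfolding reg_open_Lambda by blast
  moreover have "hat V ` F \<noteq> {}"
    using filter_top[OF F] by blast
  moreover have "{} \<notin> hat V ` F"
  proof
    assume "{} \<in> hat V ` F"
    then obtain a where "a \<in> F" "hat V a = {}"
      by force
    then show False
      using hat_nonempty[of a] car filter_proper[OF F] by blast
  qed
  moreover have "U \<in> hat V ` F" if AU: "A \<in> hat V ` F" "U \<in> reg_open (Lambda V)" "A \<subseteq> U" for A U
  proof -
    obtain a b where ab: "a \<in> F" "A = hat V a" "b \<in> carrier V" "U = hat V b"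
      using AU(1,2) unfolding reg_open_Lambda by blast
    then have "b \<in> F"
      using AU(3) filter_up[OF F, of a b] car by (simp add: hat_subset_iff)
    then show ?thesis
      using ab by blast
  qed
  moreover have "A \<sqinter>\<^bsub>RO_struct (Lambda V)\<^esub> U \<in> hat V ` F" if AU: "A \<in> hat V ` F" "U \<in> hat V ` F" for A U
  proof -
    obtain a b where ab: "a \<in> F" "A = hat V a" "b \<in> F" "U = hat V b"
      using AU by blast
    then have "A \<sqinter>\<^bsub>RO_struct (Lambda V)\<^esub> U = hat V (a \<sqinter> b)"
      using car by (simp add: meet_RO_struct reg_open_Lambda hat_meet)
    then show ?thesis
      using ab filter_meet[OF F] by blast
  qed
  moreover have "\<exists>U\<in>hat V ` F. well_inside (Lambda V) U A" if A: "A \<in> hat V ` F" for A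
  proof -
    obtain a where a: "a \<in> F" "A = hat V a"
      using A by blast
    then obtain b where "b \<in> F" "b \<prec> a"
      using conc_filtersD(2)[OF F] by blast
    then show ?thesis
      using a car by (auto simp: well_inside_hat_iff)
  qed
  ultimately show ?thesis
    unfolding concordant_filter_def proper_filter_def by (simp add: bottom_RO_struct)
qed

text \<open>The filter is pulled back to \<open>V\<close> along \<open>hat V\<close>, its round part
  is formed there, and the result is pushed forward; \<open>well_inside_hat_iff\<close> matches the
  two notions of roundness.\<close>

lemma round_part_Lambda:
  assumes "proper_filter (RO_struct (Lambda V)) \<F>"
  shows "\<exists>G\<in>conc_filters V. {U \<in> \<F>. \<exists>W\<in>\<F>. well_inside (Lambda V) W U} = hat V ` G"
proof
  let ?F = "{a \<in> carrier V. hat V a \<in> \<F>}"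
  have sub: "\<F> \<subseteq> reg_open (Lambda V)" and ne: "\<F> \<noteq> {}" and bot: "{} \<notin> \<F>"
    and up: "\<And>A B. \<lbrakk>A \<in> \<F>; B \<in> reg_open (Lambda V); A \<subseteq> B\<rbrakk> \<Longrightarrow> B \<in> \<F>"
    and meet: "\<And>A B. \<lbrakk>A \<in> \<F>; B \<in> \<F>\<rbrakk> \<Longrightarrow> A \<inter> B \<in> \<F>"
  proof -
    show sub: "\<F> \<subseteq> reg_open (Lambda V)" and "\<F> \<noteq> {}" and "{} \<notin> \<F>"
      using proper_filterD(1-3)[OF assms] by (simp_all add: bottom_RO_struct)
    show "B \<in> \<F>" if "A \<in> \<F>" "B \<in> reg_open (Lambda V)" "A \<subseteq> B" for A B
      using that proper_filterD(4)[OF assms, of A B] by simp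
    show "A \<inter> B \<in> \<F>" if "A \<in> \<F>" "B \<in> \<F>" for A B
      using that proper_filterD(5)[OF assms that] subsetD[OF sub] by (simp add: meet_RO_struct)
  qed
  have "a \<sqinter> b \<in> ?F" if "a \<in> ?F" "b \<in> ?F" for a b
    using that meet[of "hat V a" "hat V b"] by (simp add: hat_meet)
  moreover have "b \<in> ?F" if "a \<in> ?F" "b \<in> carrier V" "a \<sqsubseteq> b" for a b
    using that up[of "hat V a" "hat V b"] by (simp add: hat_subset_iff reg_open_Lambda)
  moreover have "?F \<noteq> {}"
    using ne sub by (auto simp: reg_open_Lambda)
  ultimately have "proper_filter V ?F"
    using bot by (simp add: proper_filter_def hat_bottom)
  then show "round_part V ?F \<in> conc_filters V"
    by (rule round_part_concordant)
  show "{U \<in> \<F>. \<exists>W\<in>\<F>. well_inside (Lambda V) W U} = hat V ` round_part V ?F"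
  proof (intro equalityI subsetI)
    fix U assume "U \<in> {U \<in> \<F>. \<exists>W\<in>\<F>. well_inside (Lambda V) W U}"
    then obtain W where W: "U \<in> \<F>" "W \<in> \<F>" "well_inside (Lambda V) W U"
      by blast
    then obtain a b where ab: "a \<in> carrier V" "U = hat V a" "b \<in> carrier V" "W = hat V b"
      using sub unfolding reg_open_Lambda by blast
    then have "b \<prec> a"
      using W by (simp add: well_inside_hat_iff)
    then show "U \<in> hat V ` round_part V ?F"
      using W ab unfolding round_part_def by blast
  next
    fix U assume "U \<in> hat V ` round_part V ?F"
    then obtain a b where "a \<in> carrier V" "b \<in> carrier V" "hat V a \<in> \<F>" "hat V b \<in> \<F>" "b \<prec> a" "U = hat V a"
      unfolding round_part_def by blast
    then show "U \<in> {U \<in> \<F>. \<exists>W\<in>\<F>. well_inside (Lambda V) W U}"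
      using well_inside_hat_iff by blast
  qed
qed

text \<open>A regular closed \<open>B\<close> is the complement of some \<open>hat V b\<close>, so
  the points of \<open>Int_le (Lambda V) B\<close> are the filters none of whose concordant
  extensions contains \<open>b\<close>. The separating sets are found at the least of them,
  \<open>upper_filter b\<close>: it lies in the open complement of \<open>A\<close>, which yields
  its element \<open>d\<close>.\<close>

lemma order_normal_space_Lambda: "order_normal_space (Lambda V)"
  unfolding order_normal_space_def
proof (intro allI impI)
  fix A B assume AB: "closedin (Lambda V) A \<and> regular_closedin (Lambda V) B \<and> A \<inter> Int_le (Lambda V) B = {}"
  then have "topspace (Lambda V) - B \<in> reg_open (Lambda V)"
    using regular_closedin_complement by blast
  then obtain b where b: "b \<in> carrier V" "conc_filters V - B = hat V b"
    unfolding reg_open_Lambda topspace_Lambda by (metis imageE)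
  have B: "B = conc_filters V - hat V b"
    using AB b(2) by (auto simp: regular_closedin_def)
  have Int_le_B: "F \<in> Int_le (Lambda V) B \<longleftrightarrow>
      F \<in> conc_filters V \<and> (\<forall>G\<in>conc_filters V. F \<subseteq> G \<longrightarrow> b \<notin> G)" for F
    unfolding Int_le_def spec_le_Lambda B by (auto simp: hat_def)
  have A: "A \<subseteq> conc_filters V" "openin (Lambda V) (conc_filters V - A)"
    using AB by (auto simp: closedin_def)
  show "\<exists>U W. openin (Lambda V) U \<and> openin (Lambda V) W \<and> disjnt U W \<and>
      A \<subseteq> down (Lambda V) U \<and> Int_le (Lambda V) B \<subseteq> W"
  proof (cases "b = \<top>")
    case True
    then have "Int_le (Lambda V) B = {}"
      using Int_le_B filter_top by blast
    moreover have "A \<subseteq> down (Lambda V) (topspace (Lambda V))"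
      using A(1) subset_down[of "topspace (Lambda V)" "Lambda V"] by simp
    ultimately show ?thesis
      by (rule_tac exI[of _ "topspace (Lambda V)"], rule_tac exI[of _ "{}"])
        (simp add: disjnt_def del: topspace_Lambda)
  next
    case False
    have "upper_filter b \<in> Int_le (Lambda V) B"
      using upper_filter_concordant[OF b(1) False] upper_filter_not_mem[OF b(1)] Int_le_B by blast
    then have "upper_filter b \<in> conc_filters V - A"
      using AB Int_le_B by blast
    then obtain d where d: "d \<in> upper_filter b" "hat V d \<subseteq> conc_filters V - A"
      using openin_LambdaD[OF A(2)] by blast
    then have dc: "d \<in> carrier V" "compl V b \<prec> d"
      by (simp_all add: upper_filter_def)
    \<comment> \<open>With \<open>c\<close> between \<open>compl V b\<close> and \<open>d\<close>,
      both inclusions are instances of \<open>extend_filter\<close>: a point of \<open>A\<close>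
      omits \<open>d\<close> and extends to contain \<open>compl V c\<close>, as
      \<open>compl V d \<prec> compl V c\<close>; a point of \<open>Int_le (Lambda V) B\<close>
      cannot omit \<open>c\<close>, for \<open>compl V c \<prec> b\<close> would then extend it to
      contain \<open>b\<close>.\<close>
    then obtain c where c: "c \<in> carrier V" "compl V b \<prec> c" "c \<prec> d"
      using A6[of "compl V b" d] b by auto
    have cb: "compl V c \<prec> b"
      using A5[of "compl V b" c] b c by simp
    have dc': "compl V d \<prec> compl V c"
      using A5[of c d] c dc by simp
    have "disjnt (hat V (compl V c)) (hat V c)"
      using hat_meet[of c "compl V c"] c by (auto simp: disjnt_def meet_compl hat_bottom)
    moreover have "A \<subseteq> down (Lambda V) (hat V (compl V c))"
    proof
      fix F assume F: "F \<in> A"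
      then have "F \<in> conc_filters V" "d \<notin> F"
        using d(2) A(1) unfolding hat_def by auto
      then show "F \<in> down (Lambda V) (hat V (compl V c))"
        using extend_filter[of F "compl V d" "compl V c"] dc c dc' unfolding down_hat by simp
    qed
    moreover have "Int_le (Lambda V) B \<subseteq> hat V c"
    proof
      fix F assume "F \<in> Int_le (Lambda V) B"
      then have F: "F \<in> conc_filters V" "\<not> (\<exists>G\<in>conc_filters V. F \<subseteq> G \<and> b \<in> G)"
        using Int_le_B by auto
      then have "c \<in> F"
        using extend_filter[of F "compl V c" b] b c cb by auto
      then show "F \<in> hat V c"
        using F by (simp add: hat_def)
    qed
    ultimately show ?thesis
      using openin_hat[of c] openin_hat[of "compl V c"] c(1)
      by (rule_tac exI[of _ "hat V (compl V c)"], rule_tac exI[of _ "hat V c"]) simp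
  qed
qed

lemma dV_space_Lambda: "dV_space (Lambda V)"
proof -
  have basis: "openin (Lambda V) = arbitrary union_of (\<lambda>U. U \<in> reg_open (Lambda V))"
  proof
    fix U
    show "openin (Lambda V) U \<longleftrightarrow> (arbitrary union_of (\<lambda>U. U \<in> reg_open (Lambda V))) U"
    proof
      assume "openin (Lambda V) U"
      then obtain A where "A \<subseteq> carrier V" "U = (\<Union>a\<in>A. hat V a)"
        unfolding openin_Lambda_iff by blast
      then show "(arbitrary union_of (\<lambda>U. U \<in> reg_open (Lambda V))) U"
        unfolding union_of_def arbitrary_def reg_open_Lambda
        by (intro exI[of _ "hat V ` A"]) auto
    next
      assume "(arbitrary union_of (\<lambda>U. U \<in> reg_open (Lambda V))) U"
      then show "openin (Lambda V) U"
        unfolding union_of_def arbitrary_def using reg_openD(2) by (auto intro!: openin_Union)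
    qed
  qed
  have "reg_open (Lambda V) \<subseteq> order_reg_open (Lambda V)"
    unfolding reg_open_Lambda order_reg_open_def using Int_le_down_hat hat_subset by auto
  moreover have "\<forall>F\<in>topspace (Lambda V). concordant_filter (RO_struct (Lambda V)) (reg_open_at (Lambda V) F)"
    using hat_image_concordant by (simp add: reg_open_at_Lambda)
  moreover have "\<exists>G\<in>topspace (Lambda V). {U \<in> \<F>. \<exists>W\<in>\<F>. well_inside (Lambda V) W U} = reg_open_at (Lambda V) G"
    if "proper_filter (RO_struct (Lambda V)) \<F>" for \<F>
    using round_part_Lambda[OF that] by (simp add: reg_open_at_Lambda)
  ultimately show ?thesis
    using t0_space_Lambda compact_space_Lambda order_normal_space_Lambda basis
    unfolding dV_space_def by blast
qed

end

section \<open>De Vries morphisms and their duals\<close>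

locale deVries_morphism = V: deVries_algebra V + W: deVries_algebra W
  for V :: "'a dv_struct" and W :: "'b dv_struct" +
  fixes h :: "'a \<Rightarrow> 'b"
  assumes hom: "h \<in> deV_hom V W"
begin

lemma hom_closed: "a \<in> carrier V \<Longrightarrow> h a \<in> carrier W"
  using hom unfolding deV_hom_def by blast

lemma hom_bottom: "h \<bottom>\<^bsub>V\<^esub> = \<bottom>\<^bsub>W\<^esub>"
  using hom unfolding deV_hom_def by blast

lemma hom_meet: "\<lbrakk>a \<in> carrier V; b \<in> carrier V\<rbrakk> \<Longrightarrow> h (a \<sqinter>\<^bsub>V\<^esub> b) = h a \<sqinter>\<^bsub>W\<^esub> h b"
  using hom unfolding deV_hom_def by blast

lemma hom_compl_prec:
  "\<lbrakk>a \<in> carrier V; b \<in> carrier V; a \<prec>\<^bsub>V\<^esub> b\<rbrakk> \<Longrightarrow> compl W (h (compl V a)) \<prec>\<^bsub>W\<^esub> h b"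
  using hom unfolding deV_hom_def by blast

lemma hom_sup: "a \<in> carrier V \<Longrightarrow> h a = \<Squnion>\<^bsub>W\<^esub> {h b | b. b \<in> carrier V \<and> b \<prec>\<^bsub>V\<^esub> a}"
  using hom unfolding deV_hom_def by blast

lemma hom_mono:
  assumes "a \<in> carrier V" "b \<in> carrier V" "a \<sqsubseteq>\<^bsub>V\<^esub> b"
  shows "h a \<sqsubseteq>\<^bsub>W\<^esub> h b"
proof -
  have "a = a \<sqinter>\<^bsub>V\<^esub> b"
    using assms by (simp add: V.le_iff_join[symmetric])
  then have "h a = h a \<sqinter>\<^bsub>W\<^esub> h b"
    using hom_meet[of a b] assms by simp
  then show ?thesis
    using assms hom_closed by (simp add: W.le_iff_join)
qed

lemma hom_le_compl: "a \<in> carrier V \<Longrightarrow> h a \<sqsubseteq>\<^bsub>W\<^esub> compl W (h (compl V a))"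
  using hom_meet[of a "compl V a"] W.meet_eq_bottom_iff[of "h a" "h (compl V a)"]
  by (simp add: V.meet_compl hom_bottom hom_closed)

text \<open>Preservation of meets and of bottom puts \<open>h a\<close> below
  \<open>compl W (h (compl V a))\<close>, the element about which (V3) speaks.\<close>

lemma hom_prec:
  assumes "a \<in> carrier V" "b \<in> carrier V" "a \<prec>\<^bsub>V\<^esub> b"
  shows "h a \<prec>\<^bsub>W\<^esub> h b"
  using hom_compl_prec[OF assms] hom_le_compl[OF assms(1)] assms hom_closed
  by (intro W.prec_mono_left[of "h a" "compl W (h (compl V a))"]) simp_all

text \<open>(V3) for \<open>\<top> \<prec> \<top>\<close> reads
  \<open>\<top> \<prec> h \<top>\<close>, since \<open>h\<close> preserves bottom.\<close>

lemma hom_top: "h \<top>\<^bsub>V\<^esub> = \<top>\<^bsub>W\<^esub>"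
proof -
  have "\<top>\<^bsub>W\<^esub> \<prec>\<^bsub>W\<^esub> h \<top>\<^bsub>V\<^esub>"
    using hom_compl_prec[of "\<top>\<^bsub>V\<^esub>" "\<top>\<^bsub>V\<^esub>"] V.A1
    by (simp add: V.compl_top hom_bottom W.compl_bottom)
  then have "\<top>\<^bsub>W\<^esub> \<sqsubseteq>\<^bsub>W\<^esub> h \<top>\<^bsub>V\<^esub>"
    by (simp add: W.A2 hom_closed)
  then show ?thesis
    by (simp add: W.le_antisym W.top_higher hom_closed)
qed

lemma vimage_proper_filter:
  assumes F: "F \<in> conc_filters W"
  shows "proper_filter V {a \<in> carrier V. h a \<in> F}"
proof -
  have "\<top>\<^bsub>V\<^esub> \<in> {a \<in> carrier V. h a \<in> F}"
    using W.filter_top[OF F] by (simp add: hom_top)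
  moreover have "\<bottom>\<^bsub>V\<^esub> \<notin> {a \<in> carrier V. h a \<in> F}"
    using W.filter_proper[OF F] by (simp add: hom_bottom)
  moreover have "b \<in> {a \<in> carrier V. h a \<in> F}"
    if "a \<in> {a \<in> carrier V. h a \<in> F}" "b \<in> carrier V" "a \<sqsubseteq>\<^bsub>V\<^esub> b" for a b
    using that W.filter_up[OF F, of "h a" "h b"] hom_mono[of a b] hom_closed by simp
  moreover have "a \<sqinter>\<^bsub>V\<^esub> b \<in> {a \<in> carrier V. h a \<in> F}"
    if "a \<in> {a \<in> carrier V. h a \<in> F}" "b \<in> {a \<in> carrier V. h a \<in> F}" for a b
    using that W.filter_meet[OF F, of "h a" "h b"] by (simp add: hom_meet)
  ultimately show ?thesis
    unfolding proper_filter_def by blast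
qed

lemma Lambda_map_eq:
  "F \<in> conc_filters W \<Longrightarrow> Lambda_map V W h F = round_part V {a \<in> carrier V. h a \<in> F}"
  unfolding Lambda_map_def round_part_def by auto

lemma Lambda_map_closed: "F \<in> conc_filters W \<Longrightarrow> Lambda_map V W h F \<in> conc_filters V"
  using V.round_part_concordant[OF vimage_proper_filter] by (simp add: Lambda_map_eq)

lemma Lambda_map_mem_iff:
  assumes "F \<in> conc_filters W" "a \<in> carrier V"
  shows "a \<in> Lambda_map V W h F \<longleftrightarrow> (\<exists>b\<in>carrier V. h b \<in> F \<and> b \<prec>\<^bsub>V\<^esub> a)"
proof -
  have "h a \<in> F" if "b \<in> carrier V" "h b \<in> F" "b \<prec>\<^bsub>V\<^esub> a" for b
    using that assms W.filter_up[of F "h b" "h a"] V.A2[of b a] hom_mono[of b a] hom_closed by simp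
  then show ?thesis
    using assms unfolding Lambda_map_def by auto
qed

text \<open>As a union of basic sets this yields continuity; its double complement is
  \<open>hat W (h a)\<close> by (V4), which gives the naturality of \<open>eps\<close>.\<close>

lemma Lambda_map_vimage_hat:
  assumes a: "a \<in> carrier V"
  shows "{F \<in> conc_filters W. Lambda_map V W h F \<in> hat V a} = (\<Union>b\<in>{b \<in> carrier V. b \<prec>\<^bsub>V\<^esub> a}. hat W (h b))"
proof -
  have "Lambda_map V W h F \<in> hat V a \<longleftrightarrow> (\<exists>b\<in>carrier V. h b \<in> F \<and> b \<prec>\<^bsub>V\<^esub> a)"
    if "F \<in> conc_filters W" for F
    using that a Lambda_map_closed[OF that] Lambda_map_mem_iff[OF that a] by (simp add: hat_def)
  then show ?thesis
    unfolding hat_def[of W] by blast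
qed

lemma continuous_Lambda_map: "continuous_map (Lambda W) (Lambda V) (Lambda_map V W h)"
  unfolding V.Lambda_eq
proof (rule continuous_on_generated_topo)
  fix U assume "U \<in> hat V ` carrier V"
  then obtain a where a: "a \<in> carrier V" "U = hat V a"
    by blast
  have "Lambda_map V W h -` U \<inter> topspace (Lambda W) = (\<Union>b\<in>{b \<in> carrier V. b \<prec>\<^bsub>V\<^esub> a}. hat W (h b))"
    using Lambda_map_vimage_hat[OF a(1)] a(2) by auto
  moreover have "openin (Lambda W) (\<Union>b\<in>{b \<in> carrier V. b \<prec>\<^bsub>V\<^esub> a}. hat W (h b))"
    using W.openin_hat hom_closed by (intro openin_Union) auto
  ultimately show "openin (Lambda W) (Lambda_map V W h -` U \<inter> topspace (Lambda W))"
    by simp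
next
  have "\<Union> (hat V ` carrier V) = conc_filters V"
    using V.topspace_Lambda unfolding V.Lambda_eq topology_generated_by_topspace .
  then show "Lambda_map V W h ` topspace (Lambda W) \<subseteq> \<Union> (hat V ` carrier V)"
    using Lambda_map_closed by auto
qed

text \<open>The witness is the round part of the filter generated by \<open>F \<union> h ` G\<close>.\<close>

lemma Lambda_map_weakly_dense:
  assumes F: "F \<in> conc_filters W" and G: "G \<in> conc_filters V" and sub: "Lambda_map V W h F \<subseteq> G"
  shows "\<exists>H\<in>conc_filters W. F \<subseteq> H \<and> G \<subseteq> Lambda_map V W h H"
proof -
  have car: "a \<in> carrier V" if "a \<in> G" for a
    using that G V.filter_carrier by blast
  have disj: "f \<sqinter>\<^bsub>W\<^esub> h g \<noteq> \<bottom>\<^bsub>W\<^esub>" if fg: "f \<in> F" "g \<in> G" for f g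
  proof
    assume *: "f \<sqinter>\<^bsub>W\<^esub> h g = \<bottom>\<^bsub>W\<^esub>"
    \<comment> \<open>Two steps below \<open>g\<close> are required: (V3) along
      \<open>g' \<prec> g\<close> carries \<open>f\<close> below \<open>h (compl V g')\<close>, and
      \<open>compl V g' \<prec> compl V g''\<close> then gives \<open>compl V g''\<close> the
      witness it needs in \<open>Lambda_map V W h F\<close>.\<close>
    obtain g' where g': "g' \<in> G" "g' \<prec>\<^bsub>V\<^esub> g"
      using conc_filtersD(2)[OF G fg(2)] by blast
    obtain g'' where g'': "g'' \<in> G" "g'' \<prec>\<^bsub>V\<^esub> g'"
      using conc_filtersD(2)[OF G g'(1)] by blast
    note c = car[OF fg(2)] car[OF g'(1)] car[OF g''(1)]
    have f: "f \<in> carrier W"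
      using F fg W.filter_carrier by blast
    have "compl W (h (compl V (compl V g))) \<prec>\<^bsub>W\<^esub> h (compl V g')"
      using c V.A5[of g' g] g' by (intro hom_compl_prec) simp_all
    then have "compl W (h g) \<sqsubseteq>\<^bsub>W\<^esub> h (compl V g')"
      using c hom_closed W.A2[of "compl W (h g)" "h (compl V g')"] by simp
    moreover have "f \<sqsubseteq>\<^bsub>W\<^esub> compl W (h g)"
      using * f c hom_closed W.meet_eq_bottom_iff[of f "h g"] by simp
    ultimately have "f \<sqsubseteq>\<^bsub>W\<^esub> h (compl V g')"
      using f c hom_closed W.le_trans[of f "compl W (h g)" "h (compl V g')"] by simp
    then have "h (compl V g') \<in> F"
      using F f fg c hom_closed W.filter_up[of F f "h (compl V g')"] by simp
    moreover have "compl V g' \<prec>\<^bsub>V\<^esub> compl V g''"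
      using V.A5[of g'' g'] c g'' by simp
    ultimately have "compl V g'' \<in> Lambda_map V W h F"
      using Lambda_map_mem_iff[OF F, of "compl V g''"] c by auto
    then have "compl V g'' \<in> G"
      using sub by blast
    then show False
      using V.filter_disjoint[OF G g''(1), of "compl V g''"] V.meet_compl c by simp
  qed
  have ex: "\<exists>g. g \<in> G"
    using V.filter_top[OF G] by blast
  obtain H where H: "proper_filter W H" "F \<subseteq> round_part W H" "h ` G \<subseteq> H"
  proof (rule W.generated_filter[OF F, of "h ` G"])
    show "h ` G \<subseteq> carrier W" "h ` G \<noteq> {}"
      using car hom_closed ex by auto
    show "a \<sqinter>\<^bsub>W\<^esub> b \<in> h ` G" if ab: "a \<in> h ` G" "b \<in> h ` G" for a b
    proof -
      obtain x y where xy: "x \<in> G" "a = h x" "y \<in> G" "b = h y"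
        using ab by blast
      then have "a \<sqinter>\<^bsub>W\<^esub> b = h (x \<sqinter>\<^bsub>V\<^esub> y)"
        using car hom_meet by simp
      then show ?thesis
        using V.filter_meet[OF G] xy by simp
    qed
    show "a \<sqinter>\<^bsub>W\<^esub> b \<noteq> \<bottom>\<^bsub>W\<^esub>" if ab: "a \<in> F" "b \<in> h ` G" for a b
      using ab disj by blast
  qed
  have R: "round_part W H \<in> conc_filters W"
    using H(1) by (rule W.round_part_concordant)
  have "g \<in> Lambda_map V W h (round_part W H)" if g: "g \<in> G" for g
  proof -
    \<comment> \<open>\<open>g''\<close> makes \<open>h g'\<close> an element of the round part, and
      \<open>g'\<close> in turn is the witness for \<open>g\<close>.\<close>
    obtain g' where g': "g' \<in> G" "g' \<prec>\<^bsub>V\<^esub> g"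
      using conc_filtersD(2)[OF G g] by blast
    obtain g'' where g'': "g'' \<in> G" "g'' \<prec>\<^bsub>V\<^esub> g'"
      using conc_filtersD(2)[OF G g'(1)] by blast
    have "h g' \<in> round_part W H"
      using H(3) g' g'' hom_prec[of g'' g'] car unfolding round_part_def by blast
    then show ?thesis
      using Lambda_map_mem_iff[OF R, of g] g g' car by auto
  qed
  then show ?thesis
    using R H(2) by blast
qed

lemma Lambda_map_hom: "Lambda_map V W h \<in> dVS_hom (Lambda W) (Lambda V)"
proof -
  have "Lambda_map V W h \<in> conc_filters W \<rightarrow>\<^sub>E conc_filters V"
    using Lambda_map_closed by (auto simp: Lambda_map_def)
  then show ?thesis
    using continuous_Lambda_map Lambda_map_weakly_dense Lambda_map_closed
    unfolding dVS_hom_def by (auto simp: V.spec_le_Lambda W.spec_le_Lambda)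
qed

end

section \<open>The category of de Vries algebras\<close>

context deVries_algebra
begin

text \<open>If an upper bound \<open>u\<close> were not above \<open>a\<close>, A7 would find a
  nonzero \<open>c \<prec> a \<sqinter> compl V u\<close>. This \<open>c\<close> is among the joined
  elements, so it lies below both \<open>u\<close> and its complement. The equation is (V4) for the
  identity.\<close>

lemma sup_prec:
  assumes a: "a \<in> carrier V"
  shows "\<Squnion>{b. b \<in> carrier V \<and> b \<prec> a} = a"
proof (rule sup_eqI)
  let ?A = "{b. b \<in> carrier V \<and> b \<prec> a}"
  fix u assume u: "u \<in> carrier V" "\<forall>b\<in>?A. b \<sqsubseteq> u"
  show "a \<sqsubseteq> u"
  proof (rule ccontr)
    assume "\<not> a \<sqsubseteq> u"
    then have "a \<sqinter> compl V u \<noteq> \<bottom>"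
      using a u by (simp add: le_iff_meet_compl)
    then obtain c where c: "c \<in> carrier V" "c \<noteq> \<bottom>" "c \<prec> a \<sqinter> compl V u"
      using A7[of "a \<sqinter> compl V u"] a u by auto
    then have "c \<prec> a" "c \<prec> compl V u"
      using a u prec_mono_right[of c "a \<sqinter> compl V u"] by (simp_all add: meet_left meet_right)
    then have "c \<sqsubseteq> u" "c \<sqsubseteq> compl V u"
      using u c A2[of c "compl V u"] by simp_all
    then have "c \<sqsubseteq> u \<sqinter> compl V u"
      using u c by (simp add: meet_le)
    then show False
      using u c by (simp add: meet_compl eq_bottomI)
  qed
qed (use a A2 in auto)

lemma deV_id_hom: "deV_id V \<in> deV_hom V V"
proof -
  have "{deV_id V b | b. b \<in> carrier V \<and> b \<prec> a} = {b. b \<in> carrier V \<and> b \<prec> a}" for a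
    by (auto simp: deV_id_def)
  then show ?thesis
    unfolding deV_hom_def by (auto simp: deV_id_def sup_prec)
qed

end

locale deVries_composable = h: deVries_morphism V\<^sub>1 V\<^sub>2 h + k: deVries_morphism V\<^sub>2 V\<^sub>3 k
  for V\<^sub>1 :: "'a dv_struct" and V\<^sub>2 :: "'b dv_struct" and V\<^sub>3 :: "'c dv_struct" and h k
begin

lemma comp_set: "{k (h b) | b. b \<in> carrier V\<^sub>1 \<and> b \<prec>\<^bsub>V\<^sub>1\<^esub> a} \<subseteq> carrier V\<^sub>3"
  using h.hom_closed k.hom_closed by blast

lemma comp_eq:
  "a \<in> carrier V\<^sub>1 \<Longrightarrow> deV_comp V\<^sub>1 V\<^sub>3 k h a = \<Squnion>\<^bsub>V\<^sub>3\<^esub> {k (h b) | b. b \<in> carrier V\<^sub>1 \<and> b \<prec>\<^bsub>V\<^sub>1\<^esub> a}"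
  by (simp add: deV_comp_def)

lemma comp_closed: "a \<in> carrier V\<^sub>1 \<Longrightarrow> deV_comp V\<^sub>1 V\<^sub>3 k h a \<in> carrier V\<^sub>3"
  unfolding comp_eq by (rule k.W.sup_closed[OF comp_set])

text \<open>With \<open>comp_ge\<close> this squeezes the composite at \<open>a\<close> between the
  values \<open>k (h b)\<close> for \<open>b \<prec> a\<close> and the value \<open>k (h a)\<close>.
  Interpolants between \<open>b\<close> and \<open>a\<close> then turn facts about plain composites
  into facts about \<open>deV_comp\<close>.\<close>

lemma comp_le: "a \<in> carrier V\<^sub>1 \<Longrightarrow> deV_comp V\<^sub>1 V\<^sub>3 k h a \<sqsubseteq>\<^bsub>V\<^sub>3\<^esub> k (h a)"
  unfolding comp_eq using h.V.A2[of _ a] h.hom_mono[of _ a] k.hom_mono[of "h _" "h a"]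
    h.hom_closed k.hom_closed
  by (intro k.W.sup_least[OF comp_set]) auto

lemma comp_ge:
  "\<lbrakk>a \<in> carrier V\<^sub>1; b \<in> carrier V\<^sub>1; b \<prec>\<^bsub>V\<^sub>1\<^esub> a\<rbrakk> \<Longrightarrow> k (h b) \<sqsubseteq>\<^bsub>V\<^sub>3\<^esub> deV_comp V\<^sub>1 V\<^sub>3 k h a"
  unfolding comp_eq by (rule k.W.sup_upper[OF comp_set]) blast

lemma comp_least:
  assumes "a \<in> carrier V\<^sub>1" "u \<in> carrier V\<^sub>3"
    and "\<And>b. \<lbrakk>b \<in> carrier V\<^sub>1; b \<prec>\<^bsub>V\<^sub>1\<^esub> a\<rbrakk> \<Longrightarrow> k (h b) \<sqsubseteq>\<^bsub>V\<^sub>3\<^esub> u"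
  shows "deV_comp V\<^sub>1 V\<^sub>3 k h a \<sqsubseteq>\<^bsub>V\<^sub>3\<^esub> u"
  unfolding comp_eq[OF assms(1)] using assms by (intro k.W.sup_least[OF comp_set]) auto

lemma comp_mono:
  assumes "a \<in> carrier V\<^sub>1" "b \<in> carrier V\<^sub>1" "a \<sqsubseteq>\<^bsub>V\<^sub>1\<^esub> b"
  shows "deV_comp V\<^sub>1 V\<^sub>3 k h a \<sqsubseteq>\<^bsub>V\<^sub>3\<^esub> deV_comp V\<^sub>1 V\<^sub>3 k h b"
proof (rule comp_least)
  show "k (h c) \<sqsubseteq>\<^bsub>V\<^sub>3\<^esub> deV_comp V\<^sub>1 V\<^sub>3 k h b" if "c \<in> carrier V\<^sub>1" "c \<prec>\<^bsub>V\<^sub>1\<^esub> a" for c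
    using that assms h.V.prec_mono_right[of c a b] by (simp add: comp_ge)
qed (use assms comp_closed in auto)

lemma comp_bottom: "deV_comp V\<^sub>1 V\<^sub>3 k h \<bottom>\<^bsub>V\<^sub>1\<^esub> = \<bottom>\<^bsub>V\<^sub>3\<^esub>"
  using comp_le[of "\<bottom>\<^bsub>V\<^sub>1\<^esub>"] comp_closed[of "\<bottom>\<^bsub>V\<^sub>1\<^esub>"]
  by (simp add: h.hom_bottom k.hom_bottom k.W.eq_bottomI)

text \<open>Since \<open>c \<prec> a\<close> and \<open>d \<prec> b\<close> give
  \<open>c \<sqinter> d \<prec> a \<sqinter> b\<close>, the meet of the two joins is bounded by
  infinite distributivity.\<close>

lemma comp_meet:
  assumes a: "a \<in> carrier V\<^sub>1" and b: "b \<in> carrier V\<^sub>1"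
  shows "deV_comp V\<^sub>1 V\<^sub>3 k h (a \<sqinter>\<^bsub>V\<^sub>1\<^esub> b) = deV_comp V\<^sub>1 V\<^sub>3 k h a \<sqinter>\<^bsub>V\<^sub>3\<^esub> deV_comp V\<^sub>1 V\<^sub>3 k h b"
proof (rule k.W.le_antisym)
  show "deV_comp V\<^sub>1 V\<^sub>3 k h (a \<sqinter>\<^bsub>V\<^sub>1\<^esub> b) \<sqsubseteq>\<^bsub>V\<^sub>3\<^esub> deV_comp V\<^sub>1 V\<^sub>3 k h a \<sqinter>\<^bsub>V\<^sub>3\<^esub> deV_comp V\<^sub>1 V\<^sub>3 k h b"
    using a b comp_closed by (simp add: comp_mono k.W.meet_le h.V.meet_left h.V.meet_right)
  have "k (h c) \<sqinter>\<^bsub>V\<^sub>3\<^esub> k (h d) \<sqsubseteq>\<^bsub>V\<^sub>3\<^esub> deV_comp V\<^sub>1 V\<^sub>3 k h (a \<sqinter>\<^bsub>V\<^sub>1\<^esub> b)"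
    if "c \<in> carrier V\<^sub>1" "c \<prec>\<^bsub>V\<^sub>1\<^esub> a" "d \<in> carrier V\<^sub>1" "d \<prec>\<^bsub>V\<^sub>1\<^esub> b" for c d
    using that a b comp_ge[of "a \<sqinter>\<^bsub>V\<^sub>1\<^esub> b" "c \<sqinter>\<^bsub>V\<^sub>1\<^esub> d"] h.V.prec_meet[of c a d b]
    by (simp add: h.hom_meet k.hom_meet h.hom_closed)
  then show "deV_comp V\<^sub>1 V\<^sub>3 k h a \<sqinter>\<^bsub>V\<^sub>3\<^esub> deV_comp V\<^sub>1 V\<^sub>3 k h b \<sqsubseteq>\<^bsub>V\<^sub>3\<^esub> deV_comp V\<^sub>1 V\<^sub>3 k h (a \<sqinter>\<^bsub>V\<^sub>1\<^esub> b)"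
    using comp_closed[of "a \<sqinter>\<^bsub>V\<^sub>1\<^esub> b"] a b unfolding comp_eq[OF a] comp_eq[OF b]
    by (intro k.W.sup_meet_sup_le[OF comp_set comp_set]) auto
qed (use a b comp_closed in auto)

lemma comp_compl_prec:
  assumes a: "a \<in> carrier V\<^sub>1" and b: "b \<in> carrier V\<^sub>1" and "a \<prec>\<^bsub>V\<^sub>1\<^esub> b"
  shows "compl V\<^sub>3 (deV_comp V\<^sub>1 V\<^sub>3 k h (compl V\<^sub>1 a)) \<prec>\<^bsub>V\<^sub>3\<^esub> deV_comp V\<^sub>1 V\<^sub>3 k h b"
proof -
  \<comment> \<open>There are two interpolants, \<open>a \<prec> c \<prec> d \<prec> b\<close>. The
    outer steps pay for replacing the composite by the plain values at
    \<open>compl V\<^sub>1 c\<close> and at \<open>d\<close>; the middle step is where (V3) is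
    applied, for \<open>h\<close> and then for \<open>k\<close>.\<close>
  obtain d where d: "d \<in> carrier V\<^sub>1" "a \<prec>\<^bsub>V\<^sub>1\<^esub> d" "d \<prec>\<^bsub>V\<^sub>1\<^esub> b"
    using h.V.A6 assms by blast
  obtain c where c: "c \<in> carrier V\<^sub>1" "a \<prec>\<^bsub>V\<^sub>1\<^esub> c" "c \<prec>\<^bsub>V\<^sub>1\<^esub> d"
    using h.V.A6[OF a d(1,2)] by blast
  let ?u = "h (compl V\<^sub>1 c)"
  have u: "?u \<in> carrier V\<^sub>2"
    using c h.hom_closed by simp
  have "k ?u \<sqsubseteq>\<^bsub>V\<^sub>3\<^esub> deV_comp V\<^sub>1 V\<^sub>3 k h (compl V\<^sub>1 a)"
    using a c h.V.A5[of a c] by (simp add: comp_ge)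
  then have 1: "compl V\<^sub>3 (deV_comp V\<^sub>1 V\<^sub>3 k h (compl V\<^sub>1 a)) \<sqsubseteq>\<^bsub>V\<^sub>3\<^esub> compl V\<^sub>3 (k ?u)"
    using a u k.hom_closed comp_closed by (simp add: k.W.compl_antimono)
  have "compl V\<^sub>2 ?u \<prec>\<^bsub>V\<^sub>2\<^esub> h d"
    using h.hom_compl_prec[of c d] c d by simp
  then have 2: "compl V\<^sub>3 (k ?u) \<prec>\<^bsub>V\<^sub>3\<^esub> k (h d)"
    using k.hom_compl_prec[of "compl V\<^sub>2 ?u" "h d"] u d h.hom_closed by simp
  have 3: "k (h d) \<sqsubseteq>\<^bsub>V\<^sub>3\<^esub> deV_comp V\<^sub>1 V\<^sub>3 k h b"
    using b d by (simp add: comp_ge)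
  show ?thesis
    using 1 2 3 by (rule k.W.A3[rotated 4]) (use a b d u comp_closed h.hom_closed k.hom_closed in auto)
qed

lemma comp_sup:
  assumes a: "a \<in> carrier V\<^sub>1"
  shows "deV_comp V\<^sub>1 V\<^sub>3 k h a
    = \<Squnion>\<^bsub>V\<^sub>3\<^esub> {deV_comp V\<^sub>1 V\<^sub>3 k h b | b. b \<in> carrier V\<^sub>1 \<and> b \<prec>\<^bsub>V\<^sub>1\<^esub> a}"
proof (rule k.W.sup_eqI[symmetric])
  show "{deV_comp V\<^sub>1 V\<^sub>3 k h b | b. b \<in> carrier V\<^sub>1 \<and> b \<prec>\<^bsub>V\<^sub>1\<^esub> a} \<subseteq> carrier V\<^sub>3"
    using comp_closed by blast
  show "x \<sqsubseteq>\<^bsub>V\<^sub>3\<^esub> deV_comp V\<^sub>1 V\<^sub>3 k h a"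
    if "x \<in> {deV_comp V\<^sub>1 V\<^sub>3 k h b | b. b \<in> carrier V\<^sub>1 \<and> b \<prec>\<^bsub>V\<^sub>1\<^esub> a}" for x
    using that a h.V.A2 comp_mono by auto
  show "deV_comp V\<^sub>1 V\<^sub>3 k h a \<sqsubseteq>\<^bsub>V\<^sub>3\<^esub> u"
    if u: "u \<in> carrier V\<^sub>3" "\<forall>x\<in>{deV_comp V\<^sub>1 V\<^sub>3 k h b | b. b \<in> carrier V\<^sub>1 \<and> b \<prec>\<^bsub>V\<^sub>1\<^esub> a}. x \<sqsubseteq>\<^bsub>V\<^sub>3\<^esub> u" for u
  proof (rule comp_least[OF a u(1)])
    fix b assume b: "b \<in> carrier V\<^sub>1" "b \<prec>\<^bsub>V\<^sub>1\<^esub> a"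
    then obtain c where c: "c \<in> carrier V\<^sub>1" "b \<prec>\<^bsub>V\<^sub>1\<^esub> c" "c \<prec>\<^bsub>V\<^sub>1\<^esub> a"
      using h.V.A6[OF b(1) a] by blast
    then have "deV_comp V\<^sub>1 V\<^sub>3 k h c \<sqsubseteq>\<^bsub>V\<^sub>3\<^esub> u"
      using u(2) by blast
    then show "k (h b) \<sqsubseteq>\<^bsub>V\<^sub>3\<^esub> u"
      using comp_ge[of c b] b c u comp_closed h.hom_closed k.hom_closed
        k.W.le_trans[of "k (h b)" "deV_comp V\<^sub>1 V\<^sub>3 k h c" u] by simp
  qed
qed (rule comp_closed[OF a])

lemma comp_hom: "deV_comp V\<^sub>1 V\<^sub>3 k h \<in> deV_hom V\<^sub>1 V\<^sub>3"
proof -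
  have "deV_comp V\<^sub>1 V\<^sub>3 k h \<in> carrier V\<^sub>1 \<rightarrow>\<^sub>E carrier V\<^sub>3"
    using comp_closed by (auto simp: deV_comp_def)
  then show ?thesis
    unfolding deV_hom_def using comp_bottom comp_meet comp_compl_prec comp_sup by blast
qed

lemma comp_morphism: "deVries_morphism V\<^sub>1 V\<^sub>3 (deV_comp V\<^sub>1 V\<^sub>3 k h)"
  by unfold_locales (rule comp_hom)

end

text \<open>Both sides equal the join of \<open>l (k (h b))\<close> over \<open>b \<prec> a\<close>.
  Each inner composite is at most the plain value at the same element and at least the plain value
  one step of \<open>\<prec>\<close> lower, so an interpolant \<open>c\<close> makes up for the
  difference.\<close>

lemma deV_comp_assoc:
  assumes h: "deVries_morphism V\<^sub>1 V\<^sub>2 h" and k: "deVries_morphism V\<^sub>2 V\<^sub>3 k" and l: "deVries_morphism V\<^sub>3 V\<^sub>4 l"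
  shows "deV_comp V\<^sub>1 V\<^sub>4 (deV_comp V\<^sub>2 V\<^sub>4 l k) h = deV_comp V\<^sub>1 V\<^sub>4 l (deV_comp V\<^sub>1 V\<^sub>3 k h)"
proof
  interpret hk: deVries_composable V\<^sub>1 V\<^sub>2 V\<^sub>3 h k
    using h k by (simp add: deVries_composable_def)
  interpret kl: deVries_composable V\<^sub>2 V\<^sub>3 V\<^sub>4 k l
    using k l by (simp add: deVries_composable_def)
  interpret L: deVries_composable V\<^sub>1 V\<^sub>2 V\<^sub>4 h "deV_comp V\<^sub>2 V\<^sub>4 l k"
    using h kl.comp_morphism by (simp add: deVries_composable_def)
  interpret R: deVries_composable V\<^sub>1 V\<^sub>3 V\<^sub>4 "deV_comp V\<^sub>1 V\<^sub>3 k h" l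
    using l hk.comp_morphism by (simp add: deVries_composable_def)
  fix a
  show "deV_comp V\<^sub>1 V\<^sub>4 (deV_comp V\<^sub>2 V\<^sub>4 l k) h a = deV_comp V\<^sub>1 V\<^sub>4 l (deV_comp V\<^sub>1 V\<^sub>3 k h) a"
  proof (cases "a \<in> carrier V\<^sub>1")
    case False
    then show ?thesis by (simp add: deV_comp_def)
  next
    case a: True
    have interpolate: "\<exists>c\<in>carrier V\<^sub>1. b \<prec>\<^bsub>V\<^sub>1\<^esub> c \<and> c \<prec>\<^bsub>V\<^sub>1\<^esub> a" if "b \<in> carrier V\<^sub>1" "b \<prec>\<^bsub>V\<^sub>1\<^esub> a" for b
      using hk.h.V.A6[OF that(1) a that(2)] .
    show ?thesis
    proof (rule kl.k.W.le_antisym)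
      show "deV_comp V\<^sub>1 V\<^sub>4 (deV_comp V\<^sub>2 V\<^sub>4 l k) h a \<sqsubseteq>\<^bsub>V\<^sub>4\<^esub> deV_comp V\<^sub>1 V\<^sub>4 l (deV_comp V\<^sub>1 V\<^sub>3 k h) a"
      proof (rule L.comp_least[OF a R.comp_closed[OF a]])
        fix b assume b: "b \<in> carrier V\<^sub>1" "b \<prec>\<^bsub>V\<^sub>1\<^esub> a"
        then obtain c where c: "c \<in> carrier V\<^sub>1" "b \<prec>\<^bsub>V\<^sub>1\<^esub> c" "c \<prec>\<^bsub>V\<^sub>1\<^esub> a"
          using interpolate by blast
        have "deV_comp V\<^sub>2 V\<^sub>4 l k (h b) \<sqsubseteq>\<^bsub>V\<^sub>4\<^esub> l (k (h b))"
          using b hk.h.hom_closed by (simp add: kl.comp_le)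
        moreover have "l (k (h b)) \<sqsubseteq>\<^bsub>V\<^sub>4\<^esub> l (deV_comp V\<^sub>1 V\<^sub>3 k h c)"
          using b c hk.comp_ge[of c b] hk.h.hom_closed hk.k.hom_closed hk.comp_closed
          by (intro kl.k.hom_mono) auto
        moreover have "l (deV_comp V\<^sub>1 V\<^sub>3 k h c) \<sqsubseteq>\<^bsub>V\<^sub>4\<^esub> deV_comp V\<^sub>1 V\<^sub>4 l (deV_comp V\<^sub>1 V\<^sub>3 k h) a"
          using a c by (simp add: R.comp_ge)
        ultimately show "deV_comp V\<^sub>2 V\<^sub>4 l k (h b) \<sqsubseteq>\<^bsub>V\<^sub>4\<^esub> deV_comp V\<^sub>1 V\<^sub>4 l (deV_comp V\<^sub>1 V\<^sub>3 k h) a"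
          using a b c hk.h.hom_closed hk.k.hom_closed hk.comp_closed kl.k.hom_closed
            kl.comp_closed R.comp_closed
          by (meson kl.k.W.le_trans)
      qed
      show "deV_comp V\<^sub>1 V\<^sub>4 l (deV_comp V\<^sub>1 V\<^sub>3 k h) a \<sqsubseteq>\<^bsub>V\<^sub>4\<^esub> deV_comp V\<^sub>1 V\<^sub>4 (deV_comp V\<^sub>2 V\<^sub>4 l k) h a"
      proof (rule R.comp_least[OF a L.comp_closed[OF a]])
        fix b assume b: "b \<in> carrier V\<^sub>1" "b \<prec>\<^bsub>V\<^sub>1\<^esub> a"
        then obtain c where c: "c \<in> carrier V\<^sub>1" "b \<prec>\<^bsub>V\<^sub>1\<^esub> c" "c \<prec>\<^bsub>V\<^sub>1\<^esub> a"
          using interpolate by blast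
        have "l (deV_comp V\<^sub>1 V\<^sub>3 k h b) \<sqsubseteq>\<^bsub>V\<^sub>4\<^esub> l (k (h b))"
          using b hk.comp_le[of b] hk.h.hom_closed hk.k.hom_closed hk.comp_closed
          by (intro kl.k.hom_mono) auto
        moreover have "l (k (h b)) \<sqsubseteq>\<^bsub>V\<^sub>4\<^esub> deV_comp V\<^sub>2 V\<^sub>4 l k (h c)"
          using b c hk.h.hom_closed hk.h.hom_prec[of b c] by (simp add: kl.comp_ge)
        moreover have "deV_comp V\<^sub>2 V\<^sub>4 l k (h c) \<sqsubseteq>\<^bsub>V\<^sub>4\<^esub> deV_comp V\<^sub>1 V\<^sub>4 (deV_comp V\<^sub>2 V\<^sub>4 l k) h a"
          using a c by (simp add: L.comp_ge)
        ultimately show "l (deV_comp V\<^sub>1 V\<^sub>3 k h b) \<sqsubseteq>\<^bsub>V\<^sub>4\<^esub> deV_comp V\<^sub>1 V\<^sub>4 (deV_comp V\<^sub>2 V\<^sub>4 l k) h a"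
          using a b c hk.h.hom_closed hk.k.hom_closed hk.comp_closed kl.k.hom_closed
            kl.comp_closed L.comp_closed
          by (meson kl.k.W.le_trans)
      qed
    qed (use a L.comp_closed R.comp_closed in auto)
  qed
qed

context deVries_morphism
begin

lemma hom_extensional: "h \<in> carrier V \<rightarrow>\<^sub>E carrier W"
  using hom unfolding deV_hom_def by blast

text \<open>The composition joins over all \<open>b \<prec> a\<close>, so both unit laws amount to
  (V4).\<close>

lemma comp_id_right: "deV_comp V W h (deV_id V) = h"
proof
  fix a
  show "deV_comp V W h (deV_id V) a = h a"
  proof (cases "a \<in> carrier V")
    case True
    have "{h (deV_id V b) | b. b \<in> carrier V \<and> b \<prec>\<^bsub>V\<^esub> a} = {h b | b. b \<in> carrier V \<and> b \<prec>\<^bsub>V\<^esub> a}"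
      by (auto simp: deV_id_def)
    then show ?thesis
      using True hom_sup[OF True] unfolding deV_comp_def by simp
  next
    case False
    then show ?thesis
      using PiE_arb[OF hom_extensional] by (simp add: deV_comp_def)
  qed
qed

lemma comp_id_left: "deV_comp V W (deV_id W) h = h"
proof
  fix a
  show "deV_comp V W (deV_id W) h a = h a"
  proof (cases "a \<in> carrier V")
    case True
    have "{deV_id W (h b) | b. b \<in> carrier V \<and> b \<prec>\<^bsub>V\<^esub> a} = {h b | b. b \<in> carrier V \<and> b \<prec>\<^bsub>V\<^esub> a}"
      using hom_closed by (force simp: deV_id_def)
    then show ?thesis
      using True hom_sup[OF True] unfolding deV_comp_def by simp
  next
    case False
    then show ?thesis
      using PiE_arb[OF hom_extensional] by (simp add: deV_comp_def)
  qed
qed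

end

lemma deVries_morphismI:
  "\<lbrakk>deVries_algebra V; deVries_algebra W; h \<in> deV_hom V W\<rbrakk> \<Longrightarrow> deVries_morphism V W h"
  by (simp add: deVries_morphism_def deVries_morphism_axioms_def)

lemma deVries_composableI:
  "\<lbrakk>deVries_algebra V\<^sub>1; deVries_algebra V\<^sub>2; deVries_algebra V\<^sub>3; h \<in> deV_hom V\<^sub>1 V\<^sub>2; k \<in> deV_hom V\<^sub>2 V\<^sub>3\<rbrakk>
    \<Longrightarrow> deVries_composable V\<^sub>1 V\<^sub>2 V\<^sub>3 h k"
  by (simp add: deVries_composable_def deVries_morphismI)

lemma deV_simps [simp]:
  "Obj deV = {V. deVries_algebra V}" "Hom deV = deV_hom" "Idm deV = deV_id"
  "Cmp deV V1 V2 V3 k h = deV_comp V1 V3 k h"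
  by (simp_all add: deV_def)

lemma category_deV: "category deV"
  unfolding category_def
proof (intro conjI ballI)
  fix V :: "'a dv_struct" assume "V \<in> Obj deV"
  then show "Idm deV V \<in> Hom deV V V"
    by (simp add: deVries_algebra.deV_id_hom)
next
  fix V1 V2 V3 :: "'a dv_struct" and h k
  assume "V1 \<in> Obj deV" "V2 \<in> Obj deV" "V3 \<in> Obj deV" "h \<in> Hom deV V1 V2" "k \<in> Hom deV V2 V3"
  then show "Cmp deV V1 V2 V3 k h \<in> Hom deV V1 V3"
    by (simp add: deVries_composable.comp_hom[OF deVries_composableI])
next
  fix V W :: "'a dv_struct" and h
  assume *: "V \<in> Obj deV" "W \<in> Obj deV" "h \<in> Hom deV V W"
  then show "Cmp deV V V W h (Idm deV V) = h"
    by (simp add: deVries_morphism.comp_id_right[OF deVries_morphismI])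
  show "Cmp deV V W W (Idm deV W) h = h"
    using * by (simp add: deVries_morphism.comp_id_left[OF deVries_morphismI])
next
  fix V1 V2 V3 V4 :: "'a dv_struct" and h k l
  assume "V1 \<in> Obj deV" "V2 \<in> Obj deV" "V3 \<in> Obj deV" "V4 \<in> Obj deV"
    "h \<in> Hom deV V1 V2" "k \<in> Hom deV V2 V3" "l \<in> Hom deV V3 V4"
  then show "Cmp deV V1 V2 V4 (Cmp deV V2 V3 V4 l k) h = Cmp deV V1 V3 V4 l (Cmp deV V1 V2 V3 k h)"
    using deV_comp_assoc[OF deVries_morphismI deVries_morphismI deVries_morphismI] by simp
qed

section \<open>dV-maps and their duals\<close>

lemma dVS_simps [simp]:
  "Obj dVS = {X. dV_space X}" "Hom dVS = dVS_hom" "Idm dVS = dVS_id"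
  "Cmp dVS X Y Z g f = dVS_comp X g f"
  by (simp_all add: dVS_def)

lemma dVS_homD:
  assumes "f \<in> dVS_hom X Y"
  shows "f \<in> topspace X \<rightarrow>\<^sub>E topspace Y" "continuous_map X Y f"
    and "\<And>x y. \<lbrakk>x \<in> topspace X; spec_le Y (f x) y\<rbrakk> \<Longrightarrow> \<exists>x'. spec_le X x x' \<and> spec_le Y y (f x')"
proof -
  show "f \<in> topspace X \<rightarrow>\<^sub>E topspace Y" "continuous_map X Y f"
    using assms by (simp_all add: dVS_hom_def)
  fix x y assume x: "x \<in> topspace X" and y: "spec_le Y (f x) y"
  then have "y \<in> topspace Y"
    by (simp add: spec_le_def)
  then show "\<exists>x'. spec_le X x x' \<and> spec_le Y y (f x')"
    using assms x y unfolding dVS_hom_def by blast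
qed

lemma dVS_id_hom: "dVS_id X \<in> dVS_hom X X"
proof -
  have "continuous_map X X (dVS_id X)"
    unfolding dVS_id_def by (rule continuous_map_eq[OF continuous_map_id]) simp
  then show ?thesis
    unfolding dVS_hom_def by (auto simp: dVS_id_def intro: spec_le_refl)
qed

lemma dVS_comp_hom:
  assumes f: "f \<in> dVS_hom X Y" and g: "g \<in> dVS_hom Y Z"
  shows "dVS_comp X g f \<in> dVS_hom X Z"
proof -
  have eq: "dVS_comp X g f x = g (f x)" if "x \<in> topspace X" for x
    using that by (simp add: dVS_comp_def compose_def)
  have "continuous_map X Z (dVS_comp X g f)"
    using continuous_map_compose[OF dVS_homD(2)[OF f] dVS_homD(2)[OF g]]
    by (rule continuous_map_eq) (simp add: eq)
  moreover have "dVS_comp X g f \<in> topspace X \<rightarrow>\<^sub>E topspace Z"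
    using dVS_homD(1)[OF f] dVS_homD(1)[OF g] by (auto simp: dVS_comp_def compose_def)
  moreover have "\<exists>x'\<in>topspace X. spec_le X x x' \<and> spec_le Z z (dVS_comp X g f x')"
    if x: "x \<in> topspace X" and z: "spec_le Z (dVS_comp X g f x) z" for x z
  proof -
    have "f x \<in> topspace Y"
      using dVS_homD(1)[OF f] x by blast
    \<comment> \<open>Weak density is used for \<open>g\<close> at \<open>f x\<close> and then for
      \<open>f\<close> at \<open>x\<close>; monotonicity of the continuous map \<open>g\<close>
      links the two.\<close>
    then obtain y where y: "spec_le Y (f x) y" "spec_le Z z (g y)"
      using dVS_homD(3)[OF g] z x eq by metis
    then obtain x' where x': "spec_le X x x'" "spec_le Y y (f x')"
      using dVS_homD(3)[OF f x] by blast
    then have "spec_le Z z (g (f x'))" "x' \<in> topspace X"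
      using spec_le_trans[OF y(2)] spec_le_continuous[OF dVS_homD(2)[OF g] x'(2)]
      by (auto simp: spec_le_def[of X])
    then show ?thesis
      using x'(1) eq by auto
  qed
  ultimately show ?thesis
    unfolding dVS_hom_def by blast
qed

lemma category_dVS: "category dVS"
  unfolding category_def
proof (intro conjI ballI)
  fix X :: "'a topology"
  show "Idm dVS X \<in> Hom dVS X X"
    by (simp add: dVS_id_hom)
next
  fix X Y Z :: "'a topology" and f g
  assume "f \<in> Hom dVS X Y" "g \<in> Hom dVS Y Z"
  then show "Cmp dVS X Y Z g f \<in> Hom dVS X Z"
    by (simp add: dVS_comp_hom)
next
  fix X Y :: "'a topology" and f
  assume "f \<in> Hom dVS X Y"
  then have f: "f \<in> topspace X \<rightarrow>\<^sub>E topspace Y"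
    using dVS_homD(1) by simp
  show "Cmp dVS X X Y f (Idm dVS X) = f"
    using f by (auto simp: dVS_comp_def dVS_id_def compose_def fun_eq_iff)
  show "Cmp dVS X Y Y (Idm dVS Y) f = f"
    using f by (auto simp: dVS_comp_def dVS_id_def compose_def fun_eq_iff)
next
  fix W X Y Z :: "'a topology" and f g h
  assume "f \<in> Hom dVS W X"
  then have "f \<in> topspace W \<rightarrow> topspace X"
    using dVS_homD(1) by auto
  then show "Cmp dVS W X Z (Cmp dVS X Y Z h g) f = Cmp dVS W Y Z h (Cmp dVS W X Y g f)"
    by (auto simp: dVS_comp_def compose_def fun_eq_iff)
qed

locale dV_map =
  fixes X :: "'x topology" and Y :: "'y topology" and f :: "'x \<Rightarrow> 'y"
  assumes X: "dV_space X" and Y: "dV_space Y" and f: "f \<in> dVS_hom X Y"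
begin

definition pre :: "'y set \<Rightarrow> 'x set" where
  "pre U = {x \<in> topspace X. f x \<in> U}"

lemma map_closed: "x \<in> topspace X \<Longrightarrow> f x \<in> topspace Y"
  using dVS_homD(1)[OF f] by blast

lemma openin_pre: "openin Y U \<Longrightarrow> openin X (pre U)"
  unfolding pre_def by (rule openin_continuous_map_preimage[OF dVS_homD(2)[OF f]])

lemma closedin_pre: "closedin Y A \<Longrightarrow> closedin X (pre A)"
  unfolding pre_def by (rule closedin_continuous_map_preimage[OF dVS_homD(2)[OF f]])

lemma pre_mono: "U \<subseteq> W \<Longrightarrow> pre U \<subseteq> pre W"
  unfolding pre_def by blast

text \<open>Weak density replaces a point \<open>y \<in> U\<close> above \<open>f x\<close> by a
  value \<open>f x'\<close> above \<open>y\<close>, and the open set \<open>U\<close> is closed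
  upwards.\<close>

lemma pre_down_subset: "U \<in> reg_open Y \<Longrightarrow> pre (down Y U) \<subseteq> down X (pre U)"
proof
  fix x assume U: "U \<in> reg_open Y" and "x \<in> pre (down Y U)"
  then obtain y where y: "x \<in> topspace X" "y \<in> U" "spec_le Y (f x) y"
    unfolding pre_def down_def by blast
  then obtain x' where x': "spec_le X x x'" "spec_le Y y (f x')"
    using dVS_homD(3)[OF f y(1,3)] by blast
  then have "f x' \<in> U"
    using spec_leD[OF _ reg_openD(2)[OF U] y(2)] by blast
  then show "x \<in> down X (pre U)"
    using x' y unfolding down_def pre_def by (auto simp: spec_le_def[of X])
qed

text \<open>Weak density turns the interior of \<open>f\<^sup>-\<^sup>1(\<down>U)\<close> into a subset of \<open>f\<^sup>-\<^sup>1(U)\<close>; this is what makes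
  the double complement in \<^const>\<open>Phi_map\<close> harmless up to \<^const>\<open>well_inside\<close>.\<close>

lemma perp_perp_pre_subset:
  assumes W: "W \<in> reg_open Y" and U: "U \<in> reg_open Y" and WU: "well_inside Y W U"
  shows "perp X (perp X (pre W)) \<subseteq> pre U"
proof
  fix z assume z: "z \<in> perp X (perp X (pre W))"
  have "X closure_of (pre W) \<subseteq> pre (Y closure_of W)"
    using pre_mono[OF closure_of_subset[OF reg_openD(3)[OF W]]]
    by (intro closure_of_minimal closedin_pre) simp_all
  moreover have "perp X (perp X (pre W)) \<subseteq> X closure_of (pre W)"
    using subset_perp_iff[OF openin_perp, of X "perp X (pre W)" "perp X (pre W)"]
      perp_disjoint[OF openin_perp, of X "pre W"] perp_subset[of X "perp X (pre W)"]
    unfolding perp_def[of X "pre W"] by blast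
  ultimately have sub: "perp X (perp X (pre W)) \<subseteq> pre (down Y U)"
    using WU pre_mono[of "Y closure_of W" "down Y U"] unfolding well_inside_def by blast
  have zX: "z \<in> topspace X"
    using subsetD[OF perp_subset z] .
  \<comment> \<open>So far \<open>f\<close> maps the regularized set only into
    \<open>down Y U\<close>. The regularized set is open, so it contains all points above
    \<open>z\<close>; weak density dominates every point above \<open>f z\<close> by the image of
    one of them, and order-regularity of \<open>U\<close> applies.\<close>
  have "f z \<in> U"
  proof (rule dV_order_regular[OF Y U])
    show "f z \<in> topspace Y"
      using map_closed zX .
    fix y assume y: "spec_le Y (f z) y"
    obtain z' where z': "spec_le X z z'" "spec_le Y y (f z')"
      using dVS_homD(3)[OF f zX y] by blast
    then have "z' \<in> perp X (perp X (pre W))"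
      using spec_leD[OF _ openin_perp z] by blast
    then have "f z' \<in> down Y U"
      using sub unfolding pre_def by blast
    then show "y \<in> down Y U"
      using z'(2) spec_le_trans[OF z'(2)] unfolding down_def by (auto simp: spec_le_def[of Y y "f z'"])
  qed
  then show "z \<in> pre U"
    using zX by (simp add: pre_def)
qed

lemma Phi_map_eq: "U \<in> reg_open Y \<Longrightarrow> Phi_map X Y f U = perp X (perp X (pre U))"
  by (simp add: Phi_map_def pre_def)

lemma pre_subset_Phi_map: "U \<in> reg_open Y \<Longrightarrow> pre U \<subseteq> Phi_map X Y f U"
  by (simp add: Phi_map_eq subset_perp_perp openin_pre reg_openD)

lemma pre_eq_Union:
  assumes U: "U \<in> reg_open Y"
  shows "pre U = (\<Union>W\<in>{W \<in> reg_open Y. well_inside Y W U}. pre W)"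
  using dV_well_inside_basis[OF Y U] well_inside_subset[OF Y _ U] unfolding pre_def by blast

lemma Phi_map_hom: "Phi_map X Y f \<in> deV_hom (RO_struct Y) (RO_struct X)"
proof -
  have 1: "Phi_map X Y f \<in> reg_open Y \<rightarrow>\<^sub>E reg_open X"
    by (auto simp: Phi_map_def perp_perp_reg_open)
  have 2: "Phi_map X Y f {} = {}"
    by (simp add: Phi_map_eq empty_reg_open pre_def perp_empty perp_topspace)
  have 3: "Phi_map X Y f (U \<inter> W) = Phi_map X Y f U \<inter> Phi_map X Y f W"
    if "U \<in> reg_open Y" "W \<in> reg_open Y" for U W
  proof -
    have "pre (U \<inter> W) = pre U \<inter> pre W"
      unfolding pre_def by blast
    then show ?thesis
      using that by (simp add: Phi_map_eq Int_reg_open perp_perp_Int openin_pre reg_openD)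
  qed
  \<comment> \<open>(V3): the complements collapse to \<open>perp X (pre (perp Y U))\<close>, which
    lies in the closed set \<open>pre (Y closure_of U)\<close>; weak density, through
    \<open>pre_down_subset\<close>, then leads to \<open>down X (pre W)\<close>.\<close>
  have 4: "well_inside X (perp X (Phi_map X Y f (perp Y U))) (Phi_map X Y f W)"
    if U: "U \<in> reg_open Y" and W: "W \<in> reg_open Y" and UW: "well_inside Y U W" for U W
  proof -
    have "pre (Y closure_of U) = topspace X - pre (perp Y U)"
      unfolding pre_def perp_def using map_closed by blast
    moreover have "perp X (Phi_map X Y f (perp Y U)) = perp X (pre (perp Y U))"
      using U by (simp add: Phi_map_eq perp_reg_open reg_openD perp_perp_perp openin_pre openin_perp)
    moreover have "perp X (pre (perp Y U)) \<subseteq> topspace X - pre (perp Y U)"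
      using perp_disjoint[OF openin_pre[OF openin_perp], of U] perp_subset[of X "pre (perp Y U)"] by blast
    ultimately have "X closure_of perp X (Phi_map X Y f (perp Y U)) \<subseteq> pre (Y closure_of U)"
      by (intro closure_of_minimal closedin_pre) simp_all
    also have "\<dots> \<subseteq> pre (down Y W)"
      using UW by (intro pre_mono) (simp add: well_inside_def)
    also have "\<dots> \<subseteq> down X (pre W)"
      by (rule pre_down_subset[OF W])
    also have "\<dots> \<subseteq> down X (Phi_map X Y f W)"
      by (rule down_mono[OF pre_subset_Phi_map[OF W]])
    finally show ?thesis
      unfolding well_inside_def .
  qed
  \<comment> \<open>(V4): \<open>pre U\<close> is already the union of the sets \<open>pre W\<close>
    with \<open>W\<close> well inside \<open>U\<close>, and regularizing these one by one stays
    inside the regularization of \<open>pre U\<close>.\<close>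
  have 5: "Phi_map X Y f U = perp X (perp X (\<Union>{Phi_map X Y f W | W. W \<in> reg_open Y \<and> well_inside Y W U}))"
    if U: "U \<in> reg_open Y" for U
  proof
    have "pre U \<subseteq> \<Union>{Phi_map X Y f W | W. W \<in> reg_open Y \<and> well_inside Y W U}"
      using pre_eq_Union[OF U] pre_subset_Phi_map by blast
    then show "Phi_map X Y f U \<subseteq> perp X (perp X (\<Union>{Phi_map X Y f W | W. W \<in> reg_open Y \<and> well_inside Y W U}))"
      using U by (simp add: Phi_map_eq perp_perp_mono)
    have "Phi_map X Y f W \<subseteq> Phi_map X Y f U" if "W \<in> reg_open Y" "well_inside Y W U" for W
      using that U well_inside_subset[OF Y] by (simp add: Phi_map_eq perp_perp_mono pre_mono)
    then have "\<Union>{Phi_map X Y f W | W. W \<in> reg_open Y \<and> well_inside Y W U} \<subseteq> Phi_map X Y f U"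
      by blast
    then show "perp X (perp X (\<Union>{Phi_map X Y f W | W. W \<in> reg_open Y \<and> well_inside Y W U})) \<subseteq> Phi_map X Y f U"
      using U by (intro perp_perp_least) (simp_all add: Phi_map_eq perp_perp_reg_open)
  qed
  have mem: "Phi_map X Y f U \<in> reg_open X" if "U \<in> reg_open Y" for U
    using 1 that by blast
  have sub: "{Phi_map X Y f W | W. W \<in> reg_open Y \<and> well_inside Y W U} \<subseteq> reg_open X" for U
    using mem by blast
  show ?thesis
    unfolding deV_hom_def
  proof (intro CollectI conjI ballI impI)
    show "Phi_map X Y f \<in> carrier (RO_struct Y) \<rightarrow>\<^sub>E carrier (RO_struct X)"
      using 1 by simp
    show "Phi_map X Y f \<bottom>\<^bsub>RO_struct Y\<^esub> = \<bottom>\<^bsub>RO_struct X\<^esub>"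
      by (simp add: bottom_RO_struct 2)
  next
    fix U W assume "U \<in> carrier (RO_struct Y)" "W \<in> carrier (RO_struct Y)"
    then show "Phi_map X Y f (U \<sqinter>\<^bsub>RO_struct Y\<^esub> W) = Phi_map X Y f U \<sqinter>\<^bsub>RO_struct X\<^esub> Phi_map X Y f W"
      by (simp add: meet_RO_struct 3 mem)
  next
    fix U W assume "U \<in> carrier (RO_struct Y)" "W \<in> carrier (RO_struct Y)" "U \<prec>\<^bsub>RO_struct Y\<^esub> W"
    then show "compl (RO_struct X) (Phi_map X Y f (compl (RO_struct Y) U)) \<prec>\<^bsub>RO_struct X\<^esub> Phi_map X Y f W"
      by (simp add: compl_RO_struct mem perp_reg_open reg_openD 4)
  next
    fix U assume "U \<in> carrier (RO_struct Y)"
    then show "Phi_map X Y f U = \<Squnion>\<^bsub>RO_struct X\<^esub> {Phi_map X Y f W | W. W \<in> carrier (RO_struct Y) \<and> W \<prec>\<^bsub>RO_struct Y\<^esub> U}"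
      using 5 by (simp add: sup_RO_struct[OF sub])
  qed
qed

end

section \<open>Functoriality of \<open>Phi\<close>\<close>

lemma Phi_map_id:
  assumes "dV_space X"
  shows "Phi_map X X (dVS_id X) = deV_id (RO_struct X)"
proof
  fix U
  show "Phi_map X X (dVS_id X) U = deV_id (RO_struct X) U"
  proof (cases "U \<in> reg_open X")
    case True
    then have "{x \<in> topspace X. dVS_id X x \<in> U} = U"
      using reg_openD(3) by (auto simp: dVS_id_def)
    then show ?thesis
      using True by (simp add: Phi_map_def deV_id_def reg_openD)
  qed (simp add: Phi_map_def deV_id_def)
qed

text \<open>Regularizing \<open>g.pre U\<close> before pulling back along \<open>f\<close> can only
  enlarge the result. The join over \<open>W\<close> well inside \<open>U\<close> cancels this: by
  \<open>perp_perp_pre_subset\<close> the regularized \<open>g.pre W\<close> lies within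
  \<open>g.pre U\<close>, and the sets \<open>gf.pre W\<close> still exhaust
  \<open>gf.pre U\<close>.\<close>

lemma Phi_map_comp:
  assumes X: "dV_space X" and Y: "dV_space Y" and Z: "dV_space Z"
    and f: "f \<in> dVS_hom X Y" and g: "g \<in> dVS_hom Y Z"
  shows "Phi_map X Z (dVS_comp X g f)
    = deV_comp (RO_struct Z) (RO_struct X) (Phi_map X Y f) (Phi_map Y Z g)"
proof
  interpret f: dV_map X Y f using X Y f by unfold_locales
  interpret g: dV_map Y Z g using Y Z g by unfold_locales
  interpret gf: dV_map X Z "dVS_comp X g f" using X Z dVS_comp_hom[OF f g] by unfold_locales
  have pre: "gf.pre U = f.pre (g.pre U)" for U
    unfolding gf.pre_def f.pre_def g.pre_def
    using f.map_closed by (auto simp: dVS_comp_def compose_def)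
  have mem: "Phi_map Y Z g W \<in> reg_open Y" if "W \<in> reg_open Z" for W
    using that by (simp add: g.Phi_map_eq perp_perp_reg_open)
  fix U
  show "Phi_map X Z (dVS_comp X g f) U
    = deV_comp (RO_struct Z) (RO_struct X) (Phi_map X Y f) (Phi_map Y Z g) U"
  proof (cases "U \<in> reg_open Z")
    case False
    then show ?thesis by (simp add: Phi_map_def deV_comp_def)
  next
    case U: True
    let ?S = "{Phi_map X Y f (Phi_map Y Z g W) | W. W \<in> reg_open Z \<and> well_inside Z W U}"
    have "?S \<subseteq> reg_open X"
      using mem by (auto simp: f.Phi_map_eq perp_perp_reg_open)
    then have "deV_comp (RO_struct Z) (RO_struct X) (Phi_map X Y f) (Phi_map Y Z g) U
      = perp X (perp X (\<Union>?S))"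
      using U by (simp add: deV_comp_def sup_RO_struct)
    moreover have "Phi_map X Z (dVS_comp X g f) U = perp X (perp X (\<Union>?S))"
    proof
      have "gf.pre U \<subseteq> \<Union>?S"
      proof
        fix x assume "x \<in> gf.pre U"
        then obtain W where W: "W \<in> reg_open Z" "well_inside Z W U" "x \<in> f.pre (g.pre W)"
          using gf.pre_eq_Union[OF U] pre by blast
        then have "x \<in> Phi_map X Y f (Phi_map Y Z g W)"
          using f.pre_subset_Phi_map[OF mem] f.pre_mono[OF g.pre_subset_Phi_map] by blast
        then show "x \<in> \<Union>?S"
          using W by blast
      qed
      then show "Phi_map X Z (dVS_comp X g f) U \<subseteq> perp X (perp X (\<Union>?S))"
        using U by (simp add: gf.Phi_map_eq perp_perp_mono)
      have "Phi_map X Y f (Phi_map Y Z g W) \<subseteq> Phi_map X Z (dVS_comp X g f) U"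
        if W: "W \<in> reg_open Z" "well_inside Z W U" for W
      proof -
        have "Phi_map Y Z g W \<subseteq> g.pre U"
          using g.perp_perp_pre_subset[OF W(1) U W(2)] W(1) by (simp add: g.Phi_map_eq)
        then show ?thesis
          using W U mem by (simp add: f.Phi_map_eq gf.Phi_map_eq pre perp_perp_mono f.pre_mono)
      qed
      then show "perp X (perp X (\<Union>?S)) \<subseteq> Phi_map X Z (dVS_comp X g f) U"
        using U by (intro perp_perp_least) (auto simp: gf.Phi_map_eq perp_perp_reg_open)
    qed
    ultimately show ?thesis by simp
  qed
qed

lemma contravariant_functor_Phi: "contravariant_functor dVS deV Phi Phi_map"
  unfolding contravariant_functor_def
  by (intro conjI ballI)
    (simp_all add: category_dVS category_deV Phi_def deVries_algebra_RO_struct Phi_map_id Phi_map_comp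
      dV_map.Phi_map_hom[OF dV_map.intro])

section \<open>Functoriality of \<open>Lambda\<close>\<close>

lemma Lambda_map_id:
  assumes "deVries_algebra V"
  shows "Lambda_map V V (deV_id V) = dVS_id (Lambda V)"
proof
  interpret deVries_algebra V by (rule assms)
  fix F
  show "Lambda_map V V (deV_id V) F = dVS_id (Lambda V) F"
  proof (cases "F \<in> conc_filters V")
    case True
    then have "Lambda_map V V (deV_id V) F = round_part V F"
      using filter_carrier[OF True] by (auto simp: Lambda_map_def deV_id_def round_part_def)
    then show ?thesis
      using True by (simp add: dVS_id_def round_part_eq)
  qed (simp add: Lambda_map_def dVS_id_def)
qed

text \<open>The composite at \<open>b\<close> lies below \<open>k (h b)\<close>, which lies below
  the composite at any \<open>c\<close> with \<open>b \<prec> c\<close>. Membership in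
  \<open>Lambda_map\<close> asks only for some witness \<open>\<prec>\<close>-below
  \<open>a\<close>, so an interpolant \<open>c\<close> between \<open>b\<close> and \<open>a\<close>
  covers the difference in both directions.\<close>

lemma Lambda_map_comp:
  assumes h: "deVries_morphism V\<^sub>1 V\<^sub>2 h" and k: "deVries_morphism V\<^sub>2 V\<^sub>3 k"
  shows "Lambda_map V\<^sub>1 V\<^sub>3 (deV_comp V\<^sub>1 V\<^sub>3 k h)
    = dVS_comp (Lambda V\<^sub>3) (Lambda_map V\<^sub>1 V\<^sub>2 h) (Lambda_map V\<^sub>2 V\<^sub>3 k)"
proof
  interpret deVries_composable V\<^sub>1 V\<^sub>2 V\<^sub>3 h k
    using h k by (simp add: deVries_composable_def)
  interpret kh: deVries_morphism V\<^sub>1 V\<^sub>3 "deV_comp V\<^sub>1 V\<^sub>3 k h"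
    by (rule comp_morphism)
  fix F
  show "Lambda_map V\<^sub>1 V\<^sub>3 (deV_comp V\<^sub>1 V\<^sub>3 k h) F
    = dVS_comp (Lambda V\<^sub>3) (Lambda_map V\<^sub>1 V\<^sub>2 h) (Lambda_map V\<^sub>2 V\<^sub>3 k) F"
  proof (cases "F \<in> conc_filters V\<^sub>3")
    case F: True
    note kF = k.Lambda_map_closed[OF F]
    have "a \<in> Lambda_map V\<^sub>1 V\<^sub>3 (deV_comp V\<^sub>1 V\<^sub>3 k h) F \<longleftrightarrow> a \<in> Lambda_map V\<^sub>1 V\<^sub>2 h (Lambda_map V\<^sub>2 V\<^sub>3 k F)"
      if a: "a \<in> carrier V\<^sub>1" for a
    proof
      assume "a \<in> Lambda_map V\<^sub>1 V\<^sub>3 (deV_comp V\<^sub>1 V\<^sub>3 k h) F"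
      then obtain b where b: "b \<in> carrier V\<^sub>1" "deV_comp V\<^sub>1 V\<^sub>3 k h b \<in> F" "b \<prec>\<^bsub>V\<^sub>1\<^esub> a"
        using kh.Lambda_map_mem_iff[OF F a] by blast
      obtain c where c: "c \<in> carrier V\<^sub>1" "b \<prec>\<^bsub>V\<^sub>1\<^esub> c" "c \<prec>\<^bsub>V\<^sub>1\<^esub> a"
        using h.V.A6[OF b(1) a b(3)] by blast
      have "k (h b) \<in> F"
        using k.W.filter_up[OF F b(2)] comp_le[OF b(1)] b h.hom_closed k.hom_closed by simp
      then have "h c \<in> Lambda_map V\<^sub>2 V\<^sub>3 k F"
        using k.Lambda_map_mem_iff[OF F, of "h c"] h.hom_prec[OF b(1) c(1,2)] b c h.hom_closed by blast
      then show "a \<in> Lambda_map V\<^sub>1 V\<^sub>2 h (Lambda_map V\<^sub>2 V\<^sub>3 k F)"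
        using h.Lambda_map_mem_iff[OF kF a] c by blast
    next
      assume "a \<in> Lambda_map V\<^sub>1 V\<^sub>2 h (Lambda_map V\<^sub>2 V\<^sub>3 k F)"
      then obtain b where b: "b \<in> carrier V\<^sub>1" "h b \<in> Lambda_map V\<^sub>2 V\<^sub>3 k F" "b \<prec>\<^bsub>V\<^sub>1\<^esub> a"
        using h.Lambda_map_mem_iff[OF kF a] by blast
      obtain c where c: "c \<in> carrier V\<^sub>1" "b \<prec>\<^bsub>V\<^sub>1\<^esub> c" "c \<prec>\<^bsub>V\<^sub>1\<^esub> a"
        using h.V.A6[OF b(1) a b(3)] by blast
      have "k (h b) \<in> F"
        using b F unfolding Lambda_map_def by simp
      then have "deV_comp V\<^sub>1 V\<^sub>3 k h c \<in> F"
        using k.W.filter_up[OF F] comp_ge[OF c(1) b(1) c(2)] comp_closed[OF c(1)] by blast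
      then show "a \<in> Lambda_map V\<^sub>1 V\<^sub>3 (deV_comp V\<^sub>1 V\<^sub>3 k h) F"
        using kh.Lambda_map_mem_iff[OF F a] c by blast
    qed
    moreover have "Lambda_map V\<^sub>1 V\<^sub>3 (deV_comp V\<^sub>1 V\<^sub>3 k h) F \<subseteq> carrier V\<^sub>1"
      "Lambda_map V\<^sub>1 V\<^sub>2 h (Lambda_map V\<^sub>2 V\<^sub>3 k F) \<subseteq> carrier V\<^sub>1"
      using F kF by (auto simp: Lambda_map_def[of V\<^sub>1])
    ultimately show ?thesis
      using F by (auto simp: dVS_comp_def compose_def)
  qed (simp add: Lambda_map_def dVS_comp_def compose_def)
qed

lemma contravariant_functor_Lambda: "contravariant_functor deV dVS Lambda Lambda_map"
  unfolding contravariant_functor_def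
  by (intro conjI ballI)
    (simp_all add: category_dVS category_deV deVries_algebra.dV_space_Lambda Lambda_map_id
      Lambda_map_comp deVries_morphismI deVries_morphism.Lambda_map_hom)

section \<open>The natural isomorphisms\<close>

text \<open>The inverse supplies the witness for weak density: if \<open>y\<close> lies above
  \<open>f x\<close>, then \<open>g y\<close> lies above \<open>x\<close> by continuity of
  \<open>g\<close>, and it is mapped to \<open>y\<close> itself.\<close>

lemma homeomorphic_maps_imp_dVS_hom:
  assumes "homeomorphic_maps X Y f g" and f: "f \<in> topspace X \<rightarrow>\<^sub>E topspace Y"
  shows "f \<in> dVS_hom X Y"
proof -
  have fg: "continuous_map X Y f" "continuous_map Y X g"
    "\<And>x. x \<in> topspace X \<Longrightarrow> g (f x) = x" "\<And>y. y \<in> topspace Y \<Longrightarrow> f (g y) = y"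
    using assms(1) by (simp_all add: homeomorphic_maps_def)
  have "\<exists>x'\<in>topspace X. spec_le X x x' \<and> spec_le Y y (f x')"
    if x: "x \<in> topspace X" and y: "y \<in> topspace Y" "spec_le Y (f x) y" for x y
  proof (rule bexI[of _ "g y"])
    show "spec_le X x (g y) \<and> spec_le Y y (f (g y))"
      using spec_le_continuous[OF fg(2) y(2)] x y fg(3,4) by (simp add: spec_le_refl)
    show "g y \<in> topspace X"
      using continuous_map_image_subset_topspace[OF fg(2)] y(1) by blast
  qed
  then show ?thesis
    unfolding dVS_hom_def using f fg(1) by blast
qed

lemma homeomorphic_map_imp_dVS_iso:
  assumes "homeomorphic_map X Y f" and f: "f \<in> topspace X \<rightarrow>\<^sub>E topspace Y"
  shows "dVS_iso X Y f"
proof -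
  obtain g where g: "homeomorphic_maps X Y f g"
    using assms(1) unfolding homeomorphic_map_maps by blast
  \<comment> \<open>Morphisms are extensional, so the inverse has to be cut down to
    \<open>topspace Y\<close>.\<close>
  let ?g = "restrict g (topspace Y)"
  have g': "homeomorphic_maps X Y f ?g"
    using g by (rule homeomorphic_maps_eq) simp_all
  have maps: "g y \<in> topspace X" if "y \<in> topspace Y" for y
    using g that continuous_map_image_subset_topspace[of Y X g] by (auto simp: homeomorphic_maps_def)
  then have "?g \<in> topspace Y \<rightarrow>\<^sub>E topspace X"
    by auto
  then have "?g \<in> dVS_hom Y X"
    using g' homeomorphic_maps_imp_dVS_hom homeomorphic_maps_sym by blast
  moreover have "f \<in> dVS_hom X Y"
    using g f homeomorphic_maps_imp_dVS_hom by blast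
  moreover have "dVS_comp X ?g f = dVS_id X" "dVS_comp Y f ?g = dVS_id Y"
    using g f maps by (auto simp: homeomorphic_maps_def dVS_comp_def dVS_id_def compose_def fun_eq_iff)
  ultimately show ?thesis
    unfolding dVS_iso_def by blast
qed

definition eta :: "'x topology \<Rightarrow> 'x \<Rightarrow> 'x set set" where
  "eta X = (\<lambda>x\<in>topspace X. reg_open_at X x)"

lemma eta_homeomorphic_map:
  assumes X: "dV_space X"
  shows "homeomorphic_map X (Lambda (RO_struct X)) (eta X)"
proof (rule bijective_open_imp_homeomorphic_map)
  interpret deVries_algebra "RO_struct X"
    by (rule deVries_algebra_RO_struct[OF X])
  have eta: "eta X x = reg_open_at X x" "eta X x \<in> conc_filters (RO_struct X)" if "x \<in> topspace X" for x
    using that reg_open_at_concordant[OF X] by (simp_all add: eta_def)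
  have eta_hat: "eta X x \<in> hat (RO_struct X) U \<longleftrightarrow> x \<in> U" if "x \<in> topspace X" "U \<in> reg_open X" for x U
    using that eta[of x] by (simp add: hat_def reg_open_at_def)
  show surj: "eta X ` topspace X = topspace (Lambda (RO_struct X))"
  proof (intro equalityI subsetI)
    fix F assume "F \<in> topspace (Lambda (RO_struct X))"
    then have F: "F \<in> conc_filters (RO_struct X)"
      by simp
    obtain x where "x \<in> topspace X" "round_part (RO_struct X) F = reg_open_at X x"
      using dV_round_part[OF X conc_filtersD(1)[OF F]] by blast
    then show "F \<in> eta X ` topspace X"
      using eta(1)[of x] round_part_eq[OF F] by auto
  qed (use eta in auto)
  show "inj_on (eta X) (topspace X)"
  proof (rule inj_onI, rule ccontr)
    fix x y assume xy: "x \<in> topspace X" "y \<in> topspace X" "eta X x = eta X y" "x \<noteq> y"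
    have "t0_space X"
      using X by (simp add: dV_space_def)
    then obtain U where U: "openin X U" "x \<in> U \<longleftrightarrow> y \<notin> U"
      using xy unfolding t0_space_def by blast
    have eq: "x \<in> W \<longleftrightarrow> y \<in> W" if "W \<in> reg_open X" for W
      using eta_hat[OF xy(1) that] eta_hat[OF xy(2) that] xy(3) by simp
    have "x \<in> U \<longleftrightarrow> y \<in> U"
      using dV_basis[OF X U(1)] eq by blast
    then show False
      using U(2) by blast
  qed
  show "continuous_map X (Lambda (RO_struct X)) (eta X)"
    unfolding Lambda_eq
  proof (rule continuous_on_generated_topo)
    fix A assume "A \<in> hat (RO_struct X) ` carrier (RO_struct X)"
    then obtain U where U: "U \<in> reg_open X" "A = hat (RO_struct X) U"
      by auto
    then have "eta X -` A \<inter> topspace X = U"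
      using eta_hat[OF _ U(1)] reg_openD(3)[OF U(1)] by blast
    then show "openin X (eta X -` A \<inter> topspace X)"
      using U by (simp add: reg_openD)
  next
    show "eta X ` topspace X \<subseteq> \<Union> (hat (RO_struct X) ` carrier (RO_struct X))"
      using surj unfolding Lambda_eq topology_generated_by_topspace by simp
  qed
  show "open_map X (Lambda (RO_struct X)) (eta X)"
    unfolding open_map_def
  proof (intro allI impI)
    fix U assume U: "openin X U"
    have "eta X ` U = (\<Union>W\<in>{W \<in> reg_open X. W \<subseteq> U}. hat (RO_struct X) W)"
    proof (intro equalityI subsetI)
      fix F assume "F \<in> eta X ` U"
      then obtain x where x: "x \<in> U" "F = eta X x"
        by blast
      then obtain W where "W \<in> reg_open X" "x \<in> W" "W \<subseteq> U"
        using dV_basis[OF X U] by blast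
      then show "F \<in> (\<Union>W\<in>{W \<in> reg_open X. W \<subseteq> U}. hat (RO_struct X) W)"
        using x eta_hat[of x W] openin_subset[OF U] by blast
    next
      fix F assume "F \<in> (\<Union>W\<in>{W \<in> reg_open X. W \<subseteq> U}. hat (RO_struct X) W)"
      then obtain W where W: "W \<in> reg_open X" "W \<subseteq> U" "F \<in> hat (RO_struct X) W"
        by blast
      then have "F \<in> eta X ` topspace X"
        unfolding surj using hat_subset[of W] by auto
      then obtain x where "x \<in> topspace X" "F = eta X x"
        by blast
      then show "F \<in> eta X ` U"
        using W eta_hat[of x W] by blast
    qed
    moreover have "openin (Lambda (RO_struct X)) (\<Union>W\<in>{W \<in> reg_open X. W \<subseteq> U}. hat (RO_struct X) W)"
      using openin_hat by (intro openin_Union) auto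
    ultimately show "openin (Lambda (RO_struct X)) (eta X ` U)"
      by simp
  qed
qed

text \<open>At a point \<open>x\<close> the square says that \<open>f x \<in> U\<close> iff
  \<open>x \<in> Phi_map X Y f W\<close> for some \<open>W\<close> well inside \<open>U\<close>.
  From right to left this is \<open>perp_perp_pre_subset\<close>; the other direction is
  \<open>pre_eq_Union\<close>.\<close>

lemma eta_natural:
  assumes X: "dV_space X" and Y: "dV_space Y" and f: "f \<in> dVS_hom X Y"
  shows "dVS_comp X (Lambda_map (RO_struct Y) (RO_struct X) (Phi_map X Y f)) (eta X) = dVS_comp X (eta Y) f"
proof
  interpret f: dV_map X Y f
    using X Y f by unfold_locales
  interpret h: deVries_morphism "RO_struct Y" "RO_struct X" "Phi_map X Y f"
    using deVries_algebra_RO_struct[OF X] deVries_algebra_RO_struct[OF Y] f.Phi_map_hom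
    by (intro deVries_morphismI)
  fix x
  show "dVS_comp X (Lambda_map (RO_struct Y) (RO_struct X) (Phi_map X Y f)) (eta X) x = dVS_comp X (eta Y) f x"
  proof (cases "x \<in> topspace X")
    case x: True
    have conc: "reg_open_at X x \<in> conc_filters (RO_struct X)"
      by (rule reg_open_at_concordant[OF X x])
    have "U \<in> Lambda_map (RO_struct Y) (RO_struct X) (Phi_map X Y f) (reg_open_at X x) \<longleftrightarrow> f x \<in> U"
      if U: "U \<in> reg_open Y" for U
    proof -
      have "U \<in> Lambda_map (RO_struct Y) (RO_struct X) (Phi_map X Y f) (reg_open_at X x)
        \<longleftrightarrow> (\<exists>W\<in>reg_open Y. x \<in> Phi_map X Y f W \<and> well_inside Y W U)"
        using h.Lambda_map_mem_iff[OF conc, of U] U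
        by (auto simp: reg_open_at_def f.Phi_map_eq perp_perp_reg_open)
      also have "\<dots> \<longleftrightarrow> f x \<in> U"
      proof
        assume "\<exists>W\<in>reg_open Y. x \<in> Phi_map X Y f W \<and> well_inside Y W U"
        then show "f x \<in> U"
          using f.perp_perp_pre_subset[OF _ U] by (auto simp: f.Phi_map_eq f.pre_def)
      next
        assume "f x \<in> U"
        then have "x \<in> f.pre U"
          using x by (simp add: f.pre_def)
        then show "\<exists>W\<in>reg_open Y. x \<in> Phi_map X Y f W \<and> well_inside Y W U"
          using f.pre_eq_Union[OF U] f.pre_subset_Phi_map by blast
      qed
      finally show ?thesis .
    qed
    moreover have "Lambda_map (RO_struct Y) (RO_struct X) (Phi_map X Y f) (reg_open_at X x) \<subseteq> reg_open Y"
      using conc by (auto simp: Lambda_map_def)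
    ultimately show ?thesis
      using x f.map_closed by (auto simp: dVS_comp_def compose_def eta_def reg_open_at_def)
  qed (simp add: dVS_comp_def compose_def)
qed

section \<open>The isomorphism of an algebra with its double dual\<close>

definition eps :: "'a dv_struct \<Rightarrow> 'a \<Rightarrow> 'a set set" where
  "eps V = (\<lambda>a\<in>carrier V. hat V a)"

context deVries_algebra
begin

definition eps_inv :: "'a set set \<Rightarrow> 'a" where
  "eps_inv = (\<lambda>U\<in>reg_open (Lambda V). THE a. a \<in> carrier V \<and> hat V a = U)"

lemma eps_inv_hat: "a \<in> carrier V \<Longrightarrow> eps_inv (hat V a) = a"
  unfolding eps_inv_def reg_open_Lambda by (auto simp: hat_inject intro!: the_equality)

lemma sup_RO_struct_hat:
  "A \<subseteq> carrier V \<Longrightarrow> \<Squnion>\<^bsub>RO_struct (Lambda V)\<^esub>(hat V ` A) = hat V (\<Squnion>A)"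
  by (subst sup_RO_struct) (auto simp: reg_open_Lambda perp_perp_Union_hat)

lemma eps_hom: "eps V \<in> deV_hom V (RO_struct (Lambda V))"
  unfolding deV_hom_def
proof (intro CollectI conjI ballI impI)
  show "eps V \<in> carrier V \<rightarrow>\<^sub>E carrier (RO_struct (Lambda V))"
    by (auto simp: eps_def reg_open_Lambda)
  show "eps V \<bottom> = \<bottom>\<^bsub>RO_struct (Lambda V)\<^esub>"
    by (simp add: eps_def hat_bottom bottom_RO_struct)
next
  fix a b assume ab: "a \<in> carrier V" "b \<in> carrier V"
  then show "eps V (a \<sqinter> b) = eps V a \<sqinter>\<^bsub>RO_struct (Lambda V)\<^esub> eps V b"
    by (simp add: eps_def hat_meet meet_RO_struct reg_open_Lambda)
  assume "a \<prec> b"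
  then show "compl (RO_struct (Lambda V)) (eps V (compl V a)) \<prec>\<^bsub>RO_struct (Lambda V)\<^esub> eps V b"
    using ab by (simp add: eps_def compl_RO_struct reg_open_Lambda perp_hat well_inside_hat_iff)
next
  fix a assume a: "a \<in> carrier V"
  have "{eps V b | b. b \<in> carrier V \<and> b \<prec> a} = hat V ` {b. b \<in> carrier V \<and> b \<prec> a}"
    by (auto simp: eps_def)
  then show "eps V a = \<Squnion>\<^bsub>RO_struct (Lambda V)\<^esub> {eps V b | b. b \<in> carrier V \<and> b \<prec> a}"
    using a sup_RO_struct_hat[of "{b. b \<in> carrier V \<and> b \<prec> a}"] by (simp add: sup_prec eps_def)
qed

lemma eps_inv_image:
  assumes "a \<in> carrier V"
  shows "{eps_inv U | U. U \<in> reg_open (Lambda V) \<and> well_inside (Lambda V) U (hat V a)}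
    = {b. b \<in> carrier V \<and> b \<prec> a}"
proof (intro equalityI subsetI)
  fix b assume "b \<in> {b. b \<in> carrier V \<and> b \<prec> a}"
  then have "b = eps_inv (hat V b)" "hat V b \<in> reg_open (Lambda V)" "well_inside (Lambda V) (hat V b) (hat V a)"
    using assms by (simp_all add: eps_inv_hat reg_open_Lambda well_inside_hat_iff)
  then show "b \<in> {eps_inv U | U. U \<in> reg_open (Lambda V) \<and> well_inside (Lambda V) U (hat V a)}"
    by blast
qed (use assms in \<open>auto simp: reg_open_Lambda eps_inv_hat well_inside_hat_iff\<close>)

lemma eps_inv_hom: "eps_inv \<in> deV_hom (RO_struct (Lambda V)) V"
  unfolding deV_hom_def
proof (intro CollectI conjI ballI impI)
  have "eps_inv U \<in> carrier V" if "U \<in> reg_open (Lambda V)" for U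
    using that by (auto simp: reg_open_Lambda eps_inv_hat)
  then show "eps_inv \<in> carrier (RO_struct (Lambda V)) \<rightarrow>\<^sub>E carrier V"
    by (auto simp: eps_inv_def)
  show "eps_inv \<bottom>\<^bsub>RO_struct (Lambda V)\<^esub> = \<bottom>"
    using eps_inv_hat[of \<bottom>] by (simp add: hat_bottom bottom_RO_struct)
next
  fix U W assume "U \<in> carrier (RO_struct (Lambda V))" "W \<in> carrier (RO_struct (Lambda V))"
  then obtain a b where ab: "a \<in> carrier V" "U = hat V a" "b \<in> carrier V" "W = hat V b"
    by (auto simp: reg_open_Lambda)
  then show "eps_inv (U \<sqinter>\<^bsub>RO_struct (Lambda V)\<^esub> W) = eps_inv U \<sqinter> eps_inv W"
    by (simp add: meet_RO_struct reg_open_Lambda eps_inv_hat flip: hat_meet)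
  assume "U \<prec>\<^bsub>RO_struct (Lambda V)\<^esub> W"
  then show "compl V (eps_inv (compl (RO_struct (Lambda V)) U)) \<prec> eps_inv W"
    using ab by (simp add: compl_RO_struct reg_open_Lambda perp_hat eps_inv_hat well_inside_hat_iff)
next
  fix U assume "U \<in> carrier (RO_struct (Lambda V))"
  then obtain a where a: "a \<in> carrier V" "U = hat V a"
    by (auto simp: reg_open_Lambda)
  show "eps_inv U = \<Squnion>{eps_inv W | W. W \<in> carrier (RO_struct (Lambda V)) \<and> W \<prec>\<^bsub>RO_struct (Lambda V)\<^esub> U}"
    using eps_inv_image[OF a(1)] a by (simp add: eps_inv_hat sup_prec)
qed

text \<open>Composition is \<open>deV_comp\<close>, so mutually inverse functions are not
  automatically mutually inverse morphisms. The join over \<open>b \<prec> a\<close> returns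
  \<open>a\<close> by \<open>sup_prec\<close>, applied in \<open>V\<close> and in the algebra of
  regular open sets.\<close>

lemma deV_iso_eps: "deV_iso V (RO_struct (Lambda V)) (eps V)"
proof -
  interpret R: deVries_algebra "RO_struct (Lambda V)"
    by (rule deVries_algebra_RO_struct[OF dV_space_Lambda])
  have "deV_comp V V eps_inv (eps V) = deV_id V"
  proof
    fix a
    have "{eps_inv (eps V b) | b. b \<in> carrier V \<and> b \<prec> a} = {b. b \<in> carrier V \<and> b \<prec> a}"
      by (auto simp: eps_def eps_inv_hat)
    then show "deV_comp V V eps_inv (eps V) a = deV_id V a"
      by (simp add: deV_comp_def deV_id_def sup_prec)
  qed
  moreover have "deV_comp (RO_struct (Lambda V)) (RO_struct (Lambda V)) (eps V) eps_inv
    = deV_id (RO_struct (Lambda V))"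
  proof
    fix U
    have "eps V (eps_inv W) = W" if "W \<in> reg_open (Lambda V)" for W
      using that by (auto simp: reg_open_Lambda eps_def eps_inv_hat)
    then have "{eps V (eps_inv W) | W. W \<in> reg_open (Lambda V) \<and> well_inside (Lambda V) W U}
      = {W. W \<in> reg_open (Lambda V) \<and> well_inside (Lambda V) W U}"
      by force
    then show "deV_comp (RO_struct (Lambda V)) (RO_struct (Lambda V)) (eps V) eps_inv U
      = deV_id (RO_struct (Lambda V)) U"
      using R.sup_prec[of U] by (simp add: deV_comp_def deV_id_def)
  qed
  ultimately show ?thesis
    unfolding deV_iso_def using eps_hom eps_inv_hom by blast
qed

end

text \<open>The two plain composites already agree at every \<open>b\<close>, before the joins of
  \<open>deV_comp\<close> are formed: the preimage of \<open>hat V b\<close> is the union of the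
  sets \<open>hat W (h c)\<close> with \<open>c \<prec> b\<close>, its double complement is the hat
  of the join of these \<open>h c\<close>, and that join is \<open>h b\<close> by (V4).\<close>

lemma eps_natural:
  assumes "deVries_morphism V W h"
  shows "deV_comp V (RO_struct (Lambda W)) (Phi_map (Lambda W) (Lambda V) (Lambda_map V W h)) (eps V)
    = deV_comp V (RO_struct (Lambda W)) (eps W) h"
proof
  interpret deVries_morphism V W h by (rule assms)
  have "Phi_map (Lambda W) (Lambda V) (Lambda_map V W h) (eps V b) = eps W (h b)" if b: "b \<in> carrier V" for b
  proof -
    let ?A = "{h c | c. c \<in> carrier V \<and> c \<prec>\<^bsub>V\<^esub> b}"
    have A: "?A \<subseteq> carrier W"
      using hom_closed by blast
    have "{F \<in> topspace (Lambda W). Lambda_map V W h F \<in> hat V b} = (\<Union>a\<in>?A. hat W a)"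
      using Lambda_map_vimage_hat[OF b] by auto
    then have "Phi_map (Lambda W) (Lambda V) (Lambda_map V W h) (hat V b) = hat W (\<Squnion>\<^bsub>W\<^esub>?A)"
      using b A by (simp add: Phi_map_def V.reg_open_Lambda W.perp_perp_Union_hat)
    also have "\<Squnion>\<^bsub>W\<^esub>?A = h b"
      by (rule hom_sup[OF b, symmetric])
    finally show ?thesis
      using b hom_closed by (simp add: eps_def)
  qed
  then have "{Phi_map (Lambda W) (Lambda V) (Lambda_map V W h) (eps V b) | b. b \<in> carrier V \<and> b \<prec>\<^bsub>V\<^esub> a}
    = {eps W (h b) | b. b \<in> carrier V \<and> b \<prec>\<^bsub>V\<^esub> a}" for a
    by (intro Collect_cong) metis
  then show "deV_comp V (RO_struct (Lambda W)) (Phi_map (Lambda W) (Lambda V) (Lambda_map V W h)) (eps V) a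
    = deV_comp V (RO_struct (Lambda W)) (eps W) h a" for a
    by (simp add: deV_comp_def)
qed

theorem theorem5p4:
  shows "contravariant_functor
           (dVS :: ('x topology, 'x \<Rightarrow> 'x) cat)
           (deV :: ('x set dv_struct, 'x set \<Rightarrow> 'x set) cat)
           Phi Phi_map \<and>
     contravariant_functor
           (deV :: ('a dv_struct, 'a \<Rightarrow> 'a) cat)
           (dVS :: ('a set topology, 'a set \<Rightarrow> 'a set) cat)
           Lambda Lambda_map \<and>
     (\<exists>\<eta> :: 'x topology \<Rightarrow> 'x \<Rightarrow> 'x set set.
             dVS_natural_iso_from_id
               (\<lambda>X. Lambda (Phi X))
               (\<lambda>X Y f. Lambda_map (Phi Y) (Phi X) (Phi_map X Y f)) \<eta>) \<and>
     (\<exists>\<epsilon> :: 'a dv_struct \<Rightarrow> 'a \<Rightarrow> 'a set set.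
             deV_natural_iso_from_id
               (\<lambda>V. Phi (Lambda V))
               (\<lambda>V W h. Phi_map (Lambda W) (Lambda V) (Lambda_map V W h)) \<epsilon>)"
proof (intro conjI exI)
  show "contravariant_functor dVS deV Phi Phi_map"
    by (rule contravariant_functor_Phi)
  show "contravariant_functor deV dVS Lambda Lambda_map"
    by (rule contravariant_functor_Lambda)
  have "dV_space (Lambda (RO_struct X)) \<and> dVS_iso X (Lambda (RO_struct X)) (eta X)"
    if X: "dV_space X" for X :: "'x topology"
  proof -
    interpret deVries_algebra "RO_struct X"
      by (rule deVries_algebra_RO_struct[OF X])
    have "eta X \<in> topspace X \<rightarrow>\<^sub>E topspace (Lambda (RO_struct X))"
      using reg_open_at_concordant[OF X] by (auto simp: eta_def)
    then show ?thesis
      using dV_space_Lambda homeomorphic_map_imp_dVS_iso[OF eta_homeomorphic_map[OF X]] by blast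
  qed
  then show "dVS_natural_iso_from_id (\<lambda>X. Lambda (Phi X))
      (\<lambda>X Y f. Lambda_map (Phi Y) (Phi X) (Phi_map X Y f)) (eta :: 'x topology \<Rightarrow> _)"
    unfolding dVS_natural_iso_from_id_def by (simp add: Phi_def eta_natural)
  show "deV_natural_iso_from_id (\<lambda>V. Phi (Lambda V))
      (\<lambda>V W h. Phi_map (Lambda W) (Lambda V) (Lambda_map V W h)) (eps :: 'a dv_struct \<Rightarrow> _)"
    unfolding deV_natural_iso_from_id_def
    by (simp add: Phi_def eps_natural deVries_morphismI deVries_algebra.deV_iso_eps
        deVries_algebra_RO_struct deVries_algebra.dV_space_Lambda)
qed

end
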